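(* Let $G$ be a connected real Lie group and $X$ a metric space equipped with a continuous $G$-action. Suppose $g_t$ is a non-trivial $\mathrm{Ad}$-diagonalizable (over $\mathbb R$) one-parameter subgroup of $G$ and $\varphi:[-1,1]\to\mathfrak g$ is a $g_t$-admissible curve satisfying the $\beta$-contraction hypothesis on $X$, with height function $f$. Then, for all $x\in X\setminus\{f=\infty\}$, the following hold. (1) The Hausdorff dimension of the set of $s\in[-1,1]$ for which the trajectory $g_tu(\varphi(s))x$ is divergent on average is at most $1-\beta$. (2) For Lebesgue almost every $s$, any weak-$*$ limit, as $T\to\infty$, of the measures $\frac1T\int_0^T\delta_{g_tu(\varphi(s))x}\,dt$ is a probability measure on $X$.
   Context: $\mathfrak g=\mathrm{Lie}(G)$ decomposes into eigenspaces $\mathfrak g=\bigoplus_\alpha\mathfrak g_\alpha$ of $\mathrm{Ad}(g_t)$, where $\alpha$ ranges over additive homomorphisms $\mathbb R\to\mathbb R$, $t\mapsto\alpha(t)$, and $\mathrm{Ad}(g_t)Y=e^{\alpha(t)}Y$ for $Y\in\mathfrak g_\alpha$. Write $u(Y)=\exp(Y)$. A map $\varphi:[-1,1]\to\mathfrak g$ is $g_t$-admissible if: (a) $\varphi$ is $C^{1+\gamma}$ for some $\gamma>0$ (i.e. $C^1$ with $\gamma$-Hölder derivative); (b) its image is contained in a subspace $V$ of a single eigenspace $\mathfrak g_\alpha$ with $\alpha(t)>0$ for $t>0$ and $[V,V]=0$; (c) $\dot\varphi$ does not vanish on $[-1,1]$. A $g_t$-admissible curve $\varphi:[-1,1]\to\mathfrak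 g_\alpha$ satisfies the $\beta$-contraction hypothesis on $X$ if there is a proper (Borel measurable) function $f:X\to(0,\infty]$, called a height function, such that: 1. $\{f=\infty\}$ is $G$-invariant and $f$ is bounded on compact subsets of $X\setminus\{f=\infty\}$; 2. for every bounded neighborhood $\mathcal O$ of the identity in $G$ there is $C_{\mathcal O}\ge1$ with $C_{\mathcal O}^{-1}f(x)\le f(gx)\le C_{\mathcal O}f(x)$ for all $g\in\mathcal O$, $x\in X$; 3. there is $\tilde c\ge1$ such that for all $t>0$ there is $\tilde b=\tilde b(t)>0$ such that for all $x\in X$ and $s\in[-1,1]$, $\frac12\int_{-1}^1f(g_tu(r\dot\varphi(s))x)\,dr\le\tilde ce^{-\beta\alpha(t)}f(x)+\tilde b$; 4. for all $M\ge1$, the set $X_{\le M}=\overline{\{x\in X:f(x)\le M\}}$ is compact. The orbit $g_ty$ is divergent on average if for every compact $Q\subset X$, $\lim_{T\to\infty}\frac1T\int_0^T\chi_Q(g_ty)\,dt=0$.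
   Formalization: The formal statement assumes β > 0, which the English leaves implicit in "β-contraction"; for β ≤ 0 part (2) can fail (affine group acting on R by translations, f(x) = 1+|x|: all orbits escape), while part (1) is trivial. *)

theory Defs
  imports "HOL-Analysis.Analysis" "HOL-Probability.Probability_Measure"
begin

section \<open>Smooth maps and manifolds\<close>

class group_mult = monoid_mult + inverse +
  assumes group_left_inverse: "inverse a * a = 1"

text \<open>Smoothness is only used on open sets.\<close>

fun Ck_on :: "nat \<Rightarrow> 'a::euclidean_space set \<Rightarrow> ('a \<Rightarrow> 'b::euclidean_space) \<Rightarrow> bool" where
  "Ck_on 0 S f \<longleftrightarrow> continuous_on S f"
| "Ck_on (Suc k) S f \<longleftrightarrow>
     (\<forall>x\<in>S. f differentiable (at x)) \<and> (\<forall>v. Ck_on k S (\<lambda>x. frechet_derivative f (at x) v))"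

definition smooth_on :: "'a::euclidean_space set \<Rightarrow> ('a \<Rightarrow> 'b::euclidean_space) \<Rightarrow> bool" where
  "smooth_on S f \<longleftrightarrow> (\<forall>k. Ck_on k S f)"

text \<open>A chart is a pair of its domain and its coordinate map; the values of the coordinate map
  outside the domain are irrelevant.\<close>

type_synonym ('m, 'e) chart = "'m set \<times> ('m \<Rightarrow> 'e)"

definition smooth_atlas :: "('m::topological_space, 'e::euclidean_space) chart set \<Rightarrow> bool" where
  "smooth_atlas A \<longleftrightarrow>
     (\<Union>(U, \<kappa>)\<in>A. U) = UNIV \<and>
     (\<forall>(U, \<kappa>)\<in>A. open U \<and> open (\<kappa> ` U) \<and> homeomorphism U (\<kappa> ` U) \<kappa> (inv_into U \<kappa>)) \<and>
     (\<forall>(U, \<kappa>)\<in>A. \<forall>(V, \<eta>)\<in>A. smooth_on (\<kappa> ` (U \<inter> V)) (\<eta> \<circ> inv_into U \<kappa>))"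

definition prod_atlas ::
  "('m, 'e) chart set \<Rightarrow> ('n, 'd) chart set \<Rightarrow> ('m \<times> 'n, 'e \<times> 'd) chart set" where
  "prod_atlas A B = {(U \<times> V, map_prod \<kappa> \<eta>) | U \<kappa> V \<eta>. (U, \<kappa>) \<in> A \<and> (V, \<eta>) \<in> B}"

definition smooth_map ::
  "('m::topological_space, 'e::euclidean_space) chart set \<Rightarrow>
   ('n::topological_space, 'd::euclidean_space) chart set \<Rightarrow> ('m \<Rightarrow> 'n) \<Rightarrow> bool" where
  "smooth_map A B f \<longleftrightarrow>
     continuous_on UNIV f \<and>
     (\<forall>(U, \<kappa>)\<in>A. \<forall>(V, \<eta>)\<in>B. smooth_on (\<kappa> ` (U \<inter> f -` V)) (\<eta> \<circ> f \<circ> inv_into U \<kappa>))"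


section \<open>Lie groups\<close>

definition lie_group ::
  "('g::{group_mult, t2_space, second_countable_topology}, 'e::euclidean_space) chart set \<Rightarrow> bool"
  where
  "lie_group A \<longleftrightarrow>
     smooth_atlas A \<and>
     smooth_map (prod_atlas A A) A (\<lambda>(g, h). g * h) \<and>
     smooth_map A A inverse"

text \<open>The Lie algebra is the tangent space at the identity. A chart \<open>(U, \<kappa>)\<close> around the
  identity identifies it with the model space \<open>'e\<close> through the differential of \<open>\<kappa>\<close> at \<open>1\<close>,
  and all Lie-theoretic notions below are written in these coordinates.\<close>

definition identity_chart :: "('g::group_mult, 'e) chart set \<Rightarrow> ('g, 'e) chart \<Rightarrow> bool" where
  "identity_chart A c \<longleftrightarrow> c \<in> A \<and> 1 \<in> fst c"

text \<open>The coordinate expression, near \<open>\<kappa> 1\<close>, of the left-invariant vector field with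
  value \<open>v\<close> at the identity, that is of \<open>g \<mapsto> d(L\<^sub>g)\<^sub>1 v\<close>.\<close>

definition left_invariant_field ::
  "('g::group_mult, 'e::euclidean_space) chart \<Rightarrow> 'e \<Rightarrow> 'e \<Rightarrow> 'e" where
  "left_invariant_field c v x =
     (let (U, \<kappa>) = c
      in frechet_derivative (\<lambda>y. \<kappa> (inv_into U \<kappa> x * inv_into U \<kappa> y)) (at (\<kappa> 1)) v)"

definition vector_field_bracket ::
  "('e::euclidean_space \<Rightarrow> 'e) \<Rightarrow> ('e \<Rightarrow> 'e) \<Rightarrow> 'e \<Rightarrow> 'e" where
  "vector_field_bracket P Q x =
     frechet_derivative Q (at x) (P x) - frechet_derivative P (at x) (Q x)"

definition lie_bracket ::
  "('g::group_mult, 'e::euclidean_space) chart \<Rightarrow> 'e \<Rightarrow> 'e \<Rightarrow> 'e" where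
  "lie_bracket c v w =
     vector_field_bracket (left_invariant_field c v) (left_invariant_field c w) (snd c 1)"

text \<open>\<open>Ad h\<close> is the differential at the identity of \<open>g \<mapsto> h g h\<^sup>-\<^sup>1\<close>.\<close>

definition Ad :: "('g::group_mult, 'e::euclidean_space) chart \<Rightarrow> 'g \<Rightarrow> 'e \<Rightarrow> 'e" where
  "Ad c h v =
     (let (U, \<kappa>) = c
      in frechet_derivative (\<lambda>y. \<kappa> (h * inv_into U \<kappa> y * inverse h)) (at (\<kappa> 1)) v)"

definition one_parameter_subgroup ::
  "(real \<Rightarrow> 'g::{group_mult, topological_space}) \<Rightarrow> bool" where
  "one_parameter_subgroup \<gamma> \<longleftrightarrow>
     continuous_on UNIV \<gamma> \<and> (\<forall>s t. \<gamma> (s + t) = \<gamma> s * \<gamma> t)"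

text \<open>\<open>exp v\<close> is the value at time \<open>1\<close> of the one-parameter subgroup with initial
  velocity \<open>v\<close>.\<close>

definition lie_exp ::
  "('g::{group_mult, topological_space}, 'e::euclidean_space) chart \<Rightarrow> 'e \<Rightarrow> 'g" where
  "lie_exp c v =
     (THE \<gamma>. one_parameter_subgroup \<gamma> \<and>
        ((\<lambda>t. snd c (\<gamma> t)) has_vector_derivative v) (at 0)) 1"

definition Ad_eigenspace ::
  "('g::group_mult, 'e::euclidean_space) chart \<Rightarrow> (real \<Rightarrow> 'g) \<Rightarrow> (real \<Rightarrow> real) \<Rightarrow> 'e set" where
  "Ad_eigenspace c g \<alpha> = {Y. \<forall>t. Ad c (g t) Y = exp (\<alpha> t) *\<^sub>R Y}"

text \<open>Eigenspaces for distinct \<open>\<alpha>\<close> are always independent, so the Lie algebra is their direct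
  sum as soon as they span it.\<close>

definition Ad_diagonalizable ::
  "('g::group_mult, 'e::euclidean_space) chart \<Rightarrow> (real \<Rightarrow> 'g) \<Rightarrow> bool" where
  "Ad_diagonalizable c g \<longleftrightarrow> span (\<Union>\<alpha>\<in>{\<alpha>. Modules.additive \<alpha>}. Ad_eigenspace c g \<alpha>) = UNIV"


section \<open>Admissible curves and the contraction hypothesis\<close>

definition continuous_action ::
  "('g::{group_mult, topological_space} \<Rightarrow> 'x::topological_space \<Rightarrow> 'x) \<Rightarrow> bool" where
  "continuous_action act \<longleftrightarrow>
     (\<forall>x. act 1 x = x) \<and>
     (\<forall>g h x. act (g * h) x = act g (act h x)) \<and>
     continuous_on UNIV (\<lambda>(g, x). act g x)"

definition velocity :: "(real \<Rightarrow> 'e::real_normed_vector) \<Rightarrow> real \<Rightarrow> 'e" where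
  "velocity \<phi> s = vector_derivative \<phi> (at s within {-1..1})"

text \<open>\<open>\<alpha>\<close> is the weight of the eigenspace that contains the curve; it is determined by the
  curve.\<close>

definition admissible_curve ::
  "('g::group_mult, 'e::euclidean_space) chart \<Rightarrow> (real \<Rightarrow> 'g) \<Rightarrow> (real \<Rightarrow> real) \<Rightarrow>
   (real \<Rightarrow> 'e) \<Rightarrow> bool" where
  "admissible_curve c g \<alpha> \<phi> \<longleftrightarrow>
     (\<forall>s\<in>{-1..1}. \<phi> differentiable (at s within {-1..1})) \<and>
     (\<exists>\<gamma>>0. \<exists>C. \<forall>s\<in>{-1..1}. \<forall>r\<in>{-1..1}.
        norm (velocity \<phi> s - velocity \<phi> r) \<le> C * \<bar>s - r\<bar> powr \<gamma>) \<and>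
     Modules.additive \<alpha> \<and> (\<forall>t>0. \<alpha> t > 0) \<and>
     (\<exists>V. subspace V \<and> V \<subseteq> Ad_eigenspace c g \<alpha> \<and>
        (\<forall>v\<in>V. \<forall>w\<in>V. lie_bracket c v w = 0) \<and> \<phi> ` {-1..1} \<subseteq> V) \<and>
     (\<forall>s\<in>{-1..1}. velocity \<phi> s \<noteq> 0)"

text \<open>\<open>f\<close> is a height function witnessing the \<open>\<beta>\<close>-contraction hypothesis. In a Lie group the
  bounded sets are the relatively compact ones.\<close>

definition contraction_height ::
  "('g::{group_mult, topological_space}, 'e::euclidean_space) chart \<Rightarrow>
   ('g \<Rightarrow> 'x::metric_space \<Rightarrow> 'x) \<Rightarrow> (real \<Rightarrow> 'g) \<Rightarrow> (real \<Rightarrow> real) \<Rightarrow> (real \<Rightarrow> 'e) \<Rightarrow>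
   real \<Rightarrow> ('x \<Rightarrow> ennreal) \<Rightarrow> bool" where
  "contraction_height c act g \<alpha> \<phi> \<beta> f \<longleftrightarrow>
     f \<in> borel_measurable borel \<and> (\<forall>x. f x > 0) \<and>
     (\<forall>h. act h ` {x. f x = \<infinity>} = {x. f x = \<infinity>}) \<and>
     (\<forall>K. compact K \<and> K \<subseteq> - {x. f x = \<infinity>} \<longrightarrow> (\<exists>B::real. \<forall>x\<in>K. f x \<le> ennreal B)) \<and>
     (\<forall>N. 1 \<in> interior N \<and> compact (closure N) \<longrightarrow>
        (\<exists>C\<ge>1::real. \<forall>h\<in>N. \<forall>x.
           ennreal (inverse C) * f x \<le> f (act h x) \<and> f (act h x) \<le> ennreal C * f x)) \<and>
     (\<exists>a\<ge>1::real. \<forall>t>0. \<exists>b>0::real. \<forall>x. \<forall>s\<in>{-1..1}.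
        ennreal (1 / 2) *
          (\<integral>\<^sup>+ r\<in>{-1..1}. f (act (g t) (act (lie_exp c (r *\<^sub>R velocity \<phi> s)) x)) \<partial>lborel)
        \<le> ennreal (a * exp (- \<beta> * \<alpha> t)) * f x + ennreal b) \<and>
     (\<forall>M\<ge>1::real. compact (closure {x. f x \<le> ennreal M}))"


section \<open>Hausdorff dimension\<close>

text \<open>The case distinction makes \<open>diam\<^sup>0 = 1\<close> also for singletons, where \<open>0 powr 0 = 0\<close>.\<close>

definition diameter_power :: "real \<Rightarrow> 'a::metric_space set \<Rightarrow> ennreal" where
  "diameter_power d U =
     (if U = {} then 0 else if d = 0 then 1 else ennreal (diameter U powr d))"

definition hausdorff_premeasure :: "real \<Rightarrow> real \<Rightarrow> 'a::metric_space set \<Rightarrow> ennreal" where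
  "hausdorff_premeasure d \<delta> S =
     (INF U\<in>{U :: nat \<Rightarrow> 'a set.
        S \<subseteq> (\<Union>n. U n) \<and> (\<forall>n. bounded (U n) \<and> diameter (U n) \<le> \<delta>)}.
      \<Sum>n. diameter_power d (U n))"

definition hausdorff_measure :: "real \<Rightarrow> 'a::metric_space set \<Rightarrow> ennreal" where
  "hausdorff_measure d S = (SUP \<delta>\<in>{0<..}. hausdorff_premeasure d \<delta> S)"

text \<open>Convention: the empty set has dimension \<open>-\<infinity>\<close>. An upper bound by a nonnegative number
  means the same as under the convention that it has dimension \<open>0\<close>; an upper bound by a
  negative number says that the set is empty.\<close>

definition hausdorff_dim :: "'a::metric_space set \<Rightarrow> ereal" where
  "hausdorff_dim S =
     (if S = {} then -\<infinity> else Inf {ereal d | d. d \<ge> 0 \<and> hausdorff_measure d S = 0})"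


section \<open>Divergence on average and weak-* limits\<close>

definition divergent_on_average :: "(real \<Rightarrow> 'x::topological_space) \<Rightarrow> bool" where
  "divergent_on_average y \<longleftrightarrow>
     (\<forall>Q. compact Q \<longrightarrow>
        ((\<lambda>T. (1 / T) * (LINT t:{0..T}|lborel. indicator Q (y t) :: real)) \<longlongrightarrow> 0) at_top)"

text \<open>The measure \<open>(1/T) \<integral>\<^sub>0\<^sup>T \<delta>\<^bsub>y t\<^esub> dt\<close>, for \<open>T > 0\<close>.\<close>

definition orbit_average :: "(real \<Rightarrow> 'x::topological_space) \<Rightarrow> real \<Rightarrow> 'x measure" where
  "orbit_average y T = distr (uniform_measure lborel {0..T}) borel y"

text \<open>\<open>L\<close> is a limit point, as \<open>T \<rightarrow> \<infinity>\<close>, of the measures \<open>\<mu> T\<close> as functionals on the function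
  space \<open>H\<close>. The dual of \<open>H\<close> need not be metrizable, hence limits along filters, which
  include limits along sequences tending to infinity.\<close>

definition weak_star_limit ::
  "('x \<Rightarrow> real) set \<Rightarrow> (real \<Rightarrow> 'x measure) \<Rightarrow> (('x \<Rightarrow> real) \<Rightarrow> real) \<Rightarrow> bool" where
  "weak_star_limit H \<mu> L \<longleftrightarrow>
     (\<exists>F. F \<noteq> bot \<and> F \<le> at_top \<and>
        (\<forall>\<psi>\<in>H. ((\<lambda>T. integral\<^sup>L (\<mu> T) \<psi>) \<longlongrightarrow> L \<psi>) F))"

definition bounded_continuous :: "('x::topological_space \<Rightarrow> real) set" where
  "bounded_continuous = {\<psi>. continuous_on UNIV \<psi> \<and> bounded (range \<psi>)}"

definition compactly_supported :: "('x::topological_space \<Rightarrow> real) set" where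
  "compactly_supported = {\<psi>. continuous_on UNIV \<psi> \<and> compact (closure {x. \<psi> x \<noteq> 0})}"

definition radon_measure :: "'x::topological_space measure \<Rightarrow> bool" where
  "radon_measure \<nu> \<longleftrightarrow>
     sets \<nu> = sets borel \<and>
     (\<forall>K. compact K \<longrightarrow> emeasure \<nu> K < \<infinity>) \<and>
     (\<forall>S\<in>sets borel. emeasure \<nu> S = (INF U\<in>{U. open U \<and> S \<subseteq> U}. emeasure \<nu> U)) \<and>
     (\<forall>U. open U \<longrightarrow> emeasure \<nu> U = (SUP K\<in>{K. compact K \<and> K \<subseteq> U}. emeasure \<nu> K))"

text \<open>Every weak-* limit of \<open>\<mu> T\<close>, as \<open>T \<rightarrow> \<infinity>\<close>, is a Borel probability measure. On an arbitrary
  metric space, measures are functionals on the bounded continuous functions; limits of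
  probability measures there are in general only finitely additive. On a locally compact
  space, measures are also functionals on the compactly supported continuous functions; limits
  there are Radon measures, in general of total mass less than \<open>1\<close>. (Without local compactness
  there may be no nonzero compactly supported continuous function at all.)\<close>

definition weak_star_limits_are_probabilities :: "(real \<Rightarrow> 'x::metric_space measure) \<Rightarrow> bool" where
  "weak_star_limits_are_probabilities \<mu> \<longleftrightarrow>
     (\<forall>L. weak_star_limit bounded_continuous \<mu> L \<longrightarrow>
        (\<exists>\<nu>. sets \<nu> = sets borel \<and> prob_space \<nu> \<and>
           (\<forall>\<psi>\<in>bounded_continuous. L \<psi> = integral\<^sup>L \<nu> \<psi>))) \<and>
     (locally compact (UNIV :: 'x set) \<longrightarrow>
        (\<forall>\<nu>. radon_measure \<nu> \<and> weak_star_limit compactly_supported \<mu> (integral\<^sup>L \<nu>) \<longrightarrow>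
           prob_space \<nu>))"

end

theory Submission
  imports Defs
begin

text \<open>The admissible curve enters only through two facts on the exponential map: \<open>exp\<close> is additive
  on commuting vectors and \<open>g\<^sub>t exp v g\<^sub>t\<^sup>-\<^sup>1 = exp (e\<^bsup>\<alpha>(t)\<^esup> v)\<close> on \<open>\<gg>\<^sub>\<alpha>\<close>. Both
  follow from describing \<open>exp v\<close> by its \<open>2\<^sup>n\<close>-th roots, which are \<open>v / 2\<^sup>n + o(2\<^sup>-\<^sup>n)\<close> in a chart and are
  determined by this; and \<open>[v, w] = 0\<close> makes \<open>Ad (exp t v) w\<close> constant in \<open>t\<close>.

  Choose \<open>t0\<close> such that \<open>e\<^bsup>\<alpha>(t0)\<^esup> = p\<close> is a large integer. At time \<open>n t0\<close> the curve is, on an interval of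
  length \<open>2 p\<^sup>-\<^sup>n\<close>, a bounded perturbation of a segment in the direction of its derivative, because
  \<open>\<phi>\<close> has a Hoelder derivative. So the contraction hypothesis bounds the sum of the heights at the
  \<open>p\<close> children of a node of the \<open>p\<close>-ary tree of intervals by \<open>C p\<^bsup>1-\<beta>\<^esup>\<close> times the height at the node, plus a
  constant. A weighted supermartingale on the tree then counts the nodes of level \<open>N\<close> whose
  ancestors rarely lie in \<open>{f \<le> M}\<close>. If an arbitrarily small proportion is allowed and \<open>p\<close>
  is large, these nodes give covers of Hausdorff dimension at most \<open>1 - \<beta>\<close>. If the proportion is close
  to 1 and \<open>M\<close> is large, their total length decays exponentially in \<open>N\<close>, and by Borel-Cantelli the
  orbit averages are tight for almost every \<open>s\<close>.\<close>

section \<open>Second differences of smooth maps\<close>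

text \<open>The contraction hypothesis concerns straight segments, while the theorem concerns a
  curve; passing from one to the other costs a constant factor \<open>K\<close> at every level of
  the tree. What saves the exponent is the order of choices: neither \<open>K\<close> nor the
  constant \<open>a\<close> of the hypothesis depends on the length of the time step, so a single
  long step makes their product negligible against a small power of \<open>p\<close>. The additive
  constant \<open>b\<close> does depend on the step and may be huge; it enters only through the
  threshold \<open>M\<close> and, for almost every \<open>s\<close>, through a small multiple
  \<kappa> of the height. \<open>lie_exp\<close> is specified by continuous one-parameter subgroups
  with a given velocity, so their existence and uniqueness are part of the proof. Dyadic roots
  replace differential equations. The main estimate behind them is that the mixed second difference
  of the multiplication is bounded by the product of the two increments. Conjugation is controlled
  in the chart only near 1, and global statements are recovered by taking powers.\<close>

lemma Ck_on_2D:
  assumes "Ck_on 2 S F"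
  shows "\<And>p. p \<in> S \<Longrightarrow> F differentiable (at p)"
    and "\<And>p u. p \<in> S \<Longrightarrow> (\<lambda>q. frechet_derivative F (at q) u) differentiable (at p)"
    and "\<And>u v. continuous_on S
      (\<lambda>p. frechet_derivative (\<lambda>q. frechet_derivative F (at q) u) (at p) v)"
  using assms by (auto simp: numeral_2_eq_2)

text \<open>Second derivatives are known to be continuous only for fixed directions. There are
  finitely many pairs of basis vectors, and this bound turns control of them into control that is
  uniform in all directions.\<close>

lemma bilinear_norm_bound_on_Basis:
  fixes h :: "'a::euclidean_space \<Rightarrow> 'b::euclidean_space \<Rightarrow> 'c::real_normed_vector"
  assumes "bilinear h" and "\<And>i j. i \<in> Basis \<Longrightarrow> j \<in> Basis \<Longrightarrow> norm (h i j) \<le> e"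
  shows "norm (h v w) \<le> (real DIM('a) * real DIM('b) * e) * norm v * norm w"
proof -
  have lin: "linear (\<lambda>v. h v w)" "linear (h v)" for v w
    using assms(1) by (auto simp: bilinear_def)
  have "h v w = (\<Sum>i\<in>Basis. \<Sum>j\<in>Basis. ((v \<bullet> i) * (w \<bullet> j)) *\<^sub>R h i j)"
  proof -
    have "h v w = h (\<Sum>i\<in>Basis. (v \<bullet> i) *\<^sub>R i) w"
      by (simp add: euclidean_representation)
    also have "\<dots> = (\<Sum>i\<in>Basis. (v \<bullet> i) *\<^sub>R h i w)"
      using linear_sum[OF lin(1)[of w], of "\<lambda>i. (v \<bullet> i) *\<^sub>R i" Basis] linear_scale[OF lin(1)[of w]]
      by (simp add: o_def)
    also have "\<dots> = (\<Sum>i\<in>Basis. (v \<bullet> i) *\<^sub>R h i (\<Sum>j\<in>Basis. (w \<bullet> j) *\<^sub>R j))"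
      by (simp add: euclidean_representation)
    also have "\<dots> = (\<Sum>i\<in>Basis. (v \<bullet> i) *\<^sub>R (\<Sum>j\<in>Basis. (w \<bullet> j) *\<^sub>R h i j))"
      using linear_sum[OF lin(2), of _ "\<lambda>i. (w \<bullet> i) *\<^sub>R i" Basis] linear_scale[OF lin(2)]
      by (simp add: o_def)
    finally show ?thesis by (simp add: scaleR_sum_right)
  qed
  also have "norm \<dots> \<le> (\<Sum>i\<in>(Basis::'a set). \<Sum>j\<in>(Basis::'b set). (norm v * norm w) * e)"
  proof (intro sum_norm_le)
    fix i j assume i: "i \<in> (Basis::'a set)" and j: "j \<in> (Basis::'b set)"
    have "\<bar>v \<bullet> i\<bar> * \<bar>w \<bullet> j\<bar> * norm (h i j) \<le> norm v * norm w * e"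
      by (intro mult_mono assms(2) Basis_le_norm i j) auto
    then show "norm (((v \<bullet> i) * (w \<bullet> j)) *\<^sub>R h i j) \<le> (norm v * norm w) * e"
      by (simp add: abs_mult)
  qed
  finally show ?thesis by (simp add: mult_ac)
qed

text \<open>For the multiplication of a Lie group in a chart, taken at the identity, this is the
  bilinear term of the product; its antisymmetric part is the Lie bracket.\<close>

definition mixed_derivative ::
  "('a::euclidean_space \<times> 'b::euclidean_space \<Rightarrow> 'c::euclidean_space) \<Rightarrow> 'a \<times> 'b \<Rightarrow> 'a \<Rightarrow> 'b \<Rightarrow> 'c" where
  "mixed_derivative F p v w =
     frechet_derivative (\<lambda>q. frechet_derivative F (at q) (0, w)) (at p) (v, 0)"

text \<open>Linearity in \<open>v\<close> is that of the outer derivative. Linearity in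
  \<open>w\<close> holds for the inner derivative at all points near \<open>p\<close>, and therefore
  passes to the outer one.\<close>

lemma bilinear_mixed_derivative:
  assumes C: "Ck_on 2 S F" and S: "open S" "p \<in> S"
  shows "bilinear (mixed_derivative F p)"
proof -
  note D = Ck_on_2D[OF C]
  have lin: "linear (frechet_derivative F (at q))" if "q \<in> S" for q
    using linear_frechet_derivative[OF D(1)[OF that]] .
  have 1: "linear (\<lambda>v. mixed_derivative F p v w)" for w
  proof -
    have "linear (frechet_derivative (\<lambda>q. frechet_derivative F (at q) (0, w)) (at p))"
      using linear_frechet_derivative[OF D(2)[OF S(2)]] .
    moreover have "linear (\<lambda>v. (v, 0::'b))" by (auto intro!: linearI)
    ultimately show ?thesis
      unfolding mixed_derivative_def by (rule linear_compose[unfolded o_def, rotated])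
  qed
  have d: "((\<lambda>q. frechet_derivative F (at q) (0, w)) has_derivative
     frechet_derivative (\<lambda>q. frechet_derivative F (at q) (0, w)) (at p)) (at p)" for w
    using D(2)[OF S(2)] frechet_derivative_works by blast
  have add: "mixed_derivative F p v (w + w') = mixed_derivative F p v w + mixed_derivative F p v w'" for v w w'
  proof -
    have "((\<lambda>q. frechet_derivative F (at q) (0, w + w')) has_derivative
       (\<lambda>u. frechet_derivative (\<lambda>q. frechet_derivative F (at q) (0, w)) (at p) u
          + frechet_derivative (\<lambda>q. frechet_derivative F (at q) (0, w')) (at p) u)) (at p)"
    proof (rule has_derivative_transform_within_open[OF has_derivative_add[OF d[of w] d[of w']] S])
      fix q assume "q \<in> S"
      from linear_add[OF lin[OF this], of "(0,w)" "(0,w')"]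
      show "frechet_derivative F (at q) (0, w) + frechet_derivative F (at q) (0, w') =
        frechet_derivative F (at q) (0, w + w')" by simp
    qed
    from fun_cong[OF frechet_derivative_at[OF this], of "(v, 0)"] show ?thesis
      by (simp add: mixed_derivative_def)
  qed
  have sc: "mixed_derivative F p v (r *\<^sub>R w) = r *\<^sub>R mixed_derivative F p v w" for v w r
  proof -
    have "((\<lambda>q. frechet_derivative F (at q) (0, r *\<^sub>R w)) has_derivative
       (\<lambda>u. r *\<^sub>R frechet_derivative (\<lambda>q. frechet_derivative F (at q) (0, w)) (at p) u)) (at p)"
    proof (rule has_derivative_transform_within_open[OF has_derivative_scaleR_right[OF d[of w], of r] S])
      fix q assume "q \<in> S"
      from linear_scale[OF lin[OF this], of r "(0,w)"]
      show "r *\<^sub>R frechet_derivative F (at q) (0, w) = frechet_derivative F (at q) (0, r *\<^sub>R w)" by simp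
    qed
    from fun_cong[OF frechet_derivative_at[OF this], of "(v, 0)"] show ?thesis
      by (simp add: mixed_derivative_def)
  qed
  show ?thesis using 1 add sc by (auto simp: bilinear_def intro!: linearI)
qed

text \<open>The mean value inequality is used twice: for the derivative in the second variable as a
  function of the first, then for the increment in the first variable as a function of the second.
  The error is a product of both increments and vanishes as soon as one of them does; a plain Taylor
  expansion would only give an error that is small against the square of their sum.\<close>

lemma mixed_difference_estimate:
  fixes F :: "'a::euclidean_space \<times> 'b::euclidean_space \<Rightarrow> 'c::euclidean_space"
  assumes C: "Ck_on 2 S F" and S: "open S" "(a, b) \<in> S" and "e > 0"
  obtains d where "d > 0" "ball a d \<times> ball b d \<subseteq> S"
    "\<And>x x' y y'. \<lbrakk>x \<in> ball a d; x' \<in> ball a d; y \<in> ball b d; y' \<in> ball b d\<rbrakk> \<Longrightarrow>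
       norm (F (x, y) - F (x', y) - F (x, y') + F (x', y')
         - mixed_derivative F (a, b) (x - x') (y - y')) \<le> e * norm (x - x') * norm (y - y')"
proof -
  note D = Ck_on_2D[OF C]
  let ?H = "mixed_derivative F"
  let ?N = "real DIM('a) * real DIM('b)"
  have N: "?N > 0" by simp
  have "\<forall>\<^sub>F p in nhds (a,b). \<forall>i\<in>Basis. \<forall>j\<in>Basis. norm (?H p i j - ?H (a,b) i j) < e / ?N"
  proof (intro eventually_ball_finite ballI finite_Basis)
    fix i :: 'a and j :: 'b
    have "continuous_on S (\<lambda>p. ?H p i j)"
      unfolding mixed_derivative_def by (rule D(3))
    then have "isCont (\<lambda>p. ?H p i j) (a,b)"
      using S continuous_on_eq_continuous_at by blast
    then have "((\<lambda>p. ?H p i j) \<longlongrightarrow> ?H (a,b) i j) (nhds (a,b))"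
      using tendsto_at_iff_tendsto_nhds[of "\<lambda>p. ?H p i j" "(a,b)"] by (simp add: isCont_def)
    then have "\<forall>\<^sub>F p in nhds (a,b). dist (?H p i j) (?H (a,b) i j) < e / ?N"
      using \<open>e > 0\<close> N by (intro tendstoD) auto
    then show "\<forall>\<^sub>F p in nhds (a,b). norm (?H p i j - ?H (a,b) i j) < e / ?N"
      by (simp add: dist_norm)
  qed
  then have "\<forall>\<^sub>F p in nhds (a,b). p \<in> S \<and> (\<forall>i\<in>Basis. \<forall>j\<in>Basis. norm (?H p i j - ?H (a,b) i j) < e / ?N)"
    using S by (intro eventually_conj eventually_nhds_in_open)
  then obtain T where T: "open T" "(a,b) \<in> T"
    "\<And>p. p \<in> T \<Longrightarrow> p \<in> S \<and> (\<forall>i\<in>Basis. \<forall>j\<in>Basis. norm (?H p i j - ?H (a,b) i j) < e / ?N)"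
    unfolding eventually_nhds by blast
  obtain A B where AB: "open A" "open B" "a \<in> A" "b \<in> B" "A \<times> B \<subseteq> T"
    using open_prod_elim[OF T(1,2)] by (metis SigmaE2 mem_Sigma_iff)
  obtain d1 d2 where d12: "d1 > 0" "ball a d1 \<subseteq> A" "d2 > 0" "ball b d2 \<subseteq> B"
    using AB by (meson open_contains_ball)
  define d where "d = min d1 d2"
  have d: "d > 0" "ball a d \<times> ball b d \<subseteq> T"
  proof -
    have "ball a d \<subseteq> A" "ball b d \<subseteq> B" using d12 by (auto simp: d_def subset_iff)
    then show "ball a d \<times> ball b d \<subseteq> T" using AB(5) by blast
  qed (use d12 in \<open>simp add: d_def\<close>)
  have bilH: "bilinear (?H p)" if "p \<in> S" for p
    by (rule bilinear_mixed_derivative[OF C S(1) that])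
  have Hb: "norm (?H p v w - ?H (a,b) v w) \<le> e * norm v * norm w" if p: "p \<in> T" for p v w
  proof -
    have b: "bilinear (\<lambda>v w. ?H p v w - ?H (a,b) v w)"
      using bilH[of p] bilH[of "(a,b)"] T(2,3) p
      by (auto simp: bilinear_def linear_compose_sub)
    show ?thesis
      using bilinear_norm_bound_on_Basis[OF b, of "e / ?N" v w] T(3)[OF p] N
      by (simp add: less_imp_le)
  qed
  have dF: "(F has_derivative frechet_derivative F (at p)) (at p)" if "p \<in> T" for p
    using D(1) T(3)[OF that] frechet_derivative_works by blast
  have dDF: "((\<lambda>q. frechet_derivative F (at q) u) has_derivative
      frechet_derivative (\<lambda>q. frechet_derivative F (at q) u) (at p)) (at p)" if "p \<in> T" for p u
    using D(2) T(3)[OF that] frechet_derivative_works by blast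
  have lin: "bounded_linear (?H (a,b) v)" "bounded_linear (\<lambda>v. ?H (a,b) v w)" for v w
    using bilH[OF S(2)] by (auto simp: bilinear_def linear_conv_bounded_linear)
  have step1: "norm (frechet_derivative F (at (x,y)) (0,w) - frechet_derivative F (at (x',y)) (0,w)
       - ?H (a,b) (x - x') w) \<le> (e * norm w) * norm (x - x')"
    if "x \<in> ball a d" "x' \<in> ball a d" "y \<in> ball b d" for x x' y w
  proof -
    have "norm ((frechet_derivative F (at (x,y)) (0,w) - ?H (a,b) x w) -
       (frechet_derivative F (at (x',y)) (0,w) - ?H (a,b) x' w)) \<le> (e * norm w) * norm (x - x')"
    proof (rule differentiable_bound[of "ball a d"
          "\<lambda>x. frechet_derivative F (at (x,y)) (0,w) - ?H (a,b) x w"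
          "\<lambda>x v. ?H (x,y) v w - ?H (a,b) v w"])
      fix z assume z: "z \<in> ball a d"
      then have zT: "(z,y) \<in> T" using d(2) that by auto
      have "((\<lambda>x. (x, y)) has_derivative (\<lambda>v. (v, 0))) (at z)"
        by (auto intro!: derivative_eq_intros)
      from diff_chain_at[OF this, of "\<lambda>q. frechet_derivative F (at q) (0,w)"] dDF[OF zT]
      have "((\<lambda>x. frechet_derivative F (at (x,y)) (0,w)) has_derivative (\<lambda>v. ?H (z,y) v w)) (at z)"
        unfolding mixed_derivative_def o_def by blast
      then show "((\<lambda>x. frechet_derivative F (at (x,y)) (0,w) - ?H (a,b) x w) has_derivative
          (\<lambda>v. ?H (z,y) v w - ?H (a,b) v w)) (at z within ball a d)"
        by (rule has_derivative_diff[OF has_derivative_at_withinI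
            bounded_linear_imp_has_derivative[OF lin(2)]])
      show "onorm (\<lambda>v. ?H (z,y) v w - ?H (a,b) v w) \<le> e * norm w"
        using Hb[OF zT, of _ w] by (intro onorm_le) (simp add: mult_ac)
    qed (use that in auto)
    then show ?thesis
      by (simp add: bilinear_lsub[OF bilH[OF S(2)], of x x' w] algebra_simps)
  qed
  have step2: "norm (F (x, y) - F (x', y) - F (x, y') + F (x', y')
         - mixed_derivative F (a, b) (x - x') (y - y')) \<le> e * norm (x - x') * norm (y - y')"
    if "x \<in> ball a d" "x' \<in> ball a d" "y \<in> ball b d" "y' \<in> ball b d" for x x' y y'
  proof -
    have "norm ((F (x,y) - F (x',y) - ?H (a,b) (x - x') y) - (F (x,y') - F (x',y') - ?H (a,b) (x - x') y'))
       \<le> e * norm (x - x') * norm (y - y')"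
    proof (rule differentiable_bound[of "ball b d"
          "\<lambda>y. F (x,y) - F (x',y) - ?H (a,b) (x - x') y"
          "\<lambda>y w. frechet_derivative F (at (x,y)) (0,w) - frechet_derivative F (at (x',y)) (0,w) - ?H (a,b) (x - x') w"])
      fix z assume z: "z \<in> ball b d"
      have dF1: "((\<lambda>y. F (c, y)) has_derivative (\<lambda>w. frechet_derivative F (at (c,z)) (0,w))) (at z)"
        if c: "c \<in> ball a d" for c
      proof -
        have cT: "(c,z) \<in> T" using d(2) c z by auto
        have "((\<lambda>x. (c, x)) has_derivative (\<lambda>v. (0, v))) (at z)"
          by (auto intro!: derivative_eq_intros)
        from diff_chain_at[OF this, of F] dF[OF cT]
        show ?thesis unfolding o_def by blast
      qed
      show "((\<lambda>y. F (x,y) - F (x',y) - ?H (a,b) (x - x') y) has_derivative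
        (\<lambda>w. frechet_derivative F (at (x,z)) (0,w) - frechet_derivative F (at (x',z)) (0,w) - ?H (a,b) (x - x') w)) (at z within ball b d)"
        by (rule has_derivative_at_withinI[OF has_derivative_diff[OF has_derivative_diff[OF
            dF1[OF that(1)] dF1[OF that(2)]] bounded_linear_imp_has_derivative[OF lin(1)]]])
      show "onorm (\<lambda>w. frechet_derivative F (at (x,z)) (0,w) - frechet_derivative F (at (x',z)) (0,w) - ?H (a,b) (x - x') w)
          \<le> e * norm (x - x')"
        using step1[OF that(1,2) z] by (intro onorm_le) (simp add: mult_ac)
    qed (use that in auto)
    then show ?thesis
      by (simp add: bilinear_rsub[OF bilH[OF S(2)], of "x - x'" y y'] algebra_simps)
  qed
  show ?thesis
    using that[of d] d step2 T(3) by blast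
qed

section \<open>The exponential map of a group with a chart\<close>

lemma group_mult_cancel_left [simp]:
  fixes a b c :: "'g::group_mult" shows "a * b = a * c \<longleftrightarrow> b = c"
  by (metis group_left_inverse mult.assoc mult_1)

lemma group_right_inverse [simp]: "(a::'g::group_mult) * inverse a = 1"
  by (metis group_mult_cancel_left group_left_inverse mult.assoc mult_1_right mult_1)

lemma group_inverse_unique: "a * b = 1 \<Longrightarrow> inverse (a::'g::group_mult) = b"
  by (metis group_mult_cancel_left group_right_inverse)

lemma group_inverse_mult: "inverse ((a::'g::group_mult) * b) = inverse b * inverse a"
  by (rule group_inverse_unique) (metis group_right_inverse mult.assoc mult_1_right)

lemma group_inverse_one [simp]: "inverse (1::'g::group_mult) = 1"
  by (rule group_inverse_unique) simp

lemma group_inverse_inverse [simp]: "inverse (inverse (a::'g::group_mult)) = a"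
  by (rule group_inverse_unique) (rule group_left_inverse)

lemma group_left_inverse_assoc [simp]: "inverse (a::'g::group_mult) * (a * b) = b"
  by (metis group_left_inverse mult.assoc mult_1)

lemma group_commute_power:
  "a * b = b * (a::'a::monoid_mult) \<Longrightarrow> a ^ n * b = b * a ^ n"
  by (induction n) (simp_all, metis mult.assoc)

text \<open>A chart centred at the identity: \<open>co\<close> is the coordinate, \<sigma> its
  inverse, and 1 has coordinate 0. The multiplication enters through its mixed second differences,
  its differentiability and the quadratic term \<open>B\<close>; higher derivatives do not
  appear.\<close>

locale topological_chart =
  fixes \<sigma> :: "'e::euclidean_space \<Rightarrow> 'g::{group_mult, t2_space}"
    and co :: "'g \<Rightarrow> 'e" and U :: "'g set" and R K :: real
    and B :: "'e \<Rightarrow> 'e \<Rightarrow> 'e"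
  assumes R: "R > 0" and K: "K > 0"
    and cont_mult: "continuous_on UNIV (\<lambda>(g::'g, h). g * h)"
    and cont_inv: "continuous_on UNIV (inverse :: 'g \<Rightarrow> 'g)"
    and open_U: "open U"
    and cont_co: "continuous_on U co"
    and cont_\<sigma>: "continuous_on (ball 0 R) \<sigma>"
    and \<sigma>_co: "h \<in> U \<Longrightarrow> \<sigma> (co h) = h"
    and co_\<sigma>: "norm x < R \<Longrightarrow> co (\<sigma> x) = x"
    and \<sigma>_in_U: "norm x < R \<Longrightarrow> \<sigma> x \<in> U"
    and \<sigma>_0 [simp]: "\<sigma> 0 = 1"
    and mult_in_U: "\<lbrakk>norm x < R; norm y < R\<rbrakk> \<Longrightarrow> \<sigma> x * \<sigma> y \<in> U"
    and mult_difference: "\<lbrakk>norm x < R; norm x' < R; norm y < R; norm y' < R\<rbrakk> \<Longrightarrow>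
      norm (co (\<sigma> x * \<sigma> y) - co (\<sigma> x' * \<sigma> y) - co (\<sigma> x * \<sigma> y') + co (\<sigma> x' * \<sigma> y'))
        \<le> K * norm (x - x') * norm (y - y')"
    and mult_differentiable: "\<lbrakk>norm x < R; norm y < R\<rbrakk> \<Longrightarrow>
      (\<lambda>p. co (\<sigma> (fst p) * \<sigma> (snd p))) differentiable (at (x, y))"
    and bilinear_B: "bilinear B"
    and mult_expansion: "\<epsilon> > 0 \<Longrightarrow> \<exists>\<delta>>0. \<forall>x y. norm x < \<delta> \<longrightarrow> norm y < \<delta> \<longrightarrow>
      norm (co (\<sigma> x * \<sigma> y) - x - y - B x y) \<le> \<epsilon> * norm x * norm y"
begin

definition W :: "'g set" where "W = {h \<in> U. norm (co h) < R}"

lemma W_D: "h \<in> W \<Longrightarrow> h \<in> U" "h \<in> W \<Longrightarrow> norm (co h) < R" "h \<in> W \<Longrightarrow> \<sigma> (co h) = h"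
  by (auto simp: W_def \<sigma>_co)

lemma \<sigma>_in_W: "norm x < R \<Longrightarrow> \<sigma> x \<in> W"
  by (simp add: W_def \<sigma>_in_U co_\<sigma>)

lemma open_W: "open W"
proof -
  have "W = U \<inter> co -` ball 0 R" by (auto simp: W_def)
  then show ?thesis
    using continuous_on_open_vimage[OF open_U, of co] cont_co by (simp add: Int_commute)
qed

lemma co_one [simp]: "co 1 = 0"
  using co_\<sigma>[of 0] R by simp

lemma one_in_W [simp]: "1 \<in> W"
  using \<sigma>_in_W[of 0] R by simp

lemma W_mult_in_U: "h \<in> W \<Longrightarrow> k \<in> W \<Longrightarrow> h * k \<in> U"
  using mult_in_U[of "co h" "co k"] W_D by simp

lemma co_mult_difference:
  assumes "h \<in> W" "h' \<in> W" "k \<in> W" "k' \<in> W"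
  shows "norm (co (h * k) - co (h' * k) - co (h * k') + co (h' * k'))
    \<le> K * norm (co h - co h') * norm (co k - co k')"
  using mult_difference[of "co h" "co h'" "co k" "co k'"] assms W_D by simp

lemma co_mult_bound:
  assumes "h \<in> W" "k \<in> W"
  shows "norm (co (h * k) - co h - co k) \<le> K * norm (co h) * norm (co k)"
  using co_mult_difference[of h 1 k 1] assms by (simp add: algebra_simps)

text \<open>Inserting \<open>h * k\<close> between the two squares gives two mixed differences. So
  squaring acts on distances like multiplication by 2, with a relative error proportional to the
  size of the factors.\<close>

lemma co_square_lipschitz:
  assumes "h \<in> W" "k \<in> W"
  shows "norm (co (h * h) - co (k * k) - 2 *\<^sub>R (co h - co k))
    \<le> K * (norm (co h) + norm (co k)) * norm (co h - co k)"
proof -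
  have 1: "norm (co (h * h) - co h - co (h * k) + co k) \<le> K * norm (co h) * norm (co h - co k)"
    using co_mult_difference[of h 1 h k] assms by simp
  have 2: "norm (co (h * k) - co (k * k) - co h + co k) \<le> K * norm (co h - co k) * norm (co k)"
    using co_mult_difference[of h k k 1] assms by simp
  have eq: "co (h * h) - co (k * k) - 2 *\<^sub>R (co h - co k) =
     (co (h * h) - co h - co (h * k) + co k) + (co (h * k) - co (k * k) - co h + co k)"
    by (simp add: scaleR_2 algebra_simps)
  show ?thesis
    unfolding eq by (rule order_trans[OF norm_triangle_mono[OF 1 2]]) (simp add: algebra_simps)
qed

lemma tendsto_group_mult:
  assumes "(f \<longlongrightarrow> (a::'g)) F" "(h \<longlongrightarrow> b) F"
  shows "((\<lambda>x. f x * h x) \<longlongrightarrow> a * b) F"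
proof -
  have "isCont (\<lambda>(g::'g, h). g * h) (a, b)"
    using cont_mult by (simp add: continuous_on_eq_continuous_at)
  from isCont_tendsto_compose[OF this tendsto_Pair[OF assms]] show ?thesis by simp
qed

lemma tendsto_group_inverse: "(f \<longlongrightarrow> (a::'g)) F \<Longrightarrow> ((\<lambda>x. inverse (f x)) \<longlongrightarrow> inverse a) F"
  using cont_inv by (simp add: continuous_on_eq_continuous_at isCont_tendsto_compose)

lemma tendsto_group_power: "(f \<longlongrightarrow> (a::'g)) F \<Longrightarrow> ((\<lambda>x. f x ^ n) \<longlongrightarrow> a ^ n) F"
  by (induction n) (auto intro: tendsto_group_mult)

lemma tendsto_co: "(f \<longlongrightarrow> a) F \<Longrightarrow> a \<in> U \<Longrightarrow> ((\<lambda>x. co (f x)) \<longlongrightarrow> co a) F"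
  using cont_co open_U by (simp add: continuous_on_eq_continuous_at isCont_tendsto_compose)

lemma tendsto_\<sigma>: "(f \<longlongrightarrow> a) F \<Longrightarrow> norm a < R \<Longrightarrow> ((\<lambda>x. \<sigma> (f x)) \<longlongrightarrow> \<sigma> a) F"
  using cont_\<sigma> by (simp add: continuous_on_eq_continuous_at isCont_tendsto_compose)

lemma eventually_in_W: "(f \<longlongrightarrow> 1) F \<Longrightarrow> \<forall>\<^sub>F x in F. f x \<in> W"
  by (rule topological_tendstoD[OF _ open_W one_in_W])

section \<open>Dyadic root sequences and their uniqueness\<close>

text \<open>These are to be the values \<open>a n = exp (v / 2 ^ n)\<close>. The description mixes
  algebra (iterated square roots) with an asymptotic velocity, so it is inherited by inverses, by
  conjugates and by products of commuting sequences.\<close>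

definition exp_seq :: "'e \<Rightarrow> (nat \<Rightarrow> 'g) \<Rightarrow> bool" where
  "exp_seq v a \<longleftrightarrow> (\<forall>n. a (Suc n) * a (Suc n) = a n) \<and> a \<longlonglongrightarrow> 1 \<and> (\<lambda>n. 2 ^ n *\<^sub>R co (a n)) \<longlonglongrightarrow> v"

lemma exp_seq_power: "exp_seq v a \<Longrightarrow> a n = a (n + k) ^ (2 ^ k)"
proof (induction k)
  case (Suc k)
  then have "a (n + k) = a (n + Suc k) ^ 2" by (simp add: exp_seq_def power2_eq_square)
  then show ?case using Suc by (simp add: power_mult)
qed simp

text \<open>Rescaled by \<open>2 ^ n\<close>, both sequences converge to \<open>v\<close>, so the
  rescaled distance \<open>D\<close> tends to 0. Passing from level \<open>Suc n\<close> down to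
  level \<open>n\<close> multiplies it by at most \<open>exp (c / 2 ^ Suc n)\<close>. These factors
  have a bounded product, so \<open>D 0\<close> is 0 as well.\<close>

lemma exp_seq_unique_in_W:
  assumes a: "exp_seq v a" and b: "exp_seq v b"
    and aW: "\<And>n. a n \<in> W" and bW: "\<And>n. b n \<in> W"
  shows "a 0 = b 0"
proof -
  let ?x = "\<lambda>n. co (a n)" and ?y = "\<lambda>n. co (b n)"
  have la: "(\<lambda>n. 2 ^ n *\<^sub>R ?x n) \<longlonglongrightarrow> v" and lb: "(\<lambda>n. 2 ^ n *\<^sub>R ?y n) \<longlonglongrightarrow> v"
    using a b by (auto simp: exp_seq_def)
  obtain C1 where C1: "\<And>n. norm (2 ^ n *\<^sub>R ?x n) \<le> C1"
    using convergent_imp_Bseq[OF convergentI[OF la]] unfolding Bseq_def by blast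
  obtain C2 where C2: "\<And>n. norm (2 ^ n *\<^sub>R ?y n) \<le> C2"
    using convergent_imp_Bseq[OF convergentI[OF lb]] unfolding Bseq_def by blast
  define c where "c = K * (C1 + C2)"
  define D where "D n = 2 ^ n * norm (?x n - ?y n)" for n
  have D_lim: "D \<longlonglongrightarrow> 0"
  proof -
    have "(\<lambda>n. norm (2 ^ n *\<^sub>R ?x n - 2 ^ n *\<^sub>R ?y n)) \<longlonglongrightarrow> norm (v - v)"
      by (intro tendsto_intros la lb)
    then show ?thesis
      unfolding D_def[abs_def] by (simp add: scaleR_diff_right[symmetric])
  qed
  have D0: "D n \<ge> 0" for n by (simp add: D_def)
  have c0: "c \<ge> 0"
    using K order_trans[OF norm_ge_zero C1[of 0]] order_trans[OF norm_ge_zero C2[of 0]]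
    by (simp add: c_def)
  have step: "D n \<le> exp (c / 2 ^ Suc n) * D (Suc n)" for n
  proof -
    let ?n = "Suc n"
    have x: "2 ^ ?n * norm (?x ?n) \<le> C1" and y: "2 ^ ?n * norm (?y ?n) \<le> C2"
      using C1[of ?n] C2[of ?n] by simp_all
    have "norm (?x n - ?y n) \<le> norm (2 *\<^sub>R (?x ?n - ?y ?n)) + norm (?x n - ?y n - 2 *\<^sub>R (?x ?n - ?y ?n))"
      using norm_triangle_sub by blast
    also have "norm (2 *\<^sub>R (?x ?n - ?y ?n)) = 2 * norm (?x ?n - ?y ?n)" by simp
    also have "norm (?x n - ?y n - 2 *\<^sub>R (?x ?n - ?y ?n))
        \<le> K * (norm (?x ?n) + norm (?y ?n)) * norm (?x ?n - ?y ?n)"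
      using co_square_lipschitz[OF aW[of ?n] bW[of ?n]] a b by (simp add: exp_seq_def)
    also have "\<dots> \<le> (K * ((C1 + C2) / 2 ^ ?n)) * norm (?x ?n - ?y ?n)"
      using K x y by (intro mult_right_mono mult_left_mono) (simp_all add: field_simps)
    finally have "norm (?x n - ?y n) \<le> (2 + c / 2 ^ ?n) * norm (?x ?n - ?y ?n)"
      by (simp add: c_def algebra_simps)
    also have "\<dots> \<le> (2 * exp (c / 2 ^ ?n)) * norm (?x ?n - ?y ?n)"
    proof (rule mult_right_mono)
      have "1 + c / 2 ^ ?n \<le> exp (c / 2 ^ ?n)" by (rule exp_ge_add_one_self)
      moreover have "c / 2 ^ ?n \<ge> 0" using c0 by simp
      ultimately show "2 + c / 2 ^ ?n \<le> 2 * exp (c / 2 ^ ?n)" by linarith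
    qed simp
    finally have "2 ^ n * norm (?x n - ?y n) \<le> 2 ^ n * ((2 * exp (c / 2 ^ ?n)) * norm (?x ?n - ?y ?n))"
      by (intro mult_left_mono) auto
    then show ?thesis by (simp add: D_def mult_ac)
  qed
  \<comment> \<open>\<open>c / 2 ^ n\<close> is the sum of all \<open>c / 2 ^ k\<close> with
    \<open>k > n\<close>. With this weight the step inequality becomes monotonicity, and an
    increasing sequence with limit 0 has no positive term.\<close>
  define w where "w n = exp (- (c / 2 ^ n)) * D n" for n
  have "w n \<le> w (Suc n)" for n
  proof -
    have "w n \<le> exp (- (c / 2 ^ n)) * (exp (c / 2 ^ Suc n) * D (Suc n))"
      unfolding w_def by (intro mult_left_mono step) auto
    also have "\<dots> = (exp (- (c / 2 ^ n)) * exp (c / 2 ^ Suc n)) * D (Suc n)"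
      by (simp only: mult.assoc)
    also have "exp (- (c / 2 ^ n)) * exp (c / 2 ^ Suc n) = exp (- (c / 2 ^ Suc n))"
      unfolding exp_add[symmetric] by (simp add: field_simps)
    finally show ?thesis by (simp add: w_def)
  qed
  then have inc: "incseq w" by (rule incseq_SucI)
  have "w \<longlonglongrightarrow> 0"
  proof (rule tendsto_sandwich[OF _ _ tendsto_const D_lim])
    show "\<forall>\<^sub>F n in sequentially. w n \<le> D n"
      using D0 c0 by (auto simp: w_def intro!: always_eventually mult_left_le_one_le)
  qed (use D0 in \<open>auto simp: w_def\<close>)
  from incseq_le[OF inc this, of 0] have "D 0 \<le> 0"
    by (simp add: w_def mult_le_0_iff)
  then have "?x 0 = ?y 0" by (simp add: D_def)
  then show ?thesis using W_D(3) aW bW by metis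
qed

lemma exp_seq_shift: "exp_seq v a \<Longrightarrow> exp_seq (v /\<^sub>R 2 ^ k) (\<lambda>n. a (n + k))"
proof -
  assume a: "exp_seq v a"
  have "(\<lambda>n. (1 / 2 ^ k) *\<^sub>R (2 ^ (n + k) *\<^sub>R co (a (n + k)))) \<longlonglongrightarrow> (1 / 2 ^ k) *\<^sub>R v"
    using a by (intro tendsto_intros LIMSEQ_ignore_initial_segment[of "\<lambda>n. 2 ^ n *\<^sub>R co (a n)"])
      (simp add: exp_seq_def)
  moreover have "(1 / 2 ^ k) *\<^sub>R (2 ^ (n + k) *\<^sub>R x) = 2 ^ n *\<^sub>R x" for n and x :: 'e
    by (simp add: power_add)
  ultimately have "(\<lambda>n. 2 ^ n *\<^sub>R co (a (n + k))) \<longlonglongrightarrow> (1 / 2 ^ k) *\<^sub>R v"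
    by (simp only:)
  then have "(\<lambda>n. 2 ^ n *\<^sub>R co (a (n + k))) \<longlonglongrightarrow> v /\<^sub>R 2 ^ k"
    by (simp add: divide_inverse)
  then show ?thesis
    using a by (auto simp: exp_seq_def intro: LIMSEQ_ignore_initial_segment)
qed

text \<open>Only the tails are known to lie in the chart. They start at a common element, and the
  initial terms of both sequences are the same power of it.\<close>

lemma exp_seq_unique: "exp_seq v a \<Longrightarrow> exp_seq v b \<Longrightarrow> a 0 = b 0"
proof -
  assume a: "exp_seq v a" and b: "exp_seq v b"
  have "\<forall>\<^sub>F n in sequentially. a n \<in> W \<and> b n \<in> W"
    using a b by (intro eventually_conj eventually_in_W) (auto simp: exp_seq_def)
  then obtain k where k: "\<And>n. n \<ge> k \<Longrightarrow> a n \<in> W \<and> b n \<in> W"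
    by (auto simp: eventually_sequentially)
  have "a (0 + k) = b (0 + k)"
    by (rule exp_seq_unique_in_W[OF exp_seq_shift[OF a] exp_seq_shift[OF b]]) (use k in auto)
  then show ?thesis
    using exp_seq_power[OF a, of 0 k] exp_seq_power[OF b, of 0 k] by simp
qed

lemma exp_seq_tendsto_co:
  assumes "exp_seq v a" shows "(\<lambda>n. co (a n)) \<longlonglongrightarrow> 0"
  using tendsto_co[of a 1 sequentially] assms W_D(1)[OF one_in_W] by (simp add: exp_seq_def)

text \<open>In the chart a product is a sum up to the product of the two norms. Rescaling by
  \<open>2 ^ n\<close> keeps one of these norms bounded while the other tends to 0.\<close>

lemma exp_seq_mult:
  assumes a: "exp_seq v a" and b: "exp_seq w b" and comm: "\<And>n. a n * b n = b n * a n"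
  shows "exp_seq (v + w) (\<lambda>n. a n * b n)"
  unfolding exp_seq_def
proof (intro conjI allI)
  fix n
  have "a (Suc n) * b (Suc n) * (a (Suc n) * b (Suc n))
      = (a (Suc n) * a (Suc n)) * (b (Suc n) * b (Suc n))"
    using comm[of "Suc n"] by (metis mult.assoc)
  then show "a (Suc n) * b (Suc n) * (a (Suc n) * b (Suc n)) = a n * b n"
    using a b by (simp add: exp_seq_def)
next
  show "(\<lambda>n. a n * b n) \<longlonglongrightarrow> 1"
    using tendsto_group_mult[of a 1 sequentially b 1] a b by (simp add: exp_seq_def)
next
  have ev: "\<forall>\<^sub>F n in sequentially. a n \<in> W \<and> b n \<in> W"
    using a b by (intro eventually_conj eventually_in_W) (auto simp: exp_seq_def)
  have la: "(\<lambda>n. 2 ^ n *\<^sub>R co (a n)) \<longlonglongrightarrow> v" and lb: "(\<lambda>n. 2 ^ n *\<^sub>R co (b n)) \<longlonglongrightarrow> w"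
    using a b by (auto simp: exp_seq_def)
  have "(\<lambda>n. 2 ^ n *\<^sub>R (co (a n * b n) - co (a n) - co (b n))) \<longlonglongrightarrow> 0"
  proof (rule Lim_null_comparison)
    show "\<forall>\<^sub>F n in sequentially. norm (2 ^ n *\<^sub>R (co (a n * b n) - co (a n) - co (b n)))
       \<le> K * norm (2 ^ n *\<^sub>R co (a n)) * norm (co (b n))"
      using ev
    proof eventually_elim
      case (elim n)
      have "2 ^ n * norm (co (a n * b n) - co (a n) - co (b n)) \<le> 2 ^ n * (K * norm (co (a n)) * norm (co (b n)))"
        using elim by (intro mult_left_mono co_mult_bound) auto
      then show ?case by (simp add: mult_ac)
    qed
    have "(\<lambda>n. K * norm (2 ^ n *\<^sub>R co (a n)) * norm (co (b n))) \<longlonglongrightarrow> K * norm v * norm (0::'e)"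
      by (intro tendsto_intros la exp_seq_tendsto_co[OF b])
    then show "(\<lambda>n. K * norm (2 ^ n *\<^sub>R co (a n)) * norm (co (b n))) \<longlonglongrightarrow> 0" by simp
  qed
  from tendsto_add[OF this tendsto_add[OF la lb]]
  show "(\<lambda>n. 2 ^ n *\<^sub>R co (a n * b n)) \<longlonglongrightarrow> v + w"
    by (simp add: algebra_simps)
qed

lemma exp_seq_inverse:
  assumes a: "exp_seq v a" shows "exp_seq (- v) (\<lambda>n. inverse (a n))"
  unfolding exp_seq_def
proof (intro conjI allI)
  show "inverse (a (Suc n)) * inverse (a (Suc n)) = inverse (a n)" for n
    using a by (simp add: exp_seq_def group_inverse_mult[symmetric])
  show inv1: "(\<lambda>n. inverse (a n)) \<longlonglongrightarrow> 1"
    using tendsto_group_inverse[of a 1 sequentially] a by (simp add: exp_seq_def)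
  have ev: "\<forall>\<^sub>F n in sequentially. a n \<in> W \<and> inverse (a n) \<in> W"
    using a inv1 by (intro eventually_conj eventually_in_W) (auto simp: exp_seq_def)
  have la: "(\<lambda>n. 2 ^ n *\<^sub>R co (a n)) \<longlonglongrightarrow> v"
    using a by (auto simp: exp_seq_def)
  have "(\<lambda>n. 2 ^ n *\<^sub>R (co (a n) + co (inverse (a n)))) \<longlonglongrightarrow> 0"
  proof (rule Lim_null_comparison)
    show "\<forall>\<^sub>F n in sequentially. norm (2 ^ n *\<^sub>R (co (a n) + co (inverse (a n))))
       \<le> K * norm (2 ^ n *\<^sub>R co (a n)) * norm (co (inverse (a n)))"
      using ev
    proof eventually_elim
      case (elim n)
      have "norm (co (a n * inverse (a n)) - co (a n) - co (inverse (a n)))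
          = norm (co (a n) + co (inverse (a n)))"
        using norm_minus_cancel[of "co (a n) + co (inverse (a n))"] by simp
      then have "2 ^ n * norm (co (a n) + co (inverse (a n))) \<le> 2 ^ n * (K * norm (co (a n)) * norm (co (inverse (a n))))"
        using co_mult_bound[of "a n" "inverse (a n)"] elim by (intro mult_left_mono) auto
      then show ?case by (simp add: mult_ac)
    qed
    have "(\<lambda>n. co (inverse (a n))) \<longlonglongrightarrow> 0"
      using tendsto_co[OF inv1] W_D(1)[OF one_in_W] by simp
    then have "(\<lambda>n. K * norm (2 ^ n *\<^sub>R co (a n)) * norm (co (inverse (a n)))) \<longlonglongrightarrow> K * norm v * norm (0::'e)"
      by (intro tendsto_intros la)
    then show "(\<lambda>n. K * norm (2 ^ n *\<^sub>R co (a n)) * norm (co (inverse (a n)))) \<longlonglongrightarrow> 0" by simp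
  qed
  from tendsto_diff[OF this la]
  show "(\<lambda>n. 2 ^ n *\<^sub>R co (inverse (a n))) \<longlonglongrightarrow> - v"
    by (simp add: algebra_simps)
qed

text \<open>Conjugation is a homomorphism and maps roots to roots; the velocity is transformed by
  its derivative at the identity. The element \<open>h\<close> may be far from 1.\<close>

lemma exp_seq_conj:
  assumes a: "exp_seq v a"
    and D: "((\<lambda>y. co (h * \<sigma> y * inverse h)) has_derivative A) (at 0)"
  shows "exp_seq (A v) (\<lambda>n. h * a n * inverse h)"
  unfolding exp_seq_def
proof (intro conjI allI)
  show "h * a (Suc n) * inverse h * (h * a (Suc n) * inverse h) = h * a n * inverse h" for n
    using a by (simp add: exp_seq_def mult.assoc) (metis mult.assoc)
  show "(\<lambda>n. h * a n * inverse h) \<longlonglongrightarrow> 1"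
    using tendsto_group_mult[OF tendsto_group_mult[OF tendsto_const, of a 1 sequentially h] tendsto_const, of "inverse h"] a
    by (simp add: exp_seq_def)
  have la: "(\<lambda>n. 2 ^ n *\<^sub>R co (a n)) \<longlonglongrightarrow> v"
    using a by (auto simp: exp_seq_def)
  have A: "bounded_linear A" using D by (rule has_derivative_bounded_linear)
  define f where "f y = co (h * \<sigma> y * inverse h)" for y
  have f0: "f 0 = 0" by (simp add: f_def)
  \<comment> \<open>The value at 0 is 0 because \<open>inverse 0 = 0\<close>. Hence \<open>g\<close>
    is continuous at 0 and terms with \<open>co (a n) = 0\<close> need no separate
    treatment.\<close>
  define g where "g y = (f y - A y) /\<^sub>R norm y" for y
  have "(g \<longlongrightarrow> 0) (at 0)"
    using D f0 unfolding has_derivative_at f_def[symmetric] g_def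
    by (simp add: divide_inverse mult.commute tendsto_norm_zero_iff[symmetric, of "\<lambda>y. (f y - A y) /\<^sub>R norm y"])
  moreover have "g 0 = 0" by (simp add: g_def)
  ultimately have "isCont g 0" by (simp add: isCont_def)
  then have g: "(\<lambda>n. g (co (a n))) \<longlonglongrightarrow> 0"
    using isCont_tendsto_compose[OF _ exp_seq_tendsto_co[OF a]] \<open>g 0 = 0\<close> by metis
  have eq: "f y = A y + norm y *\<^sub>R g y" for y
    using f0 linear_0[OF bounded_linear.linear[OF A]] by (cases "y = 0") (simp_all add: g_def)
  have "(\<lambda>n. A (2 ^ n *\<^sub>R co (a n)) + norm (2 ^ n *\<^sub>R co (a n)) *\<^sub>R g (co (a n))) \<longlonglongrightarrow> A v + norm v *\<^sub>R 0"
    by (intro tendsto_intros la g bounded_linear.tendsto[OF A])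
  moreover have "A (2 ^ n *\<^sub>R co (a n)) + norm (2 ^ n *\<^sub>R co (a n)) *\<^sub>R g (co (a n)) = 2 ^ n *\<^sub>R f (co (a n))" for n
    using linear_scale[OF bounded_linear.linear[OF A], of "2 ^ n"] by (simp add: eq algebra_simps)
  ultimately have "(\<lambda>n. 2 ^ n *\<^sub>R f (co (a n))) \<longlonglongrightarrow> A v" by simp
  moreover have "\<forall>\<^sub>F n in sequentially. a n \<in> W"
    using a by (intro eventually_in_W) (auto simp: exp_seq_def)
  ultimately show "(\<lambda>n. 2 ^ n *\<^sub>R co (h * a n * inverse h)) \<longlonglongrightarrow> A v"
    by (elim Lim_transform_eventually) (auto elim!: eventually_mono simp: f_def W_D)
qed

lemma exp_seq_one_parameter:
  assumes \<gamma>: "one_parameter_subgroup \<gamma>"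
    and D: "((\<lambda>t. co (\<gamma> t)) has_vector_derivative v) (at 0)"
  shows "exp_seq (t *\<^sub>R v) (\<lambda>n. \<gamma> (t / 2 ^ n))"
  unfolding exp_seq_def
proof (intro conjI allI)
  have hom: "\<gamma> (s + t) = \<gamma> s * \<gamma> t" for s t using \<gamma> by (simp add: one_parameter_subgroup_def)
  have \<gamma>0: "\<gamma> 0 = 1" using hom[of 0 0] group_mult_cancel_left[of "\<gamma> 0" "\<gamma> 0" 1] by simp
  show "\<gamma> (t / 2 ^ Suc n) * \<gamma> (t / 2 ^ Suc n) = \<gamma> (t / 2 ^ n)" for n
    by (simp add: hom[symmetric] field_simps)
  have t0: "(\<lambda>n. t / 2 ^ n) \<longlonglongrightarrow> 0"
    using LIMSEQ_divide_realpow_zero[of 2 t] by simp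
  have "isCont \<gamma> 0" using \<gamma> by (simp add: one_parameter_subgroup_def continuous_on_eq_continuous_at)
  from isCont_tendsto_compose[OF this t0] show "(\<lambda>n. \<gamma> (t / 2 ^ n)) \<longlonglongrightarrow> 1" by (simp add: \<gamma>0)
  show "(\<lambda>n. 2 ^ n *\<^sub>R co (\<gamma> (t / 2 ^ n))) \<longlonglongrightarrow> t *\<^sub>R v"
  proof (cases "t = 0")
    case False
    have "((\<lambda>h. norm (co (\<gamma> h) - h *\<^sub>R v) / \<bar>h\<bar>) \<longlongrightarrow> 0) (at 0)"
      using D by (simp add: has_vector_derivative_def has_derivative_at \<gamma>0)
    moreover have "filterlim (\<lambda>n. t / 2 ^ n) (at 0) sequentially"
      using t0 False by (intro filterlim_atI) auto
    ultimately have "(\<lambda>n. norm (co (\<gamma> (t / 2 ^ n)) - (t / 2 ^ n) *\<^sub>R v) / \<bar>t / 2 ^ n\<bar>) \<longlonglongrightarrow> 0"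
      by (rule filterlim_compose)
    from tendsto_mult_left[OF this, of "\<bar>t\<bar>"]
    have "(\<lambda>n. \<bar>t\<bar> * (norm (co (\<gamma> (t / 2 ^ n)) - (t / 2 ^ n) *\<^sub>R v) / \<bar>t / 2 ^ n\<bar>)) \<longlonglongrightarrow> 0"
      by simp
    moreover have "\<bar>t\<bar> * (norm (co (\<gamma> (t / 2 ^ n)) - (t / 2 ^ n) *\<^sub>R v) / \<bar>t / 2 ^ n\<bar>)
        = norm (2 ^ n *\<^sub>R co (\<gamma> (t / 2 ^ n)) - t *\<^sub>R v)" for n
    proof -
      have "2 ^ n *\<^sub>R co (\<gamma> (t / 2 ^ n)) - t *\<^sub>R v = 2 ^ n *\<^sub>R (co (\<gamma> (t / 2 ^ n)) - (t / 2 ^ n) *\<^sub>R v)"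
        by (simp add: scaleR_diff_right)
      then show ?thesis using False by (simp add: abs_divide)
    qed
    ultimately have "(\<lambda>n. norm (2 ^ n *\<^sub>R co (\<gamma> (t / 2 ^ n)) - t *\<^sub>R v)) \<longlonglongrightarrow> 0"
      by simp
    then show ?thesis by (simp add: tendsto_norm_zero_iff LIM_zero_iff)
  qed (simp add: \<gamma>0)
qed

section \<open>Existence of dyadic roots\<close>

text \<open>One more squaring doubles \<open>t\<close>, the length
  \<open>2 ^ k * norm (co s)\<close>. A bound of the shape \<open>t + K * t^2\<close> reproduces
  itself under this as long as \<open>K * t\<close> stays small.\<close>

lemma W_power_bound:
  assumes "s \<in> W" "K * (2 ^ k * norm (co s)) \<le> 1 / 3" "2 * (2 ^ k * norm (co s)) < R"
  shows "s ^ (2 ^ k) \<in> W \<and>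
    norm (co (s ^ (2 ^ k))) \<le> 2 ^ k * norm (co s) + K * (2 ^ k * norm (co s))\<^sup>2"
  using assms
proof (induction k)
  case 0
  then show ?case using K by simp
next
  case (Suc k)
  define t where "t = 2 ^ k * norm (co s)"
  define p where "p = s ^ (2 ^ k)"
  have t: "t \<ge> 0" "K * t \<le> 1 / 6" "4 * t < R" using Suc.prems by (simp_all add: t_def)
  have Kt: "K * t \<ge> 0" using K t by simp
  have "K * t \<le> 1 / 3" "2 * t < R" using t Kt by linarith+
  then have p: "p \<in> W" "norm (co p) \<le> t + K * t\<^sup>2"
    using Suc.IH[OF Suc.prems(1)] by (simp_all add: t_def p_def)
  have "s ^ (2 ^ Suc k) = p * p"
    by (simp add: p_def mult_2 power_add)
  moreover have "p * p \<in> U" using p W_mult_in_U by blast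
  moreover have "norm (co (p * p)) \<le> 2 * t + K * (2 * t)\<^sup>2"
  proof -
    have nonneg: "0 \<le> t + K * t\<^sup>2" using t K by simp
    have "norm (co (p * p)) \<le> norm (2 *\<^sub>R co p) + norm (co (p * p) - co p - co p)"
      using norm_triangle_sub[of "co (p * p)" "2 *\<^sub>R co p"] by (simp add: scaleR_2 algebra_simps)
    also have "\<dots> \<le> 2 * norm (co p) + K * norm (co p) * norm (co p)"
      using co_mult_bound[OF p(1) p(1)] by simp
    also have "\<dots> \<le> 2 * (t + K * t\<^sup>2) + K * (t + K * t\<^sup>2) * (t + K * t\<^sup>2)"
      using p(2) K nonneg by (intro add_mono mult_mono) auto
    also have "\<dots> = 2 * t + 2 * K * t\<^sup>2 + (K * t\<^sup>2) * (1 + K * t)\<^sup>2"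
      by (simp add: power2_eq_square algebra_simps)
    \<comment> \<open>\<open>K * t\<close> is at most 1/6, and \<open>2 + (7 / 6)^2\<close> is below
      4, which is the coefficient needed at length \<open>2 * t\<close>.\<close>
    also have "\<dots> \<le> 2 * t + 2 * K * t\<^sup>2 + (K * t\<^sup>2) * (7 / 6)\<^sup>2"
      using K t Kt by (intro add_left_mono mult_left_mono power_mono) auto
    also have "\<dots> \<le> 2 * t + K * (2 * t)\<^sup>2"
      using K by (simp add: power2_eq_square)
    finally show ?thesis .
  qed
  moreover have "2 * t + K * (2 * t)\<^sup>2 < R"
  proof -
    have "K * (2 * t)\<^sup>2 = (K * t) * (4 * t)" by (simp add: power2_eq_square)
    also have "\<dots> \<le> (1 / 6) * (4 * t)" using t by (intro mult_right_mono) auto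
    finally show ?thesis using t by simp
  qed
  moreover have "2 ^ Suc k * norm (co s) = 2 * t" by (simp add: t_def)
  ultimately show ?case by (simp only: W_def) simp
qed

text \<open>Each squaring multiplies the distance by at most 2 + 2/3. The crude factor 3 is enough:
  it will meet defects of order \<open>4 ^ (- n)\<close>, and \<open>(3 / 4) ^ n\<close> is
  summable.\<close>

lemma power_lipschitz:
  assumes s: "s \<in> W" "2 ^ k * norm (co s) \<le> T" and s': "s' \<in> W" "2 ^ k * norm (co s') \<le> T"
    and T: "K * T \<le> 1 / 3" "2 * T < R"
  shows "norm (co (s ^ (2 ^ k)) - co (s' ^ (2 ^ k))) \<le> 3 ^ k * norm (co s - co s')"
  using s(2) s'(2)
proof (induction k)
  case (Suc k)
  have half: "u ^ (2 ^ k) \<in> W \<and> norm (co (u ^ (2 ^ k))) \<le> T"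
    if u: "u \<in> W" "2 ^ Suc k * norm (co u) \<le> T" for u
  proof -
    define t where "t = 2 ^ k * norm (co u)"
    have t: "t \<ge> 0" "2 * t \<le> T" using u by (simp_all add: t_def)
    have KtT: "K * (2 * t) \<le> K * T" using K t by (intro mult_left_mono) auto
    have "u ^ (2 ^ k) \<in> W \<and> norm (co (u ^ (2 ^ k))) \<le> t + K * t\<^sup>2"
    proof -
      have "K * t \<le> 1 / 3" "2 * t < R" using KtT T t K mult_nonneg_nonneg[of K t] by linarith+
      then show ?thesis unfolding t_def by (intro W_power_bound u)
    qed
    moreover have "K * t\<^sup>2 \<le> t"
      using KtT T t mult_right_mono[of "K * t" 1 t] by (simp add: power2_eq_square)
    ultimately show ?thesis using t by linarith
  qed
  define p p' where "p = s ^ (2 ^ k)" and "p' = s' ^ (2 ^ k)"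
  have p: "p \<in> W" "norm (co p) \<le> T" and p': "p' \<in> W" "norm (co p') \<le> T"
    using half[OF s(1) Suc.prems(1)] half[OF s'(1) Suc.prems(2)] by (auto simp: p_def p'_def)
  have "norm (co p - co p') \<le> 3 ^ k * norm (co s - co s')"
    unfolding p_def p'_def
  proof (rule Suc.IH)
    have "2 ^ k * norm (co u) \<le> 2 ^ Suc k * norm (co u)" for u by simp
    then show "2 ^ k * norm (co s) \<le> T" "2 ^ k * norm (co s') \<le> T"
      using Suc.prems order_trans by blast+
  qed
  moreover have "norm (co (p * p) - co (p' * p')) \<le> 3 * norm (co p - co p')"
  proof -
    have "norm (co (p * p) - co (p' * p')) \<le> norm (2 *\<^sub>R (co p - co p'))
        + norm (co (p * p) - co (p' * p') - 2 *\<^sub>R (co p - co p'))"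
      using norm_triangle_sub by blast
    also have "norm (co (p * p) - co (p' * p') - 2 *\<^sub>R (co p - co p'))
        \<le> K * (norm (co p) + norm (co p')) * norm (co p - co p')"
      by (rule co_square_lipschitz[OF p(1) p'(1)])
    also have "K * (norm (co p) + norm (co p')) * norm (co p - co p') \<le> (K * (T + T)) * norm (co p - co p')"
      using p p' K by (intro mult_right_mono mult_left_mono add_mono) auto
    also have "\<dots> \<le> 1 * norm (co p - co p')"
      using T by (intro mult_right_mono) (auto simp: algebra_simps)
    finally show ?thesis by (simp del: scaleR_diff_right add: norm_scaleR)
  qed
  moreover have "s ^ (2 ^ Suc k) = p * p" "s' ^ (2 ^ Suc k) = p' * p'"
    by (simp_all add: p_def p'_def mult_2 power_add)
  ultimately show ?case by simp
qed simp

text \<open>The two bounds are what \<open>power_lipschitz\<close> asks for with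
  \<open>T = 2 * norm v\<close>, namely \<open>4 * norm v < R\<close> and
  \<open>K * norm v \<le> 1 / 6\<close>.\<close>

definition r0 :: real where "r0 = min (R / 5) (1 / (6 * K))"

lemma r0: "r0 > 0" and r0_D: "t \<le> r0 \<Longrightarrow> 4 * t < R" "t \<le> r0 \<Longrightarrow> K * t \<le> 1 / 6"
  using R K by (auto simp: r0_def field_simps)

text \<open>The classical limit of \<open>(1 + v / m) ^ m\<close> along \<open>m = 2 ^ n\<close>,
  with \<sigma> in the place of \<open>1 + v / m\<close>.\<close>

definition approx :: "nat \<Rightarrow> 'e \<Rightarrow> 'e" where
  "approx n v = co (\<sigma> (v /\<^sub>R 2 ^ n) ^ (2 ^ n))"

lemma norm_div_power2: "norm (v /\<^sub>R 2 ^ n) = norm v / 2 ^ n"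
  by (simp add: divide_inverse mult.commute)

lemma norm_div_power2_le: "norm (v /\<^sub>R 2 ^ n) \<le> norm v"
  using mult_left_mono[of 1 "2 ^ n" "norm v"] unfolding norm_div_power2 by (simp add: divide_le_eq)

lemma approx_in_W:
  assumes "norm v \<le> r0"
  shows "\<sigma> (v /\<^sub>R 2 ^ n) ^ (2 ^ n) \<in> W"
proof -
  have lt: "norm (v /\<^sub>R 2 ^ n) < R"
    using norm_div_power2_le[of n v] r0_D(1)[OF assms] norm_ge_zero[of v] by linarith
  then have "2 ^ n * norm (co (\<sigma> (v /\<^sub>R 2 ^ n))) = norm v"
    by (simp only: co_\<sigma> norm_div_power2) simp
  moreover have "2 * norm v < R" using r0_D(1)[OF assms] norm_ge_zero[of v] by linarith
  ultimately show ?thesis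
    using W_power_bound[of "\<sigma> (v /\<^sub>R 2 ^ n)" n] \<sigma>_in_W[OF lt] r0_D[OF assms] by simp
qed

text \<open>Both approximations are \<open>2 ^ n\<close>-th powers: of the square \<open>s'\<close>
  of \<sigma> at half a step, and of \<sigma> at the full step. One squaring has a defect of order
  \<open>(norm v)^2 / 4 ^ n\<close>, and taking the power enlarges it by at most
  \<open>3 ^ n\<close>.\<close>

lemma approx_step:
  assumes "norm v \<le> r0"
  shows "norm (approx (Suc n) v - approx n v) \<le> (K * (norm v)\<^sup>2 / 4) * (3 / 4) ^ n"
proof -
  define x where "x = v /\<^sub>R 2 ^ Suc n"
  define s where "s = \<sigma> (v /\<^sub>R 2 ^ n)"
  define s' where "s' = \<sigma> x * \<sigma> x"
  note v = r0_D[OF assms]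
  have lt: "norm (v /\<^sub>R 2 ^ m) < R" for m
    using norm_div_power2_le[of m v] v(1) norm_ge_zero[of v] by linarith
  have xx: "x + x = v /\<^sub>R 2 ^ n"
    by (simp add: x_def scaleR_add_left[symmetric])
  have cs: "co s = v /\<^sub>R 2 ^ n" and cx: "co (\<sigma> x) = x" and xW: "\<sigma> x \<in> W" and sW: "s \<in> W"
    using lt by (simp_all only: s_def x_def co_\<sigma> \<sigma>_in_W)
  have nx: "norm x = norm v / (2 * 2 ^ n)"
    using norm_div_power2[of "Suc n" v] by (simp add: x_def)
  have d: "norm (co s' - co s) \<le> K * (norm v)\<^sup>2 / 4 / 4 ^ n"
  proof -
    have "norm (co s' - co s) \<le> K * norm x * norm x"
      using co_mult_bound[OF xW xW] unfolding s'_def cs cx xx[symmetric] by (simp add: algebra_simps)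
    also have "\<dots> = K * (norm v)\<^sup>2 / 4 / 4 ^ n"
      by (simp add: nx power2_eq_square power_mult_distrib[symmetric])
    finally show ?thesis .
  qed
  have d2: "K * (norm v)\<^sup>2 / 4 / 4 ^ n \<le> norm v / 2 ^ n"
  proof -
    have "K * (norm v)\<^sup>2 / 4 = (K * norm v) * norm v / 4" by (simp add: power2_eq_square)
    also have "\<dots> \<le> (1 / 6) * norm v / 4" using v by (intro divide_right_mono mult_right_mono) auto
    also have "\<dots> \<le> norm v" by simp
    finally have "K * (norm v)\<^sup>2 / 4 / 4 ^ n \<le> norm v / 4 ^ n" by (rule divide_right_mono) simp
    also have "\<dots> \<le> norm v / 2 ^ n" by (intro divide_left_mono power_mono) auto
    finally show ?thesis .
  qed
  have ns: "norm (co s) = norm v / 2 ^ n" by (simp only: cs norm_div_power2)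
  have ns': "norm (co s') \<le> 2 * norm v / 2 ^ n"
    using norm_triangle_sub[of "co s'" "co s"] d d2 ns by simp
  have "2 * norm v / 2 ^ n \<le> 2 * norm v"
    using norm_div_power2_le[of n v] unfolding norm_div_power2 by simp
  then have s'W: "s' \<in> W"
  proof -
    have "norm (co s') < R"
      using \<open>2 * norm v / 2 ^ n \<le> 2 * norm v\<close> ns' v(1) norm_ge_zero[of v] by linarith
    then show ?thesis using W_mult_in_U[OF xW xW] by (simp add: W_def s'_def)
  qed
  have "norm (co (s' ^ (2 ^ n)) - co (s ^ (2 ^ n))) \<le> 3 ^ n * norm (co s' - co s)"
    using v ns ns' by (intro power_lipschitz[where T = "2 * norm v"] s'W sW) (auto simp: field_simps)
  also have "\<dots> \<le> 3 ^ n * (K * (norm v)\<^sup>2 / 4 / 4 ^ n)"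
    by (intro mult_left_mono d) simp
  also have "s' ^ (2 ^ n) = \<sigma> x ^ (2 ^ Suc n)"
    by (simp add: s'_def power_mult power2_eq_square)
  finally show ?thesis
    by (simp add: approx_def s_def x_def power_divide mult_ac)
qed

text \<open>The limit of \<open>approx n v\<close> written as a telescoping series, so that the
  Weierstrass test gives convergence uniform in \<open>v\<close> and thus continuity.\<close>

definition E :: "'e \<Rightarrow> 'e" where "E v = v + (\<Sum>n. approx (Suc n) v - approx n v)"

lemma approx_0: "norm v \<le> r0 \<Longrightarrow> approx 0 v = v"
proof -
  assume "norm v \<le> r0"
  then have "norm v < R" using r0_D(1)[of "norm v"] norm_ge_zero[of v] by linarith
  then show ?thesis by (simp add: approx_def co_\<sigma>)
qed

lemma summable_approx: "summable (\<lambda>n. (K * C / 4) * (3 / 4) ^ n :: real)"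
  by (intro summable_mult summable_geometric) simp

lemma uniform_limit_approx: "uniform_limit (cball 0 r0) approx E sequentially"
proof -
  have "uniform_limit (cball 0 r0) (\<lambda>n v. \<Sum>i<n. approx (Suc i) v - approx i v)
     (\<lambda>v. \<Sum>i. approx (Suc i) v - approx i v) sequentially"
  proof (rule Weierstrass_m_test[OF _ summable_approx[of "r0\<^sup>2"]])
    fix n and v :: 'e assume v: "v \<in> cball 0 r0"
    have "norm (approx (Suc n) v - approx n v) \<le> (K * (norm v)\<^sup>2 / 4) * (3 / 4) ^ n"
      using v by (intro approx_step) simp
    also have "\<dots> \<le> (K * r0\<^sup>2 / 4) * (3 / 4) ^ n"
      using v K by (intro mult_right_mono divide_right_mono mult_left_mono power_mono) auto
    finally show "norm (approx (Suc n) v - approx n v) \<le> (K * r0\<^sup>2 / 4) * (3 / 4) ^ n" .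
  qed
  moreover have "(\<Sum>i<n. approx (Suc i) v - approx i v) = approx n v - approx 0 v" for n v
    by (rule sum_lessThan_telescope[of "\<lambda>i. approx i v"])
  ultimately have "uniform_limit (cball 0 r0) (\<lambda>n v. approx n v - approx 0 v)
     (\<lambda>v. \<Sum>i. approx (Suc i) v - approx i v) sequentially"
    by simp
  from uniform_limit_add[OF uniform_limit_const this, of "\<lambda>v. v"]
  show ?thesis
    by (rule uniform_limit_cong'[THEN iffD1, rotated 2])
      (simp_all add: approx_0 E_def)
qed

lemma approx_tendsto: "norm v \<le> r0 \<Longrightarrow> (\<lambda>n. approx n v) \<longlonglongrightarrow> E v"
  using tendsto_uniform_limitI[OF uniform_limit_approx] by simp

lemma continuous_on_E: "continuous_on (cball 0 r0) E"
proof (rule uniform_limit_theorem[OF _ uniform_limit_approx])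
  show "\<forall>\<^sub>F n in sequentially. continuous_on (cball 0 r0) (approx n)"
  proof (intro always_eventually allI)
    fix n show "continuous_on (cball 0 r0) (approx n)"
      unfolding continuous_on_def approx_def
    proof
      fix v :: 'e assume "v \<in> cball 0 r0"
      then have v: "norm v \<le> r0" by simp
      have lt: "norm (v /\<^sub>R 2 ^ n) < R"
        using norm_div_power2_le[of n v] r0_D(1)[OF v] norm_ge_zero[of v] by linarith
      show "((\<lambda>v. co (\<sigma> (v /\<^sub>R 2 ^ n) ^ (2 ^ n))) \<longlongrightarrow> co (\<sigma> (v /\<^sub>R 2 ^ n) ^ (2 ^ n))) (at v within cball 0 r0)"
        by (intro tendsto_co tendsto_group_power tendsto_\<sigma> lt W_D(1) approx_in_W v tendsto_intros)
    qed
  qed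
qed simp

lemma E_bound: assumes v: "norm v \<le> r0" shows "norm (E v - v) \<le> K * (norm v)\<^sup>2"
proof -
  have "norm (\<Sum>n. approx (Suc n) v - approx n v) \<le> (\<Sum>n. (K * (norm v)\<^sup>2 / 4) * (3 / 4) ^ n)"
    by (rule norm_suminf_le[OF approx_step[OF v] summable_approx])
  also have "\<dots> = K * (norm v)\<^sup>2"
    by (subst suminf_mult) (simp_all add: suminf_geometric summable_geometric)
  finally show ?thesis by (simp add: E_def)
qed

lemma norm_E: assumes v: "norm v \<le> r0" shows "norm (E v) < R" "norm (E v) \<le> 2 * norm v"
proof -
  have "K * (norm v)\<^sup>2 = (K * norm v) * norm v" by (simp add: power2_eq_square)
  also have "\<dots> \<le> (1 / 6) * norm v" using r0_D[OF v] by (intro mult_right_mono) auto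
  finally have "norm (E v) \<le> norm v + 1 / 6 * norm v"
    using norm_triangle_sub[of "E v" v] E_bound[OF v] by simp
  then show "norm (E v) < R" "norm (E v) \<le> 2 * norm v"
    using r0_D[OF v] norm_ge_zero[of v] by linarith+
qed

text \<open>The square of the n-th approximation for \<open>v / 2\<close> is exactly the (n+1)-st
  approximation for \<open>v\<close>, and the identity passes to the limit.\<close>

lemma \<sigma>_E_double:
  assumes v: "norm v \<le> r0"
  shows "\<sigma> (E (v /\<^sub>R 2)) * \<sigma> (E (v /\<^sub>R 2)) = \<sigma> (E v)"
proof -
  have v2: "norm (v /\<^sub>R 2) \<le> r0" using v r0 by simp
  have \<sigma>a: "\<sigma> (approx n u) = \<sigma> (u /\<^sub>R 2 ^ n) ^ (2 ^ n)" if "norm u \<le> r0" for n u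
    using W_D(3)[OF approx_in_W[OF that]] by (simp add: approx_def)
  have l: "(\<lambda>n. \<sigma> (approx n u)) \<longlonglongrightarrow> \<sigma> (E u)" if "norm u \<le> r0" for u
    by (intro tendsto_\<sigma> approx_tendsto norm_E that)
  have "\<sigma> (approx n (v /\<^sub>R 2)) * \<sigma> (approx n (v /\<^sub>R 2)) = \<sigma> (approx (Suc n) v)" for n
  proof -
    have "v /\<^sub>R 2 /\<^sub>R 2 ^ n = v /\<^sub>R 2 ^ Suc n" by simp
    moreover have "s ^ (2 ^ n) * s ^ (2 ^ n) = s ^ (2 ^ Suc n)" for s :: 'g
      by (simp add: power_add[symmetric] mult_2[symmetric])
    ultimately show ?thesis by (simp only: \<sigma>a[OF v2] \<sigma>a[OF v])
  qed
  moreover have "(\<lambda>n. \<sigma> (approx (Suc n) v)) \<longlonglongrightarrow> \<sigma> (E v)"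
    using l[OF v] by (rule LIMSEQ_Suc)
  ultimately show ?thesis
    using LIMSEQ_unique[OF tendsto_group_mult[OF l[OF v2] l[OF v2]]] by simp
qed

lemma exp_seq_E:
  assumes v: "norm v \<le> r0"
  shows "exp_seq v (\<lambda>n. \<sigma> (E (v /\<^sub>R 2 ^ n)))"
  unfolding exp_seq_def
proof (intro conjI allI)
  have vn: "norm (v /\<^sub>R 2 ^ n) \<le> r0" for n
    using norm_div_power2_le[of n v] v by linarith
  show "\<sigma> (E (v /\<^sub>R 2 ^ Suc n)) * \<sigma> (E (v /\<^sub>R 2 ^ Suc n)) = \<sigma> (E (v /\<^sub>R 2 ^ n))" for n
    using \<sigma>_E_double[OF vn[of n]] by (simp add: mult.commute)
  have n0: "(\<lambda>n. norm v / 2 ^ n) \<longlonglongrightarrow> 0"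
    using LIMSEQ_divide_realpow_zero[of 2 "norm v"] by simp
  have "(\<lambda>n. E (v /\<^sub>R 2 ^ n)) \<longlonglongrightarrow> 0"
  proof (rule Lim_null_comparison[OF always_eventually])
    show "\<forall>n. norm (E (v /\<^sub>R 2 ^ n)) \<le> 2 * (norm v / 2 ^ n)"
      using norm_E(2)[OF vn] by (simp add: norm_div_power2[symmetric])
    show "(\<lambda>n. 2 * (norm v / 2 ^ n)) \<longlonglongrightarrow> 0" using tendsto_mult_left[OF n0, of 2] by simp
  qed
  then show "(\<lambda>n. \<sigma> (E (v /\<^sub>R 2 ^ n))) \<longlonglongrightarrow> 1"
    using tendsto_\<sigma>[of _ 0] R by simp
  have "(\<lambda>n. 2 ^ n *\<^sub>R co (\<sigma> (E (v /\<^sub>R 2 ^ n))) - v) \<longlonglongrightarrow> 0"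
  proof (rule Lim_null_comparison[OF always_eventually])
    show "\<forall>n. norm (2 ^ n *\<^sub>R co (\<sigma> (E (v /\<^sub>R 2 ^ n))) - v) \<le> K * norm v * (norm v / 2 ^ n)"
    proof
      fix n
      have "2 ^ n *\<^sub>R co (\<sigma> (E (v /\<^sub>R 2 ^ n))) - v = 2 ^ n *\<^sub>R (E (v /\<^sub>R 2 ^ n) - v /\<^sub>R 2 ^ n)"
        by (simp add: co_\<sigma>[OF norm_E(1)[OF vn]] scaleR_diff_right)
      then have "norm (2 ^ n *\<^sub>R co (\<sigma> (E (v /\<^sub>R 2 ^ n))) - v) = 2 ^ n * norm (E (v /\<^sub>R 2 ^ n) - v /\<^sub>R 2 ^ n)"
        by simp
      also have "\<dots> \<le> 2 ^ n * (K * (norm (v /\<^sub>R 2 ^ n))\<^sup>2)"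
        by (intro mult_left_mono E_bound vn) simp
      also have "\<dots> = K * norm v * (norm v / 2 ^ n)"
        unfolding norm_div_power2 by (simp add: power2_eq_square)
      finally show "norm (2 ^ n *\<^sub>R co (\<sigma> (E (v /\<^sub>R 2 ^ n))) - v) \<le> K * norm v * (norm v / 2 ^ n)" .
    qed
    show "(\<lambda>n. K * norm v * (norm v / 2 ^ n)) \<longlonglongrightarrow> 0"
      using tendsto_mult_left[OF n0, of "K * norm v"] by simp
  qed
  then show "(\<lambda>n. 2 ^ n *\<^sub>R co (\<sigma> (E (v /\<^sub>R 2 ^ n)))) \<longlonglongrightarrow> v"
    by (simp only: LIM_zero_iff)
qed

lemma exp_seq_double:
  assumes "exp_seq v a"
  shows "exp_seq (2 *\<^sub>R v) (\<lambda>n. case n of 0 \<Rightarrow> a 0 * a 0 | Suc m \<Rightarrow> a m)"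
  unfolding exp_seq_def
proof (intro conjI allI)
  let ?b = "\<lambda>n. case n of 0 \<Rightarrow> a 0 * a 0 | Suc m \<Rightarrow> a m"
  show "?b (Suc n) * ?b (Suc n) = ?b n" for n
    using assms by (cases n) (simp_all add: exp_seq_def)
  show "?b \<longlonglongrightarrow> 1"
    by (rule LIMSEQ_imp_Suc) (use assms in \<open>simp add: exp_seq_def\<close>)
  have "(\<lambda>n. 2 *\<^sub>R (2 ^ n *\<^sub>R co (a n))) \<longlonglongrightarrow> 2 *\<^sub>R v"
    using assms by (intro tendsto_intros) (simp add: exp_seq_def)
  then show "(\<lambda>n. 2 ^ n *\<^sub>R co (?b n)) \<longlonglongrightarrow> 2 *\<^sub>R v"
    by (intro LIMSEQ_imp_Suc[of "\<lambda>n. 2 ^ n *\<^sub>R co (?b n)"]) simp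
qed

text \<open>A long vector is halved until it lies in the ball of radius \<open>r0\<close>; every
  halving is undone by putting one more square in front of the sequence.\<close>

lemma exp_seq_exists: "\<exists>a. exp_seq v a"
proof -
  have "norm v \<le> 2 ^ k * r0 \<Longrightarrow> \<exists>a. exp_seq v a" for k v
  proof (induction k arbitrary: v)
    case 0 then show ?case using exp_seq_E by auto
  next
    case (Suc k)
    then obtain a where "exp_seq (v /\<^sub>R 2) a" by fastforce
    from exp_seq_double[OF this] show ?case by auto
  qed
  moreover obtain k where "norm v / r0 < 2 ^ k" using real_arch_pow[of 2] by auto
  then have "norm v \<le> 2 ^ k * r0" using r0 by (simp add: field_simps)
  ultimately show ?thesis by blast
qed

section \<open>The exponential map\<close>

definition lexp :: "'e \<Rightarrow> 'g" where "lexp v = (THE h. \<exists>a. exp_seq v a \<and> a 0 = h)"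

lemma lexp_eqI: "exp_seq v a \<Longrightarrow> lexp v = a 0"
  unfolding lexp_def using exp_seq_unique by blast

lemma exp_seq_lexp: "exp_seq v (\<lambda>n. lexp (v /\<^sub>R 2 ^ n))"
proof -
  obtain a where a: "exp_seq v a" using exp_seq_exists by blast
  have "lexp (v /\<^sub>R 2 ^ n) = a n" for n
    using lexp_eqI[OF exp_seq_shift[OF a, of n]] by simp
  then show ?thesis using a by simp
qed

lemma lexp_small: "norm v \<le> r0 \<Longrightarrow> lexp v = \<sigma> (E v)"
  using lexp_eqI[OF exp_seq_E] by simp

lemma lexp_power2: "lexp v = lexp (v /\<^sub>R 2 ^ k) ^ (2 ^ k)"
  using exp_seq_power[OF exp_seq_lexp[of v], of 0 k] by simp

lemma lexp_add:
  assumes "\<And>n. lexp (v /\<^sub>R 2 ^ n) * lexp (w /\<^sub>R 2 ^ n) = lexp (w /\<^sub>R 2 ^ n) * lexp (v /\<^sub>R 2 ^ n)"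
  shows "lexp (v + w) = lexp v * lexp w"
  using lexp_eqI[OF exp_seq_mult[OF exp_seq_lexp exp_seq_lexp assms]] by simp

lemma lexp_minus: "lexp (- v) = inverse (lexp v)"
  using lexp_eqI[OF exp_seq_inverse[OF exp_seq_lexp]] by simp

lemma lexp_zero [simp]: "lexp 0 = 1"
  by (rule lexp_eqI[of 0 "\<lambda>_. 1", simplified]) (simp add: exp_seq_def)

lemma lexp_conj:
  "((\<lambda>y. co (h * \<sigma> y * inverse h)) has_derivative A) (at 0) \<Longrightarrow>
    h * lexp v * inverse h = lexp (A v)"
  using lexp_eqI[OF exp_seq_conj[OF exp_seq_lexp]] by simp

lemma lexp_nat: "lexp (real j *\<^sub>R v) = lexp v ^ j"
proof (induction j arbitrary: v)
  case (Suc j)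
  have "real (Suc j) *\<^sub>R v = v + real j *\<^sub>R v" by (simp add: scaleR_add_left)
  moreover have "lexp (v + real j *\<^sub>R v) = lexp v * lexp (real j *\<^sub>R v)"
  proof (rule lexp_add)
    fix n
    have "(real j *\<^sub>R v) /\<^sub>R 2 ^ n = real j *\<^sub>R (v /\<^sub>R 2 ^ n)" by simp
    then show "lexp (v /\<^sub>R 2 ^ n) * lexp ((real j *\<^sub>R v) /\<^sub>R 2 ^ n)
       = lexp ((real j *\<^sub>R v) /\<^sub>R 2 ^ n) * lexp (v /\<^sub>R 2 ^ n)"
      by (simp only: Suc.IH power_commutes)
  qed
  ultimately show ?case by (simp add: Suc.IH)
qed simp

text \<open>Near a given \<open>v\<close> one fixed \<open>k\<close> serves for all arguments, and
  \<open>lexp\<close> is there a fixed power of the continuous map given by \<open>E\<close> and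
  \<sigma>.\<close>

lemma isCont_lexp: "isCont lexp v"
proof -
  obtain k where "norm v / r0 < 2 ^ k" using real_arch_pow[of 2] by auto
  then have v: "v \<in> ball 0 (2 ^ k * r0)" using r0 by (simp add: field_simps)
  have small: "u /\<^sub>R 2 ^ k \<in> ball 0 r0" if "u \<in> ball 0 (2 ^ k * r0)" for u :: 'e
    using that by (simp add: field_simps)
  have "isCont E u" if "u \<in> ball 0 r0" for u
    using continuous_on_subset[OF continuous_on_E ball_subset_cball] that
    by (simp add: continuous_on_eq_continuous_at)
  then have "((\<lambda>u. E (u /\<^sub>R 2 ^ k)) \<longlongrightarrow> E (v /\<^sub>R 2 ^ k)) (at v)"
    by (intro isCont_tendsto_compose[of _ E] tendsto_intros) (use small v in blast)
  then have "((\<lambda>u. \<sigma> (E (u /\<^sub>R 2 ^ k)) ^ (2 ^ k)) \<longlongrightarrow> \<sigma> (E (v /\<^sub>R 2 ^ k)) ^ (2 ^ k)) (at v)"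
    using small[OF v] by (intro tendsto_group_power tendsto_\<sigma> norm_E) simp_all
  moreover have eq: "lexp u = \<sigma> (E (u /\<^sub>R 2 ^ k)) ^ (2 ^ k)" if "u \<in> ball 0 (2 ^ k * r0)" for u
    using lexp_power2[of u k] lexp_small[of "u /\<^sub>R 2 ^ k"] small[OF that] by simp
  moreover have "\<forall>\<^sub>F u in at v. u \<in> ball 0 (2 ^ k * r0)"
    using v by (intro eventually_at_in_open') auto
  ultimately show ?thesis
    unfolding isCont_def eq[OF v] by (elim Lim_transform_eventually) (auto elim!: eventually_mono)
qed

lemma tendsto_lexp: "(f \<longlongrightarrow> v) F \<Longrightarrow> ((\<lambda>x. lexp (f x)) \<longlongrightarrow> lexp v) F"
  by (rule isCont_tendsto_compose[OF isCont_lexp])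

text \<open>Multiples of \<open>v\<close> with the same denominator \<open>n\<close> have
  exponentials that are powers of one element, so they commute. Such multiples approximate
  \<open>s\<close> and \<open>t\<close>, and \<open>lexp\<close> is continuous.\<close>

lemma lexp_commute_line_nonneg:
  assumes "s \<ge> 0" "t \<ge> 0"
  shows "lexp (s *\<^sub>R v) * lexp (t *\<^sub>R v) = lexp (t *\<^sub>R v) * lexp (s *\<^sub>R v)"
proof -
  define q where "q u n = real (nat \<lfloor>u * real n\<rfloor>) / real n" for u n
  have q: "(\<lambda>n. q u n) \<longlonglongrightarrow> u" if "u \<ge> 0" for u
  proof -
    have "(\<lambda>n. q u n - u) \<longlonglongrightarrow> 0"
    proof (rule Lim_null_comparison)
      show "\<forall>\<^sub>F n in sequentially. norm (q u n - u) \<le> 1 / real n"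
        using eventually_gt_at_top[of 0]
      proof eventually_elim
        case (elim n)
        have "real (nat \<lfloor>u * real n\<rfloor>) = of_int \<lfloor>u * real n\<rfloor>" using that by simp
        then have "\<bar>real (nat \<lfloor>u * real n\<rfloor>) - u * real n\<bar> \<le> 1" by linarith
        then have "\<bar>real (nat \<lfloor>u * real n\<rfloor>) - u * real n\<bar> / real n \<le> 1 / real n"
          by (intro divide_right_mono) auto
        moreover have "q u n - u = (real (nat \<lfloor>u * real n\<rfloor>) - u * real n) / real n"
          using elim by (simp add: q_def field_simps)
        ultimately show ?case by (simp add: abs_divide)
      qed
      show "(\<lambda>n. 1 / real n) \<longlonglongrightarrow> 0" by (rule lim_1_over_n)
    qed
    then show ?thesis by (simp only: LIM_zero_iff)
  qed
  have qv: "lexp (q u n *\<^sub>R v) = lexp (v /\<^sub>R real n) ^ nat \<lfloor>u * real n\<rfloor>" for u n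
    unfolding lexp_nat[symmetric] by (simp add: q_def divide_inverse)
  have comm: "lexp (q s n *\<^sub>R v) * lexp (q t n *\<^sub>R v) = lexp (q t n *\<^sub>R v) * lexp (q s n *\<^sub>R v)" for n
    unfolding qv power_add[symmetric] by (simp only: add.commute)
  have l: "(\<lambda>n. lexp (q s n *\<^sub>R v)) \<longlonglongrightarrow> lexp (s *\<^sub>R v)" "(\<lambda>n. lexp (q t n *\<^sub>R v)) \<longlonglongrightarrow> lexp (t *\<^sub>R v)"
    by (intro tendsto_lexp tendsto_intros q assms)+
  show ?thesis
    using LIMSEQ_unique[OF tendsto_group_mult[OF l] tendsto_group_mult[OF l(2) l(1), folded comm]] .
qed

lemma lexp_commute_line: "lexp (s *\<^sub>R v) * lexp (t *\<^sub>R v) = lexp (t *\<^sub>R v) * lexp (s *\<^sub>R v)"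
proof -
  have inv: "inverse a * b = b * inverse a" if "a * b = b * a" for a b :: 'g
    using that by (metis group_left_inverse_assoc group_right_inverse mult.assoc mult_1_right)
  have eq: "lexp (u *\<^sub>R v) = (if u \<ge> 0 then lexp (\<bar>u\<bar> *\<^sub>R v) else inverse (lexp (\<bar>u\<bar> *\<^sub>R v)))" for u
    by (auto simp: lexp_minus)
  have c: "lexp (\<bar>s\<bar> *\<^sub>R v) * lexp (\<bar>t\<bar> *\<^sub>R v) = lexp (\<bar>t\<bar> *\<^sub>R v) * lexp (\<bar>s\<bar> *\<^sub>R v)"
    by (rule lexp_commute_line_nonneg) auto
  show ?thesis
    unfolding eq[of s] eq[of t] using c inv[OF c] inv[OF c[symmetric]] inv[OF inv[OF c, symmetric]] by auto
qed

lemma lexp_add_line: "lexp ((s + t) *\<^sub>R v) = lexp (s *\<^sub>R v) * lexp (t *\<^sub>R v)"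
  unfolding scaleR_add_left
proof (rule lexp_add)
  show "lexp (s *\<^sub>R v /\<^sub>R 2 ^ n) * lexp (t *\<^sub>R v /\<^sub>R 2 ^ n) = lexp (t *\<^sub>R v /\<^sub>R 2 ^ n) * lexp (s *\<^sub>R v /\<^sub>R 2 ^ n)" for n
    using lexp_commute_line[of "inverse (2 ^ n) * s" v "inverse (2 ^ n) * t"] by simp
qed

lemma lexp_one_parameter: "one_parameter_subgroup (\<lambda>t. lexp (t *\<^sub>R v))"
  unfolding one_parameter_subgroup_def
  by (auto simp: lexp_add_line continuous_on_def intro!: tendsto_lexp tendsto_intros)

lemma co_lexp_bound: "norm v \<le> r0 \<Longrightarrow> norm (co (lexp v) - v) \<le> K * (norm v)\<^sup>2"
  using E_bound co_\<sigma>[OF norm_E(1)] by (simp add: lexp_small)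

lemma co_lexp_derivative: "((\<lambda>t. co (lexp (t *\<^sub>R v))) has_vector_derivative v) (at 0)"
  unfolding has_vector_derivative_def has_derivative_at
proof (intro conjI bounded_linear_intros)
  show "(\<lambda>h. norm (co (lexp ((0 + h) *\<^sub>R v)) - co (lexp (0 *\<^sub>R v)) - h *\<^sub>R v) / norm h) \<midarrow>0\<rightarrow> 0"
  proof (rule Lim_null_comparison)
    have "((\<lambda>h. norm (h *\<^sub>R v)) \<longlongrightarrow> norm (0 *\<^sub>R v)) (at (0::real))"
      by (intro tendsto_intros)
    then have "\<forall>\<^sub>F h in at (0::real). norm (h *\<^sub>R v) < r0"
      using r0 by (intro order_tendstoD(2)) auto
    then show "\<forall>\<^sub>F h in at (0::real). norm (norm (co (lexp ((0 + h) *\<^sub>R v)) - co (lexp (0 *\<^sub>R v)) - h *\<^sub>R v) / norm h)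
        \<le> K * (norm v)\<^sup>2 * \<bar>h\<bar>"
    proof eventually_elim
      case (elim h)
      have "norm (co (lexp (h *\<^sub>R v)) - h *\<^sub>R v) \<le> (K * (norm v)\<^sup>2 * \<bar>h\<bar>) * \<bar>h\<bar>"
        using co_lexp_bound[of "h *\<^sub>R v"] elim by (simp add: power_mult_distrib power2_eq_square mult_ac)
      then have "norm (co (lexp (h *\<^sub>R v)) - h *\<^sub>R v) / \<bar>h\<bar> \<le> K * (norm v)\<^sup>2 * \<bar>h\<bar>"
        using K by (cases "h = 0") (simp_all add: divide_le_eq)
      then show ?case by simp
    qed
    have "((\<lambda>h. K * (norm v)\<^sup>2 * \<bar>h\<bar>) \<longlongrightarrow> K * (norm v)\<^sup>2 * \<bar>0\<bar>) (at (0::real))"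
      by (intro tendsto_intros)
    then show "((\<lambda>h. K * (norm v)\<^sup>2 * \<bar>h\<bar>) \<longlongrightarrow> 0) (at (0::real))" by simp
  qed
qed

text \<open>The values of the subgroup at dyadic fractions of \<open>t\<close> form a root sequence,
  so uniqueness of root sequences gives uniqueness of one-parameter subgroups with a given
  velocity.\<close>

lemma one_parameter_eq_lexp:
  assumes "one_parameter_subgroup \<gamma>" "((\<lambda>t. co (\<gamma> t)) has_vector_derivative v) (at 0)"
  shows "\<gamma> t = lexp (t *\<^sub>R v)"
  using lexp_eqI[OF exp_seq_one_parameter[OF assms]] by simp

section \<open>The adjoint action\<close>

definition Adj :: "'g \<Rightarrow> 'e \<Rightarrow> 'e" where
  "Adj h = frechet_derivative (\<lambda>y. co (h * \<sigma> y * inverse h)) (at 0)"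

text \<open>For these \<open>h\<close>, conjugation is a composition of two multiplications that can
  both be carried out in the chart; this is where its differentiability at 0 is known.\<close>

definition N where "N = {h \<in> W. inverse h \<in> W}"

lemma eventually_in_N:
  assumes "(f \<longlongrightarrow> 1) F" shows "\<forall>\<^sub>F x in F. f x \<in> N"
  using eventually_in_W[OF assms] eventually_in_W[of "\<lambda>x. inverse (f x)" F]
    tendsto_group_inverse[OF assms] by (simp add: N_def eventually_conj)

lemma Adj_derivative:
  assumes "h \<in> N"
  shows "((\<lambda>y. co (h * \<sigma> y * inverse h)) has_derivative Adj h) (at 0)"
proof -
  have h: "norm (co h) < R" "\<sigma> (co h) = h" and h': "norm (co (inverse h)) < R" "\<sigma> (co (inverse h)) = inverse h"
    using assms W_D by (auto simp: N_def)
  let ?m = "\<lambda>p. co (\<sigma> (fst p) * \<sigma> (snd p))"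
  have d1: "(\<lambda>y. ?m (co h, y)) differentiable (at 0)"
    using differentiable_chain_at[of "\<lambda>y. (co h, y)" 0 ?m] mult_differentiable[OF h(1), of 0] R
    by (simp add: o_def differentiable_Pair)
  have "(\<lambda>z. ?m (z, co (inverse h))) differentiable (at (co h))"
    using differentiable_chain_at[of "\<lambda>z. (z, co (inverse h))" "co h" ?m] mult_differentiable[OF h(1) h'(1)]
    by (simp add: o_def differentiable_Pair)
  then have "(\<lambda>z. ?m (z, co (inverse h))) differentiable (at (?m (co h, 0)))"
    using h by simp
  from differentiable_chain_at[OF d1 this]
  obtain D where D: "((\<lambda>y. co (\<sigma> (co (h * \<sigma> y)) * inverse h)) has_derivative D) (at 0)"
    by (auto simp: o_def h h' differentiable_def)
  have "((\<lambda>y. co (h * \<sigma> y * inverse h)) has_derivative D) (at 0)"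
  proof (rule has_derivative_transform_within_open[OF D open_ball])
    show "0 \<in> ball (0::'e) R" using R by simp
    fix y :: 'e assume "y \<in> ball 0 R"
    then have "\<sigma> (co (h * \<sigma> y)) = h * \<sigma> y"
      using mult_in_U[OF h(1), of y] h(2) by (intro \<sigma>_co) simp
    then show "co (\<sigma> (co (h * \<sigma> y)) * inverse h) = co (h * \<sigma> y * inverse h)" by simp
  qed
  then show ?thesis
    unfolding Adj_def using frechet_derivative_works differentiable_def by blast
qed

lemma linear_Adj: "h \<in> N \<Longrightarrow> bounded_linear (Adj h)"
  by (rule has_derivative_bounded_linear[OF Adj_derivative])

lemma Adj_conj: "h \<in> N \<Longrightarrow> h * lexp v * inverse h = lexp (Adj h v)"
  by (rule lexp_conj[OF Adj_derivative])

lemma Adj_mult: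
  assumes h: "h \<in> N" and k: "k \<in> N" and hk: "h * k \<in> N"
  shows "Adj (h * k) w = Adj h (Adj k w)"
proof -
  let ?c = "\<lambda>h y. co (h * \<sigma> y * inverse h)"
  have 0: "?c k 0 = 0" by simp
  have D: "((\<lambda>y. ?c h (?c k y)) has_derivative (\<lambda>w. Adj h (Adj k w))) (at 0)"
    using diff_chain_at[of "?c k" "Adj k" 0 "?c h" "Adj h"] Adj_derivative[OF k] Adj_derivative[OF h]
    by (simp add: o_def)
  have "(\<sigma> \<longlongrightarrow> \<sigma> 0) (at 0)" by (rule tendsto_\<sigma>) (use R in auto)
  then have "((\<lambda>y. k * \<sigma> y * inverse k) \<longlongrightarrow> k * \<sigma> 0 * inverse k) (at 0)"
    by (intro tendsto_group_mult tendsto_const)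
  then have "\<forall>\<^sub>F y in at 0. k * \<sigma> y * inverse k \<in> W"
    by (intro eventually_in_W) simp
  then have ev: "\<forall>\<^sub>F y in at 0. ?c h (?c k y) = ?c (h * k) y"
    by eventually_elim (simp add: W_D group_inverse_mult mult.assoc)
  have "((\<lambda>y. ?c (h * k) y) has_derivative (\<lambda>w. Adj h (Adj k w))) (at 0)"
    by (rule has_derivative_transform_eventually[OF D ev]) simp_all
  from fun_cong[OF has_derivative_unique[OF Adj_derivative[OF hk] this], of w] show ?thesis .
qed

section \<open>The adjoint action near the identity\<close>

lemma co_mult_expansion:
  assumes "\<epsilon> > 0"
  obtains \<delta> where "\<delta> > 0" "\<delta> \<le> R"
    "\<And>h k. \<lbrakk>h \<in> W; k \<in> W; norm (co h) < \<delta>; norm (co k) < \<delta>\<rbrakk> \<Longrightarrow>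
      norm (co (h * k) - co h - co k - B (co h) (co k)) \<le> \<epsilon> * norm (co h) * norm (co k)"
proof -
  from mult_expansion[OF assms] obtain d where d: "d > 0"
    "\<And>x y. norm x < d \<Longrightarrow> norm y < d \<Longrightarrow> norm (co (\<sigma> x * \<sigma> y) - x - y - B x y) \<le> \<epsilon> * norm x * norm y"
    by blast
  show ?thesis
  proof (rule that[of "min d R"])
    fix h k assume "h \<in> W" "k \<in> W" "norm (co h) < min d R" "norm (co k) < min d R"
    then show "norm (co (h * k) - co h - co k - B (co h) (co k)) \<le> \<epsilon> * norm (co h) * norm (co k)"
      using d(2)[of "co h" "co k"] W_D(3) by simp
  qed (use d R in auto)
qed

lemma bounded_bilinear_B: "bounded_bilinear B"
  using bilinear_conv_bounded_bilinear bilinear_B by blast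

text \<open>The roots \<open>a n\<close> of \<open>lexp w\<close> and their conjugates
  \<open>b n\<close> satisfy \<open>h * a n = b n * h\<close>. Expanding both products to second
  order, rescaling by \<open>2 ^ n\<close> and letting \<open>n\<close> tend to infinity compares
  \<open>w\<close> with \<open>Adj h w\<close>. The unknown \<open>Adj h w\<close> still occurs on
  the right-hand side.\<close>

lemma Adj_near_one_implicit:
  assumes e: "e > 0"
    and exp: "\<And>h k. \<lbrakk>h \<in> W; k \<in> W; norm (co h) < \<delta>; norm (co k) < \<delta>\<rbrakk> \<Longrightarrow>
      norm (co (h * k) - co h - co k - B (co h) (co k)) \<le> e * norm (co h) * norm (co k)"
    and \<delta>: "\<delta> > 0" and h: "h \<in> N" "norm (co h) < \<delta>"
  shows "norm (Adj h w - w - (B (co h) w - B (Adj h w) (co h))) \<le> e * norm (co h) * (norm w + norm (Adj h w))"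
    and "norm (Adj h w - w) \<le> K * norm (co h) * (norm w + norm (Adj h w))"
proof -
  interpret B: bounded_bilinear B by (rule bounded_bilinear_B)
  let ?x = "co h"
  define a where "a n = lexp (w /\<^sub>R 2 ^ n)" for n
  define b where "b n = h * a n * inverse h" for n
  have a: "exp_seq w a" unfolding a_def[abs_def] by (rule exp_seq_lexp)
  have b: "exp_seq (Adj h w) b" unfolding b_def[abs_def] by (rule exp_seq_conj[OF a Adj_derivative[OF h(1)]])
  have hW: "h \<in> W" using h by (simp add: N_def)
  define y z where "y n = 2 ^ n *\<^sub>R co (a n)" and "z n = 2 ^ n *\<^sub>R co (b n)" for n
  have y: "y \<longlonglongrightarrow> w" and z: "z \<longlonglongrightarrow> Adj h w"
    using a b by (simp_all add: exp_seq_def y_def[abs_def] z_def[abs_def])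
  have small: "\<forall>\<^sub>F n in sequentially. norm (co (c n)) < \<delta>" if "exp_seq u c" for u c
    using tendsto_norm[OF exp_seq_tendsto_co[OF that]] \<delta> by (intro order_tendstoD(2)) auto
  have ev: "\<forall>\<^sub>F n in sequentially. a n \<in> W \<and> b n \<in> W \<and> norm (co (a n)) < \<delta> \<and> norm (co (b n)) < \<delta>"
    using a b by (intro eventually_conj eventually_in_W small[OF a] small[OF b]) (auto simp: exp_seq_def)
  have eq: "h * a n = b n * h" for n by (simp add: b_def mult.assoc group_left_inverse)
  show "norm (Adj h w - w - (B ?x w - B (Adj h w) ?x)) \<le> e * norm ?x * (norm w + norm (Adj h w))"
  proof (rule tendsto_le[OF trivial_limit_sequentially])
    show "(\<lambda>n. norm (z n - y n - (B ?x (y n) - B (z n) ?x))) \<longlonglongrightarrow> norm (Adj h w - w - (B ?x w - B (Adj h w) ?x))"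
      by (intro tendsto_intros y z B.tendsto)
    show "(\<lambda>n. e * norm ?x * (norm (y n) + norm (z n))) \<longlonglongrightarrow> e * norm ?x * (norm w + norm (Adj h w))"
      by (intro tendsto_intros y z)
    show "\<forall>\<^sub>F n in sequentially. norm (z n - y n - (B ?x (y n) - B (z n) ?x)) \<le> e * norm ?x * (norm (y n) + norm (z n))"
      using ev
    proof eventually_elim
      case (elim n)
      let ?y = "co (a n)" and ?z = "co (b n)"
      have 1: "norm (co (h * a n) - ?x - ?y - B ?x ?y) \<le> e * norm ?x * norm ?y"
        using elim h hW by (intro exp) auto
      have 2: "norm (co (b n * h) - ?z - ?x - B ?z ?x) \<le> e * norm ?z * norm ?x"
        using elim h hW by (intro exp) auto
      have "norm (?z - ?y - (B ?x ?y - B ?z ?x)) =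
          norm ((co (h * a n) - ?x - ?y - B ?x ?y) - (co (b n * h) - ?z - ?x - B ?z ?x))"
        by (simp add: eq algebra_simps)
      also have "\<dots> \<le> e * norm ?x * norm ?y + e * norm ?z * norm ?x"
        using norm_triangle_le_diff[OF add_mono[OF 1 2]] .
      finally have "2 ^ n * norm (?z - ?y - (B ?x ?y - B ?z ?x)) \<le> 2 ^ n * (e * norm ?x * norm ?y + e * norm ?z * norm ?x)"
        by (intro mult_left_mono) auto
      moreover have "z n - y n - (B ?x (y n) - B (z n) ?x) = 2 ^ n *\<^sub>R (?z - ?y - (B ?x ?y - B ?z ?x))"
        by (simp add: y_def z_def B.scaleR_left B.scaleR_right scaleR_diff_right)
      then have "norm (z n - y n - (B ?x (y n) - B (z n) ?x)) = 2 ^ n * norm (?z - ?y - (B ?x ?y - B ?z ?x))"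
        by (simp only: norm_scaleR) simp
      moreover have "2 ^ n * (e * norm ?x * norm ?y + e * norm ?z * norm ?x) = e * norm ?x * (norm (y n) + norm (z n))"
        by (simp add: y_def z_def algebra_simps)
      ultimately show ?case by (simp only:)
    qed
  qed
  show "norm (Adj h w - w) \<le> K * norm ?x * (norm w + norm (Adj h w))"
  proof (rule tendsto_le[OF trivial_limit_sequentially])
    show "(\<lambda>n. norm (z n - y n)) \<longlonglongrightarrow> norm (Adj h w - w)"
      by (intro tendsto_intros y z)
    show "(\<lambda>n. K * norm ?x * (norm (y n) + norm (z n))) \<longlonglongrightarrow> K * norm ?x * (norm w + norm (Adj h w))"
      by (intro tendsto_intros y z)
    show "\<forall>\<^sub>F n in sequentially. norm (z n - y n) \<le> K * norm ?x * (norm (y n) + norm (z n))"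
      using ev
    proof eventually_elim
      case (elim n)
      let ?y = "co (a n)" and ?z = "co (b n)"
      have 1: "norm (co (h * a n) - ?x - ?y) \<le> K * norm ?x * norm ?y"
        using elim hW by (intro co_mult_bound) auto
      have 2: "norm (co (b n * h) - ?z - ?x) \<le> K * norm ?z * norm ?x"
        using elim hW by (intro co_mult_bound) auto
      have "norm (?z - ?y) = norm ((co (h * a n) - ?x - ?y) - (co (b n * h) - ?z - ?x))"
        by (simp add: eq algebra_simps)
      also have "\<dots> \<le> K * norm ?x * norm ?y + K * norm ?z * norm ?x"
        using norm_triangle_le_diff[OF add_mono[OF 1 2]] .
      finally have "2 ^ n * norm (?z - ?y) \<le> 2 ^ n * (K * norm ?x * norm ?y + K * norm ?z * norm ?x)"
        by (intro mult_left_mono) auto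
      moreover have "z n - y n = 2 ^ n *\<^sub>R (?z - ?y)"
        by (simp add: y_def z_def scaleR_diff_right)
      then have "norm (z n - y n) = 2 ^ n * norm (?z - ?y)"
        by (simp only: norm_scaleR) simp
      moreover have "2 ^ n * (K * norm ?x * norm ?y + K * norm ?z * norm ?x) = K * norm ?x * (norm (y n) + norm (z n))"
        by (simp add: y_def z_def algebra_simps)
      ultimately show ?case by (simp only:)
    qed
  qed
qed

text \<open>A bootstrap: the crude bound first gives \<open>norm (Adj h w) \<le> 2 * norm w\<close>,
  then shows that \<open>Adj h w\<close> is close to \<open>w\<close>, and so allows replacing it by
  \<open>w\<close> inside \<open>B\<close>. The result says that the derivative of Ad at the
  identity is the bracket.\<close>

lemma Adj_near_one:
  assumes "\<epsilon> > 0"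
  obtains \<delta> where "\<delta> > 0"
    "\<And>h w. \<lbrakk>h \<in> N; norm (co h) < \<delta>\<rbrakk> \<Longrightarrow>
      norm (Adj h w - w - (B (co h) w - B w (co h))) \<le> \<epsilon> * norm (co h) * norm w"
proof -
  interpret B: bounded_bilinear B by (rule bounded_bilinear_B)
  from B.nonneg_bounded obtain b where b: "b \<ge> 0" "\<And>u v. norm (B u v) \<le> norm u * norm v * b" by blast
  obtain d where d: "d > 0" "d \<le> R"
    "\<And>h k. \<lbrakk>h \<in> W; k \<in> W; norm (co h) < d; norm (co k) < d\<rbrakk> \<Longrightarrow>
      norm (co (h * k) - co h - co k - B (co h) (co k)) \<le> (\<epsilon> / 6) * norm (co h) * norm (co k)"
    using co_mult_expansion[of "\<epsilon> / 6"] assms by auto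
  \<comment> \<open>The bound \<open>1 / (3 * K)\<close> absorbs the unknown in the crude estimate.
    The last bound makes the cost of the replacement three times \<epsilon>/6; the expansion itself
    contributes the other three sixths.\<close>
  define \<delta> where "\<delta> = min d (min (1 / (3 * K)) (\<epsilon> / (6 * (b * K + 1))))"
  have bK: "b * K + 1 > 0" using b K by (simp add: add_nonneg_pos)
  show ?thesis
  proof (rule that[of \<delta>])
    show "\<delta> > 0" using d K assms bK by (simp add: \<delta>_def)
    fix h w assume h: "h \<in> N" "norm (co h) < \<delta>"
    let ?x = "co h" and ?A = "Adj h w"
    have "norm ?x < d" using h by (simp add: \<delta>_def)
    from Adj_near_one_implicit[of "\<epsilon> / 6" d h w, OF _ d(3) d(1) h(1) this] assms
    have I1: "norm (?A - w - (B ?x w - B ?A ?x)) \<le> \<epsilon> / 6 * norm ?x * (norm w + norm ?A)"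
      and I2: "norm (?A - w) \<le> K * norm ?x * (norm w + norm ?A)"
      by auto
    have Kx: "K * norm ?x \<le> 1 / 3" using h K by (simp add: \<delta>_def field_simps)
    have bx: "b * K * norm ?x \<le> \<epsilon> / 6"
    proof -
      have "norm ?x * (6 * (b * K + 1)) \<le> \<epsilon>"
        using h bK by (simp add: \<delta>_def pos_less_divide_eq less_imp_le)
      moreover have "norm ?x * (6 * (b * K + 1)) = 6 * norm ?x + 6 * (b * K * norm ?x)"
        by (simp add: algebra_simps)
      ultimately show ?thesis using norm_ge_zero[of ?x] by linarith
    qed
    have "norm (?A - w) \<le> (1 / 3) * (norm w + norm ?A)"
      using I2 mult_right_mono[OF Kx, of "norm w + norm ?A"] by simp
    then have A2: "norm ?A \<le> 2 * norm w"
      using norm_triangle_sub[of ?A w] by simp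
    have "K * norm ?x * (norm w + norm ?A) \<le> K * norm ?x * (3 * norm w)"
      using A2 K by (intro mult_left_mono) auto
    with I2 have Aw: "norm (?A - w) \<le> K * norm ?x * (3 * norm w)" by linarith
    have "?A - w - (B ?x w - B w ?x) = (?A - w - (B ?x w - B ?A ?x)) - B (?A - w) ?x"
      by (simp add: B.diff_left)
    then have "norm (?A - w - (B ?x w - B w ?x)) \<le> norm (?A - w - (B ?x w - B ?A ?x)) + norm (B (?A - w) ?x)"
      by (metis norm_triangle_ineq4)
    also have "\<dots> \<le> \<epsilon> / 6 * norm ?x * (norm w + norm ?A) + norm (?A - w) * norm ?x * b"
      by (intro add_mono I1 b)
    also have "\<dots> \<le> \<epsilon> / 6 * norm ?x * (3 * norm w) + (K * norm ?x * (3 * norm w)) * norm ?x * b"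
      using A2 Aw assms b by (intro add_mono mult_left_mono mult_right_mono) auto
    also have "\<dots> = \<epsilon> / 6 * norm ?x * (3 * norm w) + (b * K * norm ?x) * (norm ?x * (3 * norm w))"
      by simp
    also have "\<dots> \<le> \<epsilon> / 6 * norm ?x * (3 * norm w) + (\<epsilon> / 6) * (norm ?x * (3 * norm w))"
      by (intro add_left_mono mult_right_mono bx) simp
    also have "\<dots> = \<epsilon> * norm ?x * norm w" by simp
    finally show "norm (?A - w - (B ?x w - B w ?x)) \<le> \<epsilon> * norm ?x * norm w" .
  qed
qed

lemma Adj_one: "Adj 1 w = w"
proof -
  interpret B: bounded_bilinear B by (rule bounded_bilinear_B)
  obtain d where "d > 0"
    "\<And>h w. \<lbrakk>h \<in> N; norm (co h) < d\<rbrakk> \<Longrightarrow>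
      norm (Adj h w - w - (B (co h) w - B w (co h))) \<le> 1 * norm (co h) * norm w"
    using Adj_near_one[of 1] by auto
  from this(2)[of 1 w] this(1) show ?thesis
    by (simp add: N_def B.zero_left B.zero_right)
qed

lemma tendsto_lexp_line: "((\<lambda>t. lexp (t *\<^sub>R v)) \<longlongrightarrow> 1) (at 0)"
proof -
  have "((\<lambda>t. t *\<^sub>R v) \<longlongrightarrow> 0 *\<^sub>R v) (at (0::real))" by (intro tendsto_intros)
  from tendsto_lexp[OF this] show ?thesis by simp
qed

text \<open>The derivative at 0 of \<open>Ad (exp (t v)) w\<close> is \<open>B v w - B w v\<close>,
  which is 0 here. The coordinate of \<open>lexp (t v)\<close> agrees with \<open>t v\<close> only
  up to \<open>r\<close>, of order \<open>t^2\<close>, which is harmless after division by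
  \<open>t\<close>.\<close>

lemma Adj_lexp_derivative_0:
  assumes vw: "B v w = B w v"
  shows "((\<lambda>t. norm (Adj (lexp (t *\<^sub>R v)) w - w) / \<bar>t\<bar>) \<longlongrightarrow> 0) (at 0)"
proof (rule tendstoI)
  interpret B: bounded_bilinear B by (rule bounded_bilinear_B)
  from B.nonneg_bounded obtain b where b: "b \<ge> 0" "\<And>u v. norm (B u v) \<le> norm u * norm v * b" by blast
  fix e :: real assume e: "e > 0"
  define \<epsilon> where "\<epsilon> = e / (2 * (2 * norm v * norm w + 1))"
  have pos: "2 * norm v * norm w + 1 > 0" by (simp add: add_nonneg_pos)
  have \<epsilon>: "\<epsilon> > 0" using e pos by (simp add: \<epsilon>_def)
  obtain d where d: "d > 0"
    "\<And>h w. \<lbrakk>h \<in> N; norm (co h) < d\<rbrakk> \<Longrightarrow>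
      norm (Adj h w - w - (B (co h) w - B w (co h))) \<le> \<epsilon> * norm (co h) * norm w"
    using Adj_near_one[OF \<epsilon>] by auto
  have lim0: "((\<lambda>t. t *\<^sub>R v) \<longlongrightarrow> 0 *\<^sub>R v) (at (0::real))" by (intro tendsto_intros)
  have ev1: "\<forall>\<^sub>F t in at 0. lexp (t *\<^sub>R v) \<in> N"
    by (rule eventually_in_N[OF tendsto_lexp_line])
  have ev2: "\<forall>\<^sub>F t in at 0. norm (co (lexp (t *\<^sub>R v))) < d"
    using tendsto_norm[OF tendsto_co[OF tendsto_lexp_line[of v] W_D(1)[OF one_in_W]]] d
    by (intro order_tendstoD(2)) auto
  have ev3: "\<forall>\<^sub>F t in at (0::real). norm (t *\<^sub>R v) < r0"
    using tendsto_norm[OF lim0] r0 by (intro order_tendstoD(2)) auto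
  have ev4: "\<forall>\<^sub>F t in at (0::real). \<bar>t\<bar> * (2 * b * K * (norm v)\<^sup>2 * norm w) < e / 2"
  proof (rule order_tendstoD(2))
    show "((\<lambda>t. \<bar>t\<bar> * (2 * b * K * (norm v)\<^sup>2 * norm w)) \<longlongrightarrow> \<bar>0\<bar> * (2 * b * K * (norm v)\<^sup>2 * norm w)) (at (0::real))"
      by (intro tendsto_intros)
  qed (use e in simp)
  have ev5: "\<forall>\<^sub>F t in at (0::real). t \<noteq> 0" by (simp add: eventually_at_filter)
  show "\<forall>\<^sub>F t in at 0. dist (norm (Adj (lexp (t *\<^sub>R v)) w - w) / \<bar>t\<bar>) 0 < e"
    using ev1 ev2 ev3 ev4 ev5
  proof eventually_elim
    case (elim t)
    let ?x = "co (lexp (t *\<^sub>R v))" and ?A = "Adj (lexp (t *\<^sub>R v)) w"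
    define r where "r = ?x - t *\<^sub>R v"
    have r: "norm r \<le> K * (norm (t *\<^sub>R v))\<^sup>2"
      unfolding r_def by (rule co_lexp_bound) (use elim in simp)
    have x2: "norm ?x \<le> 2 * (\<bar>t\<bar> * norm v)"
    proof -
      have "norm (t *\<^sub>R v) \<le> r0" using elim by simp
      then show ?thesis
        using norm_E[of "t *\<^sub>R v"] co_\<sigma>[of "E (t *\<^sub>R v)"] by (simp add: lexp_small)
    qed
    have "B ?x w - B w ?x = B r w - B w r"
      by (simp add: r_def B.diff_left B.diff_right B.scaleR_left B.scaleR_right vw)
    then have "norm (B ?x w - B w ?x) \<le> norm (B r w) + norm (B w r)"
      using norm_triangle_ineq4 by metis
    also have "\<dots> \<le> norm r * norm w * b + norm w * norm r * b" by (intro add_mono b)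
    also have "\<dots> = norm r * (2 * b * norm w)" by simp
    also have "\<dots> \<le> K * (norm (t *\<^sub>R v))\<^sup>2 * (2 * b * norm w)"
      using b by (intro mult_right_mono r) auto
    also have "\<dots> = \<bar>t\<bar> * (\<bar>t\<bar> * (2 * b * K * (norm v)\<^sup>2 * norm w))"
      by (simp add: power2_eq_square)
    also have "\<dots> < \<bar>t\<bar> * (e / 2)"
      using elim by (intro mult_strict_left_mono) auto
    finally have 1: "norm (B ?x w - B w ?x) < \<bar>t\<bar> * (e / 2)" .
    have "\<epsilon> * norm ?x * norm w \<le> \<epsilon> * (2 * (\<bar>t\<bar> * norm v)) * norm w"
      using \<epsilon> by (intro mult_right_mono mult_left_mono x2) auto
    also have "\<dots> = \<bar>t\<bar> * (\<epsilon> * (2 * norm v * norm w))" by simp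
    also have "\<dots> \<le> \<bar>t\<bar> * (e / 2)"
    proof (rule mult_left_mono)
      have "\<epsilon> * (2 * norm v * norm w) \<le> \<epsilon> * (2 * norm v * norm w + 1)"
        using \<epsilon> by (intro mult_left_mono) auto
      also have "\<dots> = e / 2"
      proof -
        have "e / (2 * D) * D = e / 2" if "D > 0" for D using that by simp
        from this[OF pos] show ?thesis by (simp only: \<epsilon>_def)
      qed
      finally show "\<epsilon> * (2 * norm v * norm w) \<le> e / 2" .
    qed simp
    finally have 2: "norm (?A - w - (B ?x w - B w ?x)) \<le> \<bar>t\<bar> * (e / 2)"
      using d(2)[of "lexp (t *\<^sub>R v)" w] elim by linarith
    have "norm (?A - w) \<le> norm (B ?x w - B w ?x) + norm (?A - w - (B ?x w - B w ?x))"
      by (rule norm_triangle_sub)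
    also have "\<dots> < \<bar>t\<bar> * e" using 1 2 by simp
    finally show ?case using elim by (simp add: divide_less_eq mult.commute)
  qed
qed

text \<open>Since \<open>A (t + s) - A t\<close> is \<open>Adj (a t)\<close> applied to
  \<open>A s - w\<close>, the vanishing derivative at 0 propagates to every \<open>t\<close>. The
  interval is restricted because \<open>Adj\<close> is controlled only on \<open>N\<close>.\<close>

lemma lexp_commute_of_bracket_small:
  assumes vw: "B v w = B w v"
  shows "\<exists>\<tau>>0. \<forall>t. \<bar>t\<bar> < \<tau> \<longrightarrow> lexp (t *\<^sub>R v) * lexp w = lexp w * lexp (t *\<^sub>R v)"
proof -
  define a where "a t = lexp (t *\<^sub>R v)" for t
  define A where "A t = Adj (a t) w" for t
  have a: "a (s + t) = a s * a t" for s t by (simp add: a_def lexp_add_line)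
  from eventually_in_N[OF tendsto_lexp_line[of v]]
  obtain \<tau> where \<tau>: "\<tau> > 0" "\<And>t. t \<noteq> 0 \<Longrightarrow> \<bar>t\<bar> < \<tau> \<Longrightarrow> a t \<in> N"
    by (auto simp: eventually_at dist_real_def a_def)
  have aN: "a t \<in> N" if "t \<in> ball 0 \<tau>" for t
    using \<tau>(2)[of t] that by (cases "t = 0") (auto simp: a_def N_def)
  have "\<exists>c. \<forall>t\<in>ball 0 \<tau>. A t = c"
  proof (rule has_derivative_zero_constant)
    fix t :: real assume t: "t \<in> ball 0 \<tau>"
    interpret L: bounded_linear "Adj (a t)" by (rule linear_Adj[OF aN[OF t]])
    have "((\<lambda>s. t + s) \<longlongrightarrow> t + 0) (at 0)" by (intro tendsto_intros)
    then have "\<forall>\<^sub>F s in at 0. t + s \<in> ball 0 \<tau>"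
      using t by (intro topological_tendstoD) auto
    moreover have "\<forall>\<^sub>F s in at 0. s \<in> ball 0 \<tau>"
      using \<tau>(1) by (intro topological_tendstoD[OF tendsto_ident_at]) auto
    ultimately have ev: "\<forall>\<^sub>F s in at 0. A (t + s) - A t = Adj (a t) (A s - w)"
    proof eventually_elim
      case (elim s)
      have "A (t + s) = Adj (a t) (A s)"
        using Adj_mult[OF aN[OF t] aN[OF elim(2)]] aN[OF elim(1)] by (simp add: A_def a)
      then show ?case by (simp add: L.diff A_def)
    qed
    have "((\<lambda>s. norm (A (t + s) - A t - 0) / norm s) \<longlongrightarrow> 0) (at 0)"
    proof (rule Lim_null_comparison)
      show "\<forall>\<^sub>F s in at 0. norm (norm (A (t + s) - A t - 0) / norm s) \<le> onorm (Adj (a t)) * (norm (A s - w) / \<bar>s\<bar>)"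
        using ev
      proof eventually_elim
        case (elim s)
        have "norm (Adj (a t) (A s - w)) / \<bar>s\<bar> \<le> onorm (Adj (a t)) * norm (A s - w) / \<bar>s\<bar>"
          by (intro divide_right_mono onorm L.bounded_linear_axioms) auto
        then show ?case by (simp add: elim)
      qed
      show "((\<lambda>s. onorm (Adj (a t)) * (norm (A s - w) / \<bar>s\<bar>)) \<longlongrightarrow> 0) (at 0)"
        using tendsto_mult_left[OF Adj_lexp_derivative_0[OF vw], of "onorm (Adj (a t))"]
        by (simp add: A_def a_def)
    qed
    then have "(A has_derivative (\<lambda>_. 0)) (at t)"
      by (simp add: has_derivative_at)
    then show "(A has_derivative (\<lambda>_. 0)) (at t within ball 0 \<tau>)"
      by (rule has_derivative_at_withinI)
  qed auto
  then obtain c where c: "\<And>t. t \<in> ball 0 \<tau> \<Longrightarrow> A t = c" by blast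
  moreover have "A 0 = w" by (simp add: A_def a_def Adj_one)
  ultimately have Aw: "A t = w" if "t \<in> ball 0 \<tau>" for t using \<tau>(1) that by force
  have "a t * lexp w = lexp w * a t" if "\<bar>t\<bar> < \<tau>" for t
  proof -
    have t: "t \<in> ball 0 \<tau>" using that by simp
    from Adj_conj[OF aN[OF t], of w] have "a t * lexp w * inverse (a t) = lexp w"
      using Aw[OF t] by (simp add: A_def)
    then show ?thesis by (metis group_left_inverse mult.assoc mult_1_right)
  qed
  then show ?thesis using \<tau>(1) by (auto simp: a_def)
qed

text \<open>A small dyadic fraction of \<open>v\<close> has an exponential commuting with
  \<open>lexp w\<close>, and so do the powers of that exponential.\<close>

lemma lexp_commute_of_bracket:
  assumes "B v w = B w v" shows "lexp v * lexp w = lexp w * lexp v"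
proof -
  obtain \<tau> where \<tau>: "\<tau> > 0" "\<And>t. \<bar>t\<bar> < \<tau> \<Longrightarrow> lexp (t *\<^sub>R v) * lexp w = lexp w * lexp (t *\<^sub>R v)"
    using lexp_commute_of_bracket_small[OF assms] by blast
  obtain k where "(1 / 2) ^ k < \<tau>" using real_arch_pow_inv[OF \<tau>(1), of "1 / 2"] by auto
  then have "lexp (v /\<^sub>R 2 ^ k) * lexp w = lexp w * lexp (v /\<^sub>R 2 ^ k)"
  proof (intro \<tau>(2))
    have "inverse (2 ^ k) = (1 / 2 :: real) ^ k" by (simp add: power_one_over inverse_eq_divide)
    then show "\<bar>inverse (2 ^ k)\<bar> < \<tau>" using \<open>(1 / 2) ^ k < \<tau>\<close> by simp
  qed
  from group_commute_power[OF this, of "2 ^ k"] show ?thesis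
    by (simp only: lexp_power2[of v k, symmetric])
qed

lemma lexp_add_of_bracket:
  assumes "B v w = B w v" shows "lexp (v + w) = lexp v * lexp w"
proof (rule lexp_add)
  interpret B: bounded_bilinear B by (rule bounded_bilinear_B)
  show "lexp (v /\<^sub>R 2 ^ n) * lexp (w /\<^sub>R 2 ^ n) = lexp (w /\<^sub>R 2 ^ n) * lexp (v /\<^sub>R 2 ^ n)" for n
    by (rule lexp_commute_of_bracket) (simp add: B.scaleR_left B.scaleR_right assms)
qed

text \<open>For large \<open>t\<close> conjugation by \<open>g t\<close> is not directly accessible
  in the chart. Writing \<open>t = n * s\<close> with \<open>g s\<close> in \<open>N\<close>, it is
  the n-fold iterate of conjugation by \<open>g s\<close>, and additivity of \<alpha> collects the
  eigenvalues.\<close>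

lemma lexp_eigen_conj:
  assumes g: "one_parameter_subgroup g" and \<alpha>: "Modules.additive \<alpha>"
    and v: "\<And>t. Adj (g t) v = exp (\<alpha> t) *\<^sub>R v"
  shows "g t * lexp v * inverse (g t) = lexp (exp (\<alpha> t) *\<^sub>R v)"
proof -
  have hom: "g (s + t) = g s * g t" for s t using g by (simp add: one_parameter_subgroup_def)
  have g0: "g 0 = 1" using hom[of 0 0] group_mult_cancel_left[of "g 0" "g 0" 1] by simp
  have gn: "g (real n * s) = g s ^ n" for n s
    by (induction n) (simp_all add: g0 distrib_right hom)
  have \<alpha>n: "\<alpha> (real n * s) = real n * \<alpha> s" for n s
    by (induction n) (simp_all add: additive.zero[OF \<alpha>] additive.add[OF \<alpha>] distrib_right)
  have "(\<lambda>n. t / real (Suc n)) \<longlonglongrightarrow> 0"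
    using tendsto_mult[OF tendsto_const[of t] LIMSEQ_inverse_real_of_nat] by (simp add: divide_inverse)
  moreover have "isCont g 0" using g by (simp add: one_parameter_subgroup_def continuous_on_eq_continuous_at)
  ultimately have "(\<lambda>n. g (t / real (Suc n))) \<longlonglongrightarrow> 1"
    using isCont_tendsto_compose[of 0 g] g0 by metis
  from eventually_in_N[OF this] obtain m where "g (t / real (Suc m)) \<in> N"
    using eventually_happens'[OF trivial_limit_sequentially] by blast
  then obtain s n where s: "g s \<in> N" "t = real n * s" by (metis nonzero_mult_div_cancel_left of_nat_neq_0 times_divide_eq_right)
  interpret L: bounded_linear "Adj (g s)" by (rule linear_Adj[OF s(1)])
  have "g s ^ n * lexp v * inverse (g s ^ n) = lexp (exp (real n * \<alpha> s) *\<^sub>R v)" for n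
  proof (induction n)
    case (Suc n)
    have "g s ^ Suc n * lexp v * inverse (g s ^ Suc n) = g s * (g s ^ n * lexp v * inverse (g s ^ n)) * inverse (g s)"
      by (simp add: group_inverse_mult mult.assoc)
    also have "\<dots> = lexp (Adj (g s) (exp (real n * \<alpha> s) *\<^sub>R v))"
      unfolding Suc by (rule Adj_conj[OF s(1)])
    also have "\<dots> = lexp (exp (real (Suc n) * \<alpha> s) *\<^sub>R v)"
      by (simp add: L.scaleR v exp_add[symmetric] algebra_simps)
    finally show ?case .
  qed simp
  then show ?thesis by (simp add: s(2) gn \<alpha>n)
qed

end

section \<open>Lie groups\<close>

text \<open>Both sides choose from the same set of derivatives, so the equality holds at every
  point, differentiable or not. It can therefore be used in \<open>Ad c h\<close> for an arbitrary
  \<open>h\<close>.\<close>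

lemma frechet_derivative_shift:
  "frechet_derivative (\<lambda>y. f (a + y) - b) (at 0) = frechet_derivative f (at a)"
  unfolding frechet_derivative_def has_derivative_at by simp

lemma identity_chart_props:
  fixes A :: "('g::{group_mult, t2_space, second_countable_topology}, 'e::euclidean_space) chart set"
  assumes "lie_group A" "identity_chart A (U, \<kappa>)"
  defines "s \<equiv> inv_into U \<kappa>"
  shows "open U" "open (\<kappa> ` U)" "1 \<in> U" "continuous_on U \<kappa>" "continuous_on (\<kappa> ` U) s"
    and "\<And>h. h \<in> U \<Longrightarrow> s (\<kappa> h) = h" "\<And>x. x \<in> \<kappa> ` U \<Longrightarrow> \<kappa> (s x) = x" "\<And>x. x \<in> \<kappa> ` U \<Longrightarrow> s x \<in> U"
    and "smooth_on (map_prod \<kappa> \<kappa> ` ((U \<times> U) \<inter> (\<lambda>(g, h). g * h) -` U))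
           (\<kappa> \<circ> (\<lambda>(g, h). g * h) \<circ> inv_into (U \<times> U) (map_prod \<kappa> \<kappa>))"
    and "continuous_on UNIV (\<lambda>(g::'g, h). g * h)"
    and "continuous_on UNIV (inverse :: 'g \<Rightarrow> 'g)"
proof -
  have c: "(U, \<kappa>) \<in> A" "1 \<in> U" using assms(2) by (auto simp: identity_chart_def)
  have at: "smooth_atlas A" and m: "smooth_map (prod_atlas A A) A (\<lambda>(g, h). g * h)" and i: "smooth_map A A inverse"
    using assms(1) by (auto simp: lie_group_def)
  have hom: "open U" "open (\<kappa> ` U)" "homeomorphism U (\<kappa> ` U) \<kappa> s"
    using at c(1) unfolding smooth_atlas_def s_def by blast+
  show "open U" "open (\<kappa> ` U)" "1 \<in> U" by (fact hom c)+
  show "continuous_on U \<kappa>" "continuous_on (\<kappa> ` U) s"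
    using hom(3) by (auto simp: homeomorphism_def)
  show "\<And>h. h \<in> U \<Longrightarrow> s (\<kappa> h) = h" "\<And>x. x \<in> \<kappa> ` U \<Longrightarrow> \<kappa> (s x) = x" "\<And>x. x \<in> \<kappa> ` U \<Longrightarrow> s x \<in> U"
    using hom(3) by (auto simp: homeomorphism_def)
  have "(U \<times> U, map_prod \<kappa> \<kappa>) \<in> prod_atlas A A" using c by (auto simp: prod_atlas_def)
  with m c show "smooth_on (map_prod \<kappa> \<kappa> ` ((U \<times> U) \<inter> (\<lambda>(g, h). g * h) -` U))
           (\<kappa> \<circ> (\<lambda>(g, h). g * h) \<circ> inv_into (U \<times> U) (map_prod \<kappa> \<kappa>))"
    unfolding smooth_map_def by blast
  show "continuous_on UNIV (\<lambda>(g::'g, h). g * h)" "continuous_on UNIV (inverse :: 'g \<Rightarrow> 'g)"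
    using m i by (auto simp: smooth_map_def)
qed

text \<open>\<open>F\<close> is the product in coordinates. Because \<open>F (e, y) = y\<close> and
  \<open>F (y, e) = y\<close>, its mixed difference against the base point is the product minus the
  sum of the centred coordinates, so the mixed derivative is the whole second-order term. The
  left-invariant field of \<open>v\<close> is the derivative of \<open>F\<close> at
  \<open>(x, e)\<close> in direction \<open>(0, v)\<close>; differentiating it at \<open>e\<close>
  along \<open>u\<close> gives \<open>B u v\<close>, and hence the bracket.\<close>

lemma lie_group_topological_chart:
  fixes A :: "('g::{group_mult, t2_space, second_countable_topology}, 'e::euclidean_space) chart set"
  assumes L: "lie_group A" and c: "identity_chart A c"
  shows "\<exists>R K B. topological_chart (\<lambda>x. inv_into (fst c) (snd c) (snd c 1 + x)) (\<lambda>h. snd c h - snd c 1) (fst c) R K B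
     \<and> (\<forall>v w. lie_bracket c v w = B v w - B w v)"
proof -
  obtain U \<kappa> where c_eq: "c = (U, \<kappa>)" by (cases c)
  define s where "s = inv_into U \<kappa>"
  note P = identity_chart_props[OF L c[unfolded c_eq], folded s_def]
  define e where "e = \<kappa> 1"
  define S where "S = map_prod \<kappa> \<kappa> ` ((U \<times> U) \<inter> (\<lambda>(g, h). g * h) -` U)"
  define F where "F = \<kappa> \<circ> (\<lambda>(g, h). g * h) \<circ> inv_into (U \<times> U) (map_prod \<kappa> \<kappa>)"
  have C: "Ck_on 2 S F" using P(9) by (simp add: smooth_on_def S_def F_def)
  have S_iff: "(x, y) \<in> S \<longleftrightarrow> x \<in> \<kappa> ` U \<and> y \<in> \<kappa> ` U \<and> s x * s y \<in> U" for x y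
    using P(6,7,8) by (force simp: S_def)
  have e: "e \<in> \<kappa> ` U" "s e = 1" using P(3,6) by (auto simp: e_def)
  have F_eq: "F (x, y) = \<kappa> (s x * s y)" if "x \<in> \<kappa> ` U" "y \<in> \<kappa> ` U" for x y
  proof -
    have "inj_on \<kappa> U" using P(6) by (metis inj_onI)
    then have "inj_on (map_prod \<kappa> \<kappa>) (U \<times> U)" by (rule map_prod_inj_on) (fact \<open>inj_on \<kappa> U\<close>)
    from inv_into_f_f[OF this, of "(s x, s y)"]
    have "inv_into (U \<times> U) (map_prod \<kappa> \<kappa>) (x, y) = (s x, s y)"
      using that P(7,8) by simp
    then show ?thesis by (simp add: F_def)
  qed
  have openS: "open S"
  proof -
    have "continuous_on (\<kappa> ` U \<times> \<kappa> ` U) (\<lambda>p. (s (fst p), s (snd p)))"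
      by (intro continuous_on_Pair continuous_on_compose2[OF P(5)] continuous_intros) auto
    from continuous_on_compose2[OF P(10) this]
    have "continuous_on (\<kappa> ` U \<times> \<kappa> ` U) (\<lambda>p. s (fst p) * s (snd p))" by simp
    moreover have "S = (\<lambda>p. s (fst p) * s (snd p)) -` U \<inter> (\<kappa> ` U \<times> \<kappa> ` U)"
      using S_iff by auto
    ultimately show ?thesis
      using continuous_on_open_vimage[OF open_Times[OF P(2) P(2)]] P(1) by metis
  qed
  have eS: "(e, e) \<in> S" using e P(3) by (simp add: S_iff)
  have Fe: "F (e, y) = y" "F (y, e) = y" if "y \<in> \<kappa> ` U" for y
    using F_eq e that P(7) by simp_all
  let ?B = "mixed_derivative F (e, e)"
  have bil: "bilinear ?B" by (rule bilinear_mixed_derivative[OF C openS eS])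
  then interpret B: bounded_bilinear ?B by (simp add: bilinear_conv_bounded_bilinear)
  from B.nonneg_bounded obtain b where b: "b \<ge> 0" "\<And>u v. norm (?B u v) \<le> norm u * norm v * b" by blast
  \<comment> \<open>Any fixed error bound would do; with 1 the constant \<open>K\<close> of the
    chart is \<open>1 + b\<close>.\<close>
  from mixed_difference_estimate[OF C openS eS, of 1]
  obtain R where R: "R > 0" "ball e R \<times> ball e R \<subseteq> S" and
    D: "\<And>x x' y y'. \<lbrakk>x \<in> ball e R; x' \<in> ball e R; y \<in> ball e R; y' \<in> ball e R\<rbrakk> \<Longrightarrow>
       norm (F (x, y) - F (x', y) - F (x, y') + F (x', y') - ?B (x - x') (y - y')) \<le> 1 * norm (x - x') * norm (y - y')"
    by (metis zero_less_one)
  have ball: "e + x \<in> ball e R" if "norm x < R" for x using that by (simp add: dist_norm)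
  have ballU: "e + x \<in> \<kappa> ` U" if "norm x < R" for x
  proof -
    have "(e + x, e) \<in> ball e R \<times> ball e R" using ball[OF that] R(1) by simp
    then show ?thesis using R(2) S_iff by blast
  qed
  have topo: "topological_chart (\<lambda>x. s (e + x)) (\<lambda>h. \<kappa> h - e) U R (1 + b) ?B"
  proof
    show "continuous_on U (\<lambda>h. \<kappa> h - e)" by (intro continuous_intros P)
    show "continuous_on (ball 0 R) (\<lambda>x. s (e + x))"
    proof (intro continuous_on_compose2[OF P(5)] continuous_intros image_subsetI)
      show "x \<in> ball 0 R \<Longrightarrow> e + x \<in> \<kappa> ` U" for x by (rule ballU) simp
    qed
    fix x y :: 'e assume xy: "norm x < R" "norm y < R"
    have xyS: "(e + x, e + y) \<in> S" using R(2) ball xy by blast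
    then show "s (e + x) * s (e + y) \<in> U" by (simp add: S_iff)
    have "(\<lambda>p. F ((e, e) + p) - e) differentiable (at (x, y))"
    proof (intro differentiable_diff differentiable_const)
      have "(F \<circ> (\<lambda>p. (e, e) + p)) differentiable (at (x, y))"
        by (rule differentiable_chain_at) (use Ck_on_2D(1)[OF C xyS] in \<open>auto intro!: derivative_intros simp: differentiable_add\<close>)
      then show "(\<lambda>p. F ((e, e) + p)) differentiable (at (x, y))" by (simp add: o_def)
    qed
    moreover have "((\<lambda>p. F ((e, e) + p) - e) has_derivative D) (at (x, y)) \<Longrightarrow>
       ((\<lambda>p. \<kappa> (s (e + fst p) * s (e + snd p)) - e) has_derivative D) (at (x, y))" for D
    proof (erule has_derivative_transform_within_open[of _ _ _ _ "ball 0 R \<times> ball 0 R"])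
      fix p :: "'e \<times> 'e" assume "p \<in> ball 0 R \<times> ball 0 R"
      then show "F ((e, e) + p) - e = \<kappa> (s (e + fst p) * s (e + snd p)) - e"
        using F_eq ballU by (cases p) auto
    qed (use xy in \<open>auto intro: open_Times\<close>)
    ultimately show "(\<lambda>p. \<kappa> (s (e + fst p) * s (e + snd p)) - e) differentiable (at (x, y))"
      unfolding differentiable_def by blast
    fix x' y' :: 'e assume xy': "norm x' < R" "norm y' < R"
    have "norm (F (e + x, e + y) - F (e + x', e + y) - F (e + x, e + y') + F (e + x', e + y') - ?B (x - x') (y - y'))
       \<le> norm (x - x') * norm (y - y')"
      using D[of "e + x" "e + x'" "e + y" "e + y'"] ball xy xy' by simp
    then have "norm (F (e + x, e + y) - F (e + x', e + y) - F (e + x, e + y') + F (e + x', e + y'))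
       \<le> norm (x - x') * norm (y - y') + norm (x - x') * norm (y - y') * b"
      using b(2)[of "x - x'" "y - y'"] norm_triangle_sub order_trans add_mono by (smt (verit))
    then show "norm (\<kappa> (s (e + x) * s (e + y)) - e - (\<kappa> (s (e + x') * s (e + y)) - e) -
              (\<kappa> (s (e + x) * s (e + y')) - e) + (\<kappa> (s (e + x') * s (e + y')) - e))
           \<le> (1 + b) * norm (x - x') * norm (y - y')"
      using F_eq ballU xy xy' by (simp add: algebra_simps)
  next
    fix \<epsilon> :: real assume "\<epsilon> > 0"
    from mixed_difference_estimate[OF C openS eS this]
    obtain d where d: "d > 0" "ball e d \<times> ball e d \<subseteq> S" and
      Dd: "\<And>x x' y y'. \<lbrakk>x \<in> ball e d; x' \<in> ball e d; y \<in> ball e d; y' \<in> ball e d\<rbrakk> \<Longrightarrow>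
       norm (F (x, y) - F (x', y) - F (x, y') + F (x', y') - ?B (x - x') (y - y')) \<le> \<epsilon> * norm (x - x') * norm (y - y')"
      by metis
    show "\<exists>\<delta>>0. \<forall>x y. norm x < \<delta> \<longrightarrow> norm y < \<delta> \<longrightarrow>
      norm (\<kappa> (s (e + x) * s (e + y)) - e - x - y - ?B x y) \<le> \<epsilon> * norm x * norm y"
    proof (intro exI[of _ "min d R"] conjI allI impI)
      fix x y :: 'e assume xy: "norm x < min d R" "norm y < min d R"
      then have "norm (F (e + x, e + y) - F (e, e + y) - F (e + x, e) + F (e, e) - ?B x y) \<le> \<epsilon> * norm x * norm y"
        using Dd[of "e + x" e "e + y" e] d by (simp add: dist_norm)
      then show "norm (\<kappa> (s (e + x) * s (e + y)) - e - x - y - ?B x y) \<le> \<epsilon> * norm x * norm y"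
        using F_eq[of "e + x" "e + y"] Fe e ballU xy by (simp add: algebra_simps)
    qed (use d R in auto)
  qed (use R b bil P e ballU in \<open>auto simp: add_pos_nonneg\<close>)
  have lif: "left_invariant_field c v x = frechet_derivative F (at (x, e)) (0, v)" if x: "x \<in> \<kappa> ` U" for v x
  proof -
    have xS: "(x, e) \<in> S" using x e P(8) by (simp add: S_iff)
    have "((\<lambda>y. F (x, y)) has_derivative (\<lambda>w. frechet_derivative F (at (x, e)) (0, w))) (at e)"
    proof -
      have "((\<lambda>y. (x, y)) has_derivative (\<lambda>v. (0, v))) (at e)"
        by (auto intro!: derivative_eq_intros)
      from diff_chain_at[OF this, of F] Ck_on_2D(1)[OF C xS] show ?thesis
        unfolding o_def frechet_derivative_works by blast
    qed
    then have "((\<lambda>y. \<kappa> (s x * s y)) has_derivative (\<lambda>w. frechet_derivative F (at (x, e)) (0, w))) (at e)"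
      by (rule has_derivative_transform_within_open[OF _ P(2) e(1)]) (simp add: F_eq x)
    from fun_cong[OF frechet_derivative_at[OF this], of v] show ?thesis
      by (simp add: left_invariant_field_def c_eq s_def e_def)
  qed
  have lif_e: "left_invariant_field c v e = v" for v
  proof -
    have "((\<lambda>y. \<kappa> (s e * s y)) has_derivative (\<lambda>w. w)) (at e)"
      by (rule has_derivative_transform_within_open[OF has_derivative_ident P(2) e(1)]) (simp add: e P(7))
    from fun_cong[OF frechet_derivative_at[OF this], of v] show ?thesis
      by (simp add: left_invariant_field_def c_eq s_def e_def)
  qed
  have D_lif: "frechet_derivative (left_invariant_field c v) (at e) u = ?B u v" for u v
  proof -
    have "((\<lambda>x. (x, e)) has_derivative (\<lambda>v. (v, 0))) (at e)"
      by (auto intro!: derivative_eq_intros)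
    from diff_chain_at[OF this, of "\<lambda>q. frechet_derivative F (at q) (0, v)"] Ck_on_2D(2)[OF C eS]
    have "((\<lambda>x. frechet_derivative F (at (x, e)) (0, v)) has_derivative (\<lambda>u. ?B u v)) (at e)"
      unfolding o_def frechet_derivative_works mixed_derivative_def by blast
    then have "(left_invariant_field c v has_derivative (\<lambda>u. ?B u v)) (at e)"
      by (rule has_derivative_transform_within_open[OF _ P(2) e(1)]) (simp add: lif)
    from fun_cong[OF frechet_derivative_at[OF this], of u] show ?thesis by simp
  qed
  have "lie_bracket c v w = ?B v w - ?B w v" for v w
    using lif_e D_lif by (simp add: lie_bracket_def vector_field_bracket_def c_eq e_def)
  with topo show ?thesis
    unfolding c_eq fst_conv snd_conv s_def[symmetric] e_def[symmetric] by blast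
qed

context
  fixes A :: "('g::{group_mult, t2_space, second_countable_topology}, 'e::euclidean_space) chart set" and c
  assumes L: "lie_group A" and c: "identity_chart A c"
begin

text \<open>The definite description in \<open>lie_exp\<close> is met by the line of
  \<open>lexp\<close> and by nothing else. \<open>R\<close>, \<open>K\<close> and \<open>B\<close>
  may stay existential, because \<open>lexp\<close> and \<open>Adj\<close> are built from the chart
  maps alone.\<close>

lemma lie_group_chart_exp:
  obtains R K B where
    "topological_chart (\<lambda>x. inv_into (fst c) (snd c) (snd c 1 + x)) (\<lambda>h. snd c h - snd c 1) (fst c) R K B"
    "\<And>v w. lie_bracket c v w = B v w - B w v"
    "\<And>v. lie_exp c v = topological_chart.lexp (\<lambda>h. snd c h - snd c 1) v"
    "\<And>h v. Ad c h v = topological_chart.Adj (\<lambda>x. inv_into (fst c) (snd c) (snd c 1 + x)) (\<lambda>h. snd c h - snd c 1) h v"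
proof -
  obtain R K B where T: "topological_chart (\<lambda>x. inv_into (fst c) (snd c) (snd c 1 + x)) (\<lambda>h. snd c h - snd c 1) (fst c) R K B"
     and B: "\<And>v w. lie_bracket c v w = B v w - B w v"
    using lie_group_topological_chart[OF L c] by blast
  interpret T: topological_chart "\<lambda>x. inv_into (fst c) (snd c) (snd c 1 + x)" "\<lambda>h. snd c h - snd c 1" "fst c" R K B
    by (fact T)
  have d: "((\<lambda>t. snd c (\<gamma> t)) has_vector_derivative v) (at 0) \<longleftrightarrow>
     ((\<lambda>t. snd c (\<gamma> t) - snd c 1) has_vector_derivative v) (at 0)" for \<gamma> and v
    by (simp add: has_vector_derivative_diff_const)
  have "lie_exp c v = T.lexp v" for v
  proof -
    have "(THE \<gamma>. one_parameter_subgroup \<gamma> \<and> ((\<lambda>t. snd c (\<gamma> t)) has_vector_derivative v) (at 0)) = (\<lambda>t. T.lexp (t *\<^sub>R v))"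
      unfolding d
      by (rule the_equality) (use T.lexp_one_parameter T.co_lexp_derivative T.one_parameter_eq_lexp in blast)+
    then show ?thesis by (simp add: lie_exp_def)
  qed
  moreover have "Ad c h v = T.Adj h v" for h v
    using frechet_derivative_shift[of "\<lambda>y. snd c (h * inv_into (fst c) (snd c) y * inverse h)" "snd c 1" "snd c 1"]
    by (simp add: Ad_def T.Adj_def split_beta)
  ultimately show ?thesis using that T B by blast
qed

lemma continuous_lie_exp: "continuous_on UNIV (lie_exp c)"
proof -
  obtain R K B where T: "topological_chart (\<lambda>x. inv_into (fst c) (snd c) (snd c 1 + x)) (\<lambda>h. snd c h - snd c 1) (fst c) R K B"
     and e: "\<And>v. lie_exp c v = topological_chart.lexp (\<lambda>h. snd c h - snd c 1) v"
    by (rule lie_group_chart_exp) blast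
  show ?thesis
    unfolding continuous_on_eq_continuous_at[OF open_UNIV] e[abs_def]
    using topological_chart.isCont_lexp[OF T] by simp
qed

lemma lie_exp_zero: "lie_exp c 0 = 1"
proof -
  obtain R K B where T: "topological_chart (\<lambda>x. inv_into (fst c) (snd c) (snd c 1 + x)) (\<lambda>h. snd c h - snd c 1) (fst c) R K B"
     and e: "\<And>v. lie_exp c v = topological_chart.lexp (\<lambda>h. snd c h - snd c 1) v"
    by (rule lie_group_chart_exp) blast
  show ?thesis unfolding e by (rule topological_chart.lexp_zero[OF T])
qed

lemma lie_exp_add:
  assumes "lie_bracket c v w = 0"
  shows "lie_exp c (v + w) = lie_exp c v * lie_exp c w"
proof -
  obtain R K B where T: "topological_chart (\<lambda>x. inv_into (fst c) (snd c) (snd c 1 + x)) (\<lambda>h. snd c h - snd c 1) (fst c) R K B"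
     and B: "\<And>v w. lie_bracket c v w = B v w - B w v"
     and e: "\<And>v. lie_exp c v = topological_chart.lexp (\<lambda>h. snd c h - snd c 1) v"
    by (rule lie_group_chart_exp) blast
  show ?thesis
    unfolding e using topological_chart.lexp_add_of_bracket[OF T] assms B by simp
qed

lemma lie_exp_eigen_conj:
  assumes "one_parameter_subgroup g" "Modules.additive \<alpha>" "v \<in> Ad_eigenspace c g \<alpha>"
  shows "g t * lie_exp c v * inverse (g t) = lie_exp c (exp (\<alpha> t) *\<^sub>R v)"
proof -
  obtain R K B where T: "topological_chart (\<lambda>x. inv_into (fst c) (snd c) (snd c 1 + x)) (\<lambda>h. snd c h - snd c 1) (fst c) R K B"
     and e: "\<And>v. lie_exp c v = topological_chart.lexp (\<lambda>h. snd c h - snd c 1) v"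
     and A: "\<And>h v. Ad c h v = topological_chart.Adj (\<lambda>x. inv_into (fst c) (snd c) (snd c 1 + x)) (\<lambda>h. snd c h - snd c 1) h v"
    by (rule lie_group_chart_exp) blast
  show ?thesis
    unfolding e by (rule topological_chart.lexp_eigen_conj[OF T assms(1,2)])
      (use assms(3) A in \<open>simp add: Ad_eigenspace_def\<close>)
qed

text \<open>The comparison of heights is assumed for relatively compact neighbourhoods of 1. Joined
  with such a neighbourhood, any compact set of group elements becomes admissible there.\<close>

lemma lie_group_compact_neighbourhood:
  obtains N :: "'g set" where "compact N" "1 \<in> interior N"
proof -
  obtain R K B where T: "topological_chart (\<lambda>x. inv_into (fst c) (snd c) (snd c 1 + x)) (\<lambda>h. snd c h - snd c 1) (fst c) R K B"
    by (rule lie_group_chart_exp) blast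
  interpret T: topological_chart "\<lambda>x. inv_into (fst c) (snd c) (snd c 1 + x)" "\<lambda>h. snd c h - snd c 1" "fst c" R K B
    by (fact T)
  let ?\<sigma> = "\<lambda>x. inv_into (fst c) (snd c) (snd c 1 + x)" and ?co = "\<lambda>h. snd c h - snd c 1"
  show ?thesis
  proof (rule that)
    show "compact (?\<sigma> ` cball 0 (R / 2))"
      by (intro compact_continuous_image continuous_on_subset[OF T.cont_\<sigma>]) (use T.R in auto)
    have "open (?co -` ball 0 (R / 2) \<inter> fst c)"
      using continuous_on_open_vimage[OF T.open_U] T.cont_co by blast
    moreover have "?co -` ball 0 (R / 2) \<inter> fst c \<subseteq> ?\<sigma> ` cball 0 (R / 2)"
    proof
      fix h assume "h \<in> ?co -` ball 0 (R / 2) \<inter> fst c"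
      then have "h = ?\<sigma> (?co h)" "?co h \<in> cball 0 (R / 2)" using T.\<sigma>_co[of h] by auto
      then show "h \<in> ?\<sigma> ` cball 0 (R / 2)" by blast
    qed
    moreover have "1 \<in> ?co -` ball 0 (R / 2) \<inter> fst c"
      using T.R T.W_D(1)[OF T.one_in_W] by simp
    ultimately show "1 \<in> interior (?\<sigma> ` cball 0 (R / 2))" by (metis interiorI)
  qed
qed

end

section \<open>Counting nodes of a tree\<close>

lemma sum_nat_children:
  fixes f :: "nat \<Rightarrow> 'a::comm_monoid_add"
  shows "(\<Sum>i<p * q. f i) = (\<Sum>i<q. \<Sum>j<p. f (p * i + j))"
proof -
  have "(\<Sum>i<p * q. f i) = (\<Sum>m<q. sum f {m * p..<m * p + p})"
    by (simp add: sum.nat_group mult.commute)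
  also have "\<dots> = (\<Sum>i<q. \<Sum>j<p. f (p * i + j))"
  proof (rule sum.cong[OF refl])
    fix m
    show "sum f {m * p..<m * p + p} = (\<Sum>j<p. f (p * m + j))"
      using sum.shift_bounds_nat_ivl[of f 0 "m * p" p] by (simp add: atLeast0LessThan ac_simps)
  qed
  finally show ?thesis .
qed

text \<open>The node \<open>i\<close> of level \<open>N\<close> of the \<open>p\<close>-ary tree has the ancestor \<open>i div p ^ (N - k)\<close> at
  level \<open>k\<close>. The sum of \<open>V\<close>, weighted by the product of the factors \<open>a\<close> and \<open>b\<close> along the path
  from the root, is a supermartingale.\<close>

lemma tree_count:
  fixes V :: "nat \<Rightarrow> nat \<Rightarrow> real"
  assumes p: "p > 0" and ab: "0 < b" "b \<le> a" and V: "\<And>n i. 1 \<le> V n i"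
    and child: "\<And>n i. n0 \<le> n \<Longrightarrow> i < p ^ n \<Longrightarrow>
      (\<Sum>j<p. V (Suc n) (p * i + j)) \<le> V n i / (if high n i then a else b)"
    and N: "n0 \<le> N"
  shows "real (card {i. i < p ^ N \<and> real (card {k. n0 \<le> k \<and> k < N \<and> \<not> high k (i div p ^ (N - k))}) \<le> l})
    \<le> (\<Sum>i<p ^ n0. V n0 i) * (1 / a) ^ (N - n0) * (a / b) powr l"
proof -
  define S where "S = (\<Sum>i<p ^ n0. V n0 i)"
  define w where "w N i = (\<Prod>k\<in>{n0..<N}. if high k (i div p ^ (N - k)) then a else b)" for N i
  have a: "a > 0" using ab by simp
  have w0: "w N i \<ge> 0" for N i unfolding w_def using a ab by (intro prod_nonneg) auto
  have "(\<Sum>i<p ^ N. w N i * V N i) \<le> S"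
    using N
  proof (induction N rule: dec_induct)
    case base
    then show ?case by (simp add: w_def S_def)
  next
    case (step N)
    have w_child: "w (Suc N) (p * i + j) = w N i * (if high N i then a else b)" if "j < p" for i j
    proof -
      have "(p * i + j) div p ^ (Suc N - k) = i div p ^ (N - k)" if "k < N" for k
      proof -
        have "Suc N - k = Suc (N - k)" using that by simp
        then show ?thesis using \<open>j < p\<close> by (simp add: div_mult2_eq)
      qed
      moreover have "(p * i + j) div p = i" using that by simp
      ultimately show ?thesis using step(1) by (simp add: w_def)
    qed
    have "(\<Sum>i<p ^ Suc N. w (Suc N) i * V (Suc N) i)
        = (\<Sum>i<p ^ N. \<Sum>j<p. w (Suc N) (p * i + j) * V (Suc N) (p * i + j))"
      by (simp add: sum_nat_children)
    also have "\<dots> = (\<Sum>i<p ^ N. w N i * (if high N i then a else b) * (\<Sum>j<p. V (Suc N) (p * i + j)))"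
      by (simp add: w_child sum_distrib_left cong: sum.cong_simp)
    also have "\<dots> \<le> (\<Sum>i<p ^ N. w N i * (if high N i then a else b) * (V N i / (if high N i then a else b)))"
      using w0 a ab step(1) by (intro sum_mono mult_left_mono child) auto
    also have "\<dots> = (\<Sum>i<p ^ N. w N i * V N i)" using a ab by (intro sum.cong) auto
    finally show ?case using step.IH by simp
  qed
  define G where "G = {i. i < p ^ N \<and> real (card {k. n0 \<le> k \<and> k < N \<and> \<not> high k (i div p ^ (N - k))}) \<le> l}"
  have G: "finite G" "G \<subseteq> {..<p ^ N}" by (auto simp: G_def)
  \<comment> \<open>Every low ancestor lowers the weight by \<open>b / a\<close>, so few low
    ancestors leave a large weight. With \<open>V\<close> at least 1, the bound on the weighted sum
    then counts such nodes as in Markov's inequality.\<close>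
  have wG: "a ^ (N - n0) * (b / a) powr l \<le> w N i" if "i \<in> G" for i
  proof -
    let ?P = "\<lambda>k. high k (i div p ^ (N - k))"
    define c where "c = card {k. n0 \<le> k \<and> k < N \<and> \<not> ?P k}"
    have cl: "real c \<le> l" using that by (simp add: c_def G_def)
    have eq: "{n0..<N} \<inter> - {k. ?P k} = {k. n0 \<le> k \<and> k < N \<and> \<not> ?P k}" by auto
    have "card ({n0..<N} \<inter> {k. ?P k}) + card ({n0..<N} \<inter> - {k. ?P k}) = N - n0"
      using card_Un_disjoint[of "{n0..<N} \<inter> {k. ?P k}" "{n0..<N} \<inter> - {k. ?P k}"]
      by (simp add: Int_Un_distrib[symmetric] disjoint_iff)
    then have card: "card ({n0..<N} \<inter> {k. ?P k}) + c = N - n0" by (simp add: eq c_def)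
    have "w N i = a ^ card ({n0..<N} \<inter> {k. ?P k}) * b ^ c"
      unfolding w_def by (simp add: prod.If_cases eq c_def)
    also have "\<dots> = a ^ (N - n0) * (b / a) ^ c"
      using a unfolding card[symmetric] by (simp add: power_add power_divide)
    also have "(b / a) ^ c = (b / a) powr real c" using a ab by (simp add: powr_realpow)
    also have "a ^ (N - n0) * (b / a) powr real c \<ge> a ^ (N - n0) * (b / a) powr l"
      using a ab cl by (intro mult_left_mono powr_mono') auto
    finally show ?thesis .
  qed
  have wV: "0 \<le> w N i * V N i" for i
    by (intro mult_nonneg_nonneg w0 order_trans[OF zero_le_one V])
  have "real (card G) * (a ^ (N - n0) * (b / a) powr l) = (\<Sum>i\<in>G. a ^ (N - n0) * (b / a) powr l)" by simp
  also have "\<dots> \<le> (\<Sum>i\<in>G. w N i * V N i)"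
  proof (rule sum_mono)
    fix i assume "i \<in> G"
    from wG[OF this] mult_left_mono[OF V[of N i] w0[of N i]]
    show "a ^ (N - n0) * (b / a) powr l \<le> w N i * V N i" by simp
  qed
  also have "\<dots> \<le> (\<Sum>i<p ^ N. w N i * V N i)"
    using G wV by (intro sum_mono2) auto
  also have "\<dots> \<le> S" by fact
  finally have le: "real (card G) * (a ^ (N - n0) * (b / a) powr l) \<le> S" .
  have inv: "(a ^ (N - n0) * (b / a) powr l) * ((1 / a) ^ (N - n0) * (a / b) powr l) = 1"
  proof -
    have "(b / a) powr l * (a / b) powr l = 1" using a ab by (simp add: powr_mult[symmetric])
    moreover have "a ^ (N - n0) * (1 / a) ^ (N - n0) = 1" using a by (simp add: power_mult_distrib[symmetric])
    ultimately show ?thesis by (metis mult.assoc mult.commute mult_1_right)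
  qed
  have "real (card G) = real (card G) * ((a ^ (N - n0) * (b / a) powr l) * ((1 / a) ^ (N - n0) * (a / b) powr l))"
    by (simp only: inv mult_1_right)
  also have "\<dots> = (real (card G) * (a ^ (N - n0) * (b / a) powr l)) * ((1 / a) ^ (N - n0) * (a / b) powr l)"
    by (simp only: mult.assoc)
  also have "\<dots> \<le> S * ((1 / a) ^ (N - n0) * (a / b) powr l)"
    using a by (intro mult_right_mono le) auto
  finally show ?thesis by (simp add: G_def S_def mult.assoc)
qed

text \<open>Used with \<open>V = 1 + h\<close>. At a high node the additive constant is dominated
  and the growth is at most \<open>2 * Q\<close>; at a low node the growth is merely bounded,
  possibly by a large number. A small enough proportion \<delta> of low nodes costs no more than
  \<open>exp \<epsilon>\<close> per level.\<close>

lemma few_low_count: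
  fixes h :: "nat \<Rightarrow> nat \<Rightarrow> real"
  assumes p: "p > 0" and h: "\<And>n i. 0 \<le> h n i" and Q: "Q > 0" and D: "D \<ge> 0" and \<epsilon>: "\<epsilon> > 0"
    and child: "\<And>n i. n0 \<le> n \<Longrightarrow> i < p ^ n \<Longrightarrow> (\<Sum>j<p. h (Suc n) (p * i + j)) \<le> Q * h n i + D"
  obtains M \<delta> S where "\<delta> > 0"
    "\<And>N. n0 \<le> N \<Longrightarrow> real (card {i. i < p ^ N \<and>
        real (card {k. n0 \<le> k \<and> k < N \<and> \<not> M < h k (i div p ^ (N - k))}) \<le> \<delta> * real N})
      \<le> S * (2 * Q * exp \<epsilon>) ^ N"
proof -
  \<comment> \<open>Above this height \<open>p + D\<close> is at most \<open>Q * h\<close>, which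
    accounts for the factor 2 in \<open>a\<close>.\<close>
  define M where "M = (real p + D) / Q"
  define a where "a = 1 / (2 * Q)"
  define b where "b = min a (1 / (2 * (real p + D)))"
  have pD: "real p + D > 0" using p D by simp
  have ab: "0 < b" "b \<le> a" "a > 0" using Q pD by (auto simp: a_def b_def)
  \<comment> \<open>The summand 1 keeps the denominator positive when \<open>a = b\<close>.\<close>
  define \<delta> where "\<delta> = \<epsilon> / (ln (a / b) + 1)"
  have ln: "ln (a / b) \<ge> 0" using ab by simp
  have \<delta>: "\<delta> > 0" "\<delta> * ln (a / b) \<le> \<epsilon>"
    using \<epsilon> ln by (auto simp: \<delta>_def field_simps)
  define S where "S = (\<Sum>i<p ^ n0. 1 + h n0 i) / (2 * Q) ^ n0"
  have S: "(\<Sum>i<p ^ n0. 1 + h n0 i) \<ge> 0" using h by (intro sum_nonneg) (simp add: add_nonneg_nonneg)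
  show ?thesis
  proof (rule that[OF \<delta>(1)])
    fix N assume N: "n0 \<le> N"
    have "real (card {i. i < p ^ N \<and> real (card {k. n0 \<le> k \<and> k < N \<and> \<not> M < h k (i div p ^ (N - k))}) \<le> \<delta> * real N})
      \<le> (\<Sum>i<p ^ n0. 1 + h n0 i) * (1 / a) ^ (N - n0) * (a / b) powr (\<delta> * real N)"
    proof (rule tree_count[OF p ab(1,2) _ _ N])
      show "1 \<le> 1 + h n i" for n i using h by simp
      fix n i assume ni: "n0 \<le> n" "i < p ^ n"
      have s: "(\<Sum>j<p. 1 + h (Suc n) (p * i + j)) \<le> real p + D + Q * h n i"
        using child[OF ni] by (simp add: sum.distrib)
      show "(\<Sum>j<p. 1 + h (Suc n) (p * i + j)) \<le> (1 + h n i) / (if M < h n i then a else b)"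
      proof (cases "M < h n i")
        case True
        then have "real p + D \<le> Q * h n i" using Q by (simp add: M_def field_simps)
        then have "real p + D + Q * h n i \<le> (1 + h n i) * (2 * Q)" using Q by (simp add: algebra_simps)
        also have "\<dots> = (1 + h n i) / a" using Q by (simp add: a_def)
        finally show ?thesis using s True by simp
      next
        case False
        then have "Q * h n i \<le> real p + D" using Q by (simp add: M_def field_simps)
        then have "real p + D + Q * h n i \<le> 1 / (1 / (2 * (real p + D)))" by simp
        also have "\<dots> \<le> (1 + h n i) / b"
          using ab pD h[of n i] by (intro frac_le) (auto simp: b_def)
        finally show ?thesis using s False by simp
      qed
    qed
    also have "\<dots> \<le> (\<Sum>i<p ^ n0. 1 + h n0 i) * (1 / a) ^ (N - n0) * exp \<epsilon> ^ N"
    proof (rule mult_left_mono)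
      have "(a / b) powr (\<delta> * real N) = exp (real N * (\<delta> * ln (a / b)))" using ab by (simp add: powr_def)
      also have "\<dots> \<le> exp (real N * \<epsilon>)" using \<delta>(2) by (simp add: mult_left_mono)
      finally show "(a / b) powr (\<delta> * real N) \<le> exp \<epsilon> ^ N" by (simp add: exp_of_nat_mult)
    qed (use S ab in simp)
    also have "(1 / a) ^ (N - n0) = (2 * Q) ^ N / (2 * Q) ^ n0"
      using N Q by (simp add: a_def power_diff)
    finally show "real (card {i. i < p ^ N \<and> real (card {k. n0 \<le> k \<and> k < N \<and> \<not> M < h k (i div p ^ (N - k))}) \<le> \<delta> * real N})
      \<le> S * (2 * Q * exp \<epsilon>) ^ N"
      by (simp add: S_def power_mult_distrib)
  qed
qed

text \<open>Used with \<open>V = 1 + \<kappa> * h\<close>. For small \<kappa> the growth at a low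
  node is at most \<open>p * (1 + \<kappa> * D)\<close>, barely above the number of children, while
  at a high node it is at most \<open>3 * p / 5\<close>. If at least a proportion \<epsilon> of the
  levels is high, the gain beats the total excess by the factor \<theta> per level.\<close>

lemma many_high_count:
  fixes h :: "nat \<Rightarrow> nat \<Rightarrow> real"
  assumes p: "p > 0" and h: "\<And>n i. 0 \<le> h n i" and D: "D \<ge> 0" and \<epsilon>: "0 < \<epsilon>" "\<epsilon> < 1"
    and child: "\<And>n i. n0 \<le> n \<Longrightarrow> i < p ^ n \<Longrightarrow> (\<Sum>j<p. h (Suc n) (p * i + j)) \<le> real p * (h n i / 4 + D)"
  obtains M S \<theta> where "0 < \<theta>" "\<theta> < 1"
    "\<And>N. n0 \<le> N \<Longrightarrow> real (card {i. i < p ^ N \<and>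
        real (card {k. n0 \<le> k \<and> k < N \<and> \<not> M < h k (i div p ^ (N - k))}) \<le> (1 - \<epsilon>) * real N})
      \<le> S * (real p * \<theta>) ^ N"
proof -
  \<comment> \<open>\<open>c\<close> bounds \<open>\<kappa> * D\<close>. The excess over all low
    levels then stays within \<open>(5 / 3) powr (\<epsilon> / 2)\<close> per level, half of the
    gain in the exponent.\<close>
  define c where "c = min 1 ((5 / 3) powr (\<epsilon> / 2) - 1)"
  have c: "0 < c" "c \<le> 1" "1 + c \<le> (5 / 3) powr (\<epsilon> / 2)"
    using \<epsilon> by (auto simp: c_def)
  define \<kappa> where "\<kappa> = c / (D + 1)"
  have \<kappa>: "\<kappa> > 0" "\<kappa> * D \<le> c" using c D by (auto simp: \<kappa>_def field_simps)
  \<comment> \<open>For \<open>y = \<kappa> * h\<close> and \<open>\<kappa> * D \<le> 1\<close>, the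
    inequality \<open>2 + y / 4 \<le> (3 / 5) * (1 + y)\<close> holds from \<open>y = 4\<close>
    on.\<close>
  define M where "M = 4 / \<kappa>"
  define a where "a = 5 / (3 * real p)"
  define b where "b = 1 / (real p * (1 + \<kappa> * D))"
  define \<theta> :: real where "\<theta> = (5 / 3) powr (- (\<epsilon> / 2))"
  have pos: "1 + \<kappa> * D \<ge> 1" using \<kappa> D by simp
  have ab: "0 < b" "b \<le> a" "a > 0"
  proof -
    have pp: "real p \<le> real p * (1 + \<kappa> * D)" using mult_left_mono[OF pos, of "real p"] by simp
    then show "0 < b" using p by (simp add: b_def)
    have "b \<le> 1 / real p" unfolding b_def using pp p by (intro divide_left_mono) auto
    also have "\<dots> \<le> a" using p by (simp add: a_def field_simps)
    finally show "b \<le> a" .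
    show "a > 0" using p by (simp add: a_def)
  qed
  have "1 < (5 / 3 :: real) powr (\<epsilon> / 2)" using \<epsilon> by (intro gr_one_powr) auto
  then have \<theta>: "0 < \<theta>" "\<theta> < 1" unfolding \<theta>_def powr_minus by (auto simp: inverse_less_1_iff)
  define S0 where "S0 = (\<Sum>i<p ^ n0. 1 + \<kappa> * h n0 i)"
  have S0: "S0 \<ge> 0" unfolding S0_def using h \<kappa> by (intro sum_nonneg) (simp add: add_nonneg_nonneg)
  show ?thesis
  proof (rule that[OF \<theta>])
    fix N assume N: "n0 \<le> N"
    have "real (card {i. i < p ^ N \<and> real (card {k. n0 \<le> k \<and> k < N \<and> \<not> M < h k (i div p ^ (N - k))}) \<le> (1 - \<epsilon>) * real N})
      \<le> S0 * (1 / a) ^ (N - n0) * (a / b) powr ((1 - \<epsilon>) * real N)"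
      unfolding S0_def
    proof (rule tree_count[OF p ab(1,2) _ _ N])
      show "1 \<le> 1 + \<kappa> * h n i" for n i using h \<kappa> by simp
      fix n i assume ni: "n0 \<le> n" "i < p ^ n"
      define y where "y = \<kappa> * h n i"
      have y: "y \<ge> 0" using h \<kappa> by (simp add: y_def)
      have "(\<Sum>j<p. 1 + \<kappa> * h (Suc n) (p * i + j)) = real p + \<kappa> * (\<Sum>j<p. h (Suc n) (p * i + j))"
        by (simp add: sum.distrib sum_distrib_left)
      also have "\<dots> \<le> real p + \<kappa> * (real p * (h n i / 4 + D))"
        using \<kappa> by (intro add_left_mono mult_left_mono child ni) auto
      also have "\<dots> = real p * (1 + \<kappa> * D + y / 4)" by (simp add: y_def algebra_simps)
      finally have s: "(\<Sum>j<p. 1 + \<kappa> * h (Suc n) (p * i + j)) \<le> real p * (1 + \<kappa> * D + y / 4)" .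
      show "(\<Sum>j<p. 1 + \<kappa> * h (Suc n) (p * i + j)) \<le> (1 + \<kappa> * h n i) / (if M < h n i then a else b)"
      proof (cases "M < h n i")
        case True
        then have "4 \<le> y" using \<kappa> by (simp add: M_def y_def field_simps)
        then have "1 + \<kappa> * D + y / 4 \<le> (3 / 5) * (1 + y)" using \<kappa> c by simp
        then have "real p * (1 + \<kappa> * D + y / 4) \<le> real p * ((3 / 5) * (1 + y))" by (rule mult_left_mono) simp
        also have "\<dots> = (1 + y) / a" by (simp add: a_def)
        finally show ?thesis using s True by (simp add: y_def)
      next
        case False
        have "1 + \<kappa> * D + y / 4 \<le> (1 + \<kappa> * D) * (1 + y)"
          using y mult_right_mono[OF pos y] by (simp add: algebra_simps)
        then have "real p * (1 + \<kappa> * D + y / 4) \<le> real p * ((1 + \<kappa> * D) * (1 + y))" by (rule mult_left_mono) simp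
        also have "\<dots> = (1 + y) / b" by (simp add: b_def)
        finally show ?thesis using s False by (simp add: y_def)
      qed
    qed
    also have "\<dots> \<le> S0 * (1 / a) ^ (N - n0) * ((5 / 3) powr (1 - \<epsilon> / 2)) ^ N"
    proof (rule mult_left_mono)
      have "a / b = (5 / 3) * (1 + \<kappa> * D)" using p by (simp add: a_def b_def)
      also have "\<dots> \<le> (5 / 3) * (5 / 3) powr (\<epsilon> / 2)" using c \<kappa> by simp
      also have "\<dots> = (5 / 3) powr (1 + \<epsilon> / 2)" by (simp add: powr_add)
      finally have "(a / b) powr ((1 - \<epsilon>) * real N) \<le> ((5 / 3) powr (1 + \<epsilon> / 2)) powr ((1 - \<epsilon>) * real N)"
        using ab \<epsilon> by (intro powr_mono2) auto
      also have "\<dots> = (5 / 3) powr ((1 + \<epsilon> / 2) * (1 - \<epsilon>) * real N)" by (simp add: powr_powr mult.assoc)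
      also have "\<dots> \<le> (5 / 3) powr ((1 - \<epsilon> / 2) * real N)"
      proof (intro powr_mono mult_right_mono)
        show "(1 + \<epsilon> / 2) * (1 - \<epsilon>) \<le> 1 - \<epsilon> / 2" using \<epsilon> by (simp add: algebra_simps)
      qed auto
      also have "\<dots> = ((5 / 3) powr (1 - \<epsilon> / 2)) ^ N" by (simp add: powr_powr[symmetric] powr_realpow)
      finally show "(a / b) powr ((1 - \<epsilon>) * real N) \<le> ((5 / 3) powr (1 - \<epsilon> / 2)) ^ N" .
    qed (use S0 ab in simp)
    also have "(1 / a) ^ (N - n0) = (3 * real p / 5) ^ N / (3 * real p / 5) ^ n0"
      using N p by (simp add: a_def power_diff)
    also have "S0 * ((3 * real p / 5) ^ N / (3 * real p / 5) ^ n0) * ((5 / 3) powr (1 - \<epsilon> / 2)) ^ N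
       = (S0 / (3 * real p / 5) ^ n0) * ((3 * real p / 5) * (5 / 3) powr (1 - \<epsilon> / 2)) ^ N"
    proof -
      have "A * (x ^ N / z) * y ^ N = (A / z) * (x * y) ^ N" for A x y z :: real
        by (simp add: power_mult_distrib)
      then show ?thesis .
    qed
    also have "(3 * real p / 5) * (5 / 3) powr (1 - \<epsilon> / 2) = real p * \<theta>"
      using powr_add[of "5 / 3 :: real" 1 "- (\<epsilon> / 2)"] by (simp add: \<theta>_def)
    finally show "real (card {i. i < p ^ N \<and> real (card {k. n0 \<le> k \<and> k < N \<and> \<not> M < h k (i div p ^ (N - k))}) \<le> (1 - \<epsilon>) * real N})
      \<le> (S0 / (3 * real p / 5) ^ n0) * (real p * \<theta>) ^ N"
      by simp
  qed
qed

section \<open>Cells of the p-adic subdivision\<close>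

text \<open>The centre of the i-th of \<open>p ^ N\<close> equal cells of [-1,1]. Each cell has
  half-length \<open>(1 / p) ^ N\<close>, so lying in the closed cell is a bound on the distance to
  the midpoint.\<close>

definition midpt :: "nat \<Rightarrow> nat \<Rightarrow> nat \<Rightarrow> real" where
  "midpt p N i = -1 + (2 * real i + 1) / real p ^ N"

lemma midpt_in: assumes "i < p ^ N" shows "midpt p N i \<in> {-1..1}"
proof -
  have "0 < p ^ N" using assms by linarith
  then have "0 < real (p ^ N)" by (simp only: of_nat_0_less_iff)
  then have p: "real p ^ N > 0" by simp
  have "real (Suc i) \<le> real (p ^ N)" using assms by (simp only: of_nat_le_iff Suc_le_eq)
  then have "2 * real i + 1 \<le> 2 * real p ^ N" by simp
  then have "(2 * real i + 1) / real p ^ N \<le> 2" using p by (simp add: divide_le_eq)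
  then show ?thesis using p by (simp add: midpt_def)
qed

lemma midpt_exists:
  assumes s: "s \<in> {-1..1}" and p: "p > 0"
  shows "\<exists>i<p ^ N. \<bar>s - midpt p N i\<bar> \<le> (1 / real p) ^ N"
proof -
  let ?P = "real p ^ N"
  have P: "?P > 0" using p by simp
  define y where "y = (s + 1) * ?P / 2"
  have y: "0 \<le> y" "y \<le> ?P" using s P by (auto simp: y_def)
  have "\<exists>i<p ^ N. real i \<le> y \<and> y \<le> real i + 1"
  proof (cases "y < ?P")
    case True
    then have "real (nat \<lfloor>y\<rfloor>) < real (p ^ N)" using y by simp linarith
    then have "nat \<lfloor>y\<rfloor> < p ^ N" by (simp only: of_nat_less_iff)
    moreover have "real (nat \<lfloor>y\<rfloor>) \<le> y \<and> y \<le> real (nat \<lfloor>y\<rfloor>) + 1" using y by simp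
    ultimately show ?thesis by blast
  next
    \<comment> \<open>The right endpoint \<open>s = 1\<close> goes to the last cell.\<close>
    case False
    then have "y = real (p ^ N)" using y by simp
    moreover have "p ^ N > 0" using p by simp
    ultimately show ?thesis by (intro exI[of _ "p ^ N - 1"]) (auto simp: of_nat_diff)
  qed
  then obtain i where i: "i < p ^ N" "real i \<le> y" "y \<le> real i + 1" by blast
  have "s - midpt p N i = (2 * y - (2 * real i + 1)) / ?P"
    using P by (simp add: midpt_def y_def field_simps)
  then have "\<bar>s - midpt p N i\<bar> = \<bar>2 * y - (2 * real i + 1)\<bar> / ?P" using P by (simp add: abs_divide)
  also have "\<dots> \<le> 1 / ?P" using i P by (intro divide_right_mono) auto
  finally show ?thesis using i(1) by (auto simp: power_one_over)
qed

text \<open>Cells are nested: the two midpoints differ by at most \<open>p - 1\<close> half-lengths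
  of the child, and the parent's half-length is \<open>p\<close> of them.\<close>

lemma midpt_parent:
  assumes p: "p > 0" and s: "\<bar>s - midpt p (Suc N) i\<bar> \<le> (1 / real p) ^ Suc N"
  shows "\<bar>s - midpt p N (i div p)\<bar> \<le> (1 / real p) ^ N"
proof -
  let ?P = "real p ^ Suc N"
  have P: "?P > 0" using p by simp
  define q j where "q = i div p" and "j = i mod p"
  have i: "real i = real p * real q + real j"
    unfolding q_def j_def by (metis mult_div_mod_eq of_nat_add of_nat_mult)
  have "Suc j \<le> p" using p mod_less_divisor[of p i] by (simp add: j_def Suc_le_eq)
  then have "real (Suc j) \<le> real p" by (simp only: of_nat_le_iff)
  then have j: "real j \<le> real p - 1" by simp
  have "midpt p (Suc N) i - midpt p N q = (2 * real j + 1 - real p) / ?P"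
    using p by (simp add: midpt_def i field_simps)
  then have "\<bar>midpt p (Suc N) i - midpt p N q\<bar> = \<bar>2 * real j + 1 - real p\<bar> / ?P" using P by (simp add: abs_divide)
  also have "\<dots> \<le> (real p - 1) / ?P" using j P by (intro divide_right_mono) auto
  finally have "\<bar>midpt p (Suc N) i - midpt p N q\<bar> \<le> (real p - 1) / ?P" .
  moreover have "(1 / real p) ^ Suc N = 1 / ?P" by (simp add: power_one_over)
  moreover have "(1 / real p) ^ N = (real p - 1) / ?P + 1 / ?P"
    using p by (simp add: power_one_over add_divide_distrib[symmetric])
  ultimately show ?thesis using s unfolding q_def[symmetric] by linarith
qed

lemma midpt_ancestor:
  assumes p: "p > 0" and "\<bar>s - midpt p N i\<bar> \<le> (1 / real p) ^ N" and "k \<le> N"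
  shows "\<bar>s - midpt p k (i div p ^ (N - k))\<bar> \<le> (1 / real p) ^ k"
  using assms(3,2)
proof (induction N arbitrary: i rule: dec_induct)
  case base
  then show ?case by simp
next
  case (step N)
  from step.IH[OF midpt_parent[OF p step.prems]]
  show ?case using step.hyps by (simp add: Suc_diff_le div_mult2_eq)
qed

section \<open>Sets covered by few cells at infinitely many or all large levels\<close>

text \<open>A point near the chosen centres at infinitely many levels is covered by the balls of all
  levels from \<open>N1\<close> on. Their total cost is a geometric tail in
  \<open>\<rho> * r powr d\<close>, which tends to 0 with growing \<open>N1\<close>.\<close>

lemma hausdorff_measure_limsup_zero:
  fixes c :: "nat \<Rightarrow> nat \<Rightarrow> real" and G :: "nat \<Rightarrow> nat set"
  assumes fin: "\<And>N. finite (G N)" and card: "\<And>N. N0 \<le> N \<Longrightarrow> real (card (G N)) \<le> S * \<rho> ^ N"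
    and r: "0 < r" "r < 1" and d: "d > 0" and \<rho>: "\<rho> > 0" "\<rho> * r powr d < 1"
    and Z: "\<And>s. s \<in> Z \<Longrightarrow> \<exists>\<^sub>F N in sequentially. \<exists>i\<in>G N. \<bar>s - c N i\<bar> \<le> r ^ N"
  shows "hausdorff_measure d Z = 0"
proof -
  define q where "q = \<rho> * r powr d"
  have q: "0 < q" "q < 1" using \<rho> r by (auto simp: q_def)
  define C where "C = S * 2 powr d"
  have "hausdorff_premeasure d \<delta> Z \<le> 0" if \<delta>: "\<delta> > 0" for \<delta>
  proof (rule ennreal_le_epsilon)
    fix e :: real assume e: "e > 0"
    have "(\<lambda>N. 2 * r ^ N) \<longlonglongrightarrow> 2 * 0" using r by (intro tendsto_intros LIMSEQ_power_zero) auto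
    then have "\<forall>\<^sub>F N in sequentially. 2 * r ^ N < \<delta>" using \<delta> by (intro order_tendstoD(2)) auto
    moreover have "(\<lambda>N. C * q ^ N / (1 - q)) \<longlonglongrightarrow> C * 0 / (1 - q)" using q by (intro tendsto_intros LIMSEQ_power_zero) auto
    then have "\<forall>\<^sub>F N in sequentially. C * q ^ N / (1 - q) < e" using e by (intro order_tendstoD(2)) auto
    ultimately have "\<forall>\<^sub>F N in sequentially. N0 \<le> N \<and> 2 * r ^ N < \<delta> \<and> C * q ^ N / (1 - q) < e"
      using eventually_ge_at_top[of N0] by eventually_elim auto
    then obtain N1 where N1: "N0 \<le> N1" "2 * r ^ N1 < \<delta>" "C * q ^ N1 / (1 - q) < e"
      using eventually_happens'[OF trivial_limit_sequentially] by blast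
    \<comment> \<open>Covers are indexed by natural numbers, so levels and nodes are enumerated
      together. Pairs that stand for no node get the empty set, whose \<open>diameter_power\<close>
      is 0.\<close>
    define B where "B = (\<lambda>(N, i). if N1 \<le> N \<and> i \<in> G N then cball (c N i) (r ^ N) else {})"
    have dB: "diameter (B (N, i)) = (if N1 \<le> N \<and> i \<in> G N then 2 * r ^ N else 0)" for N i
      using r by (simp add: B_def)
    have "hausdorff_premeasure d \<delta> Z \<le> (\<Sum>n. diameter_power d (B (prod_decode n)))"
      unfolding hausdorff_premeasure_def
    proof (rule INF_lower, intro CollectI conjI allI)
      show "Z \<subseteq> (\<Union>n. B (prod_decode n))"
      proof
        fix s assume "s \<in> Z"
        from Z[OF this] have "\<exists>N\<ge>N1. \<exists>i\<in>G N. \<bar>s - c N i\<bar> \<le> r ^ N"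
          by (auto simp: frequently_sequentially)
        then obtain N i where Ni: "N1 \<le> N" "i \<in> G N" "\<bar>s - c N i\<bar> \<le> r ^ N" by blast
        then have "s \<in> B (prod_decode (prod_encode (N, i)))" by (simp add: B_def dist_real_def abs_minus_commute)
        then show "s \<in> (\<Union>n. B (prod_decode n))" by blast
      qed
      fix n
      obtain N i where Ni: "prod_decode n = (N, i)" by (cases "prod_decode n")
      show "bounded (B (prod_decode n))" by (simp add: Ni B_def)
      have "r ^ N \<le> r ^ N1" if "N1 \<le> N" using r that by (intro power_decreasing) auto
      then show "diameter (B (prod_decode n)) \<le> \<delta>" unfolding Ni dB using N1(2) \<delta> by auto
    qed
    also have "\<dots> = (\<Sum>N. \<Sum>i. diameter_power d (B (N, i)))"
      by (rule suminf_ennreal_2dimen) simp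
    also have "\<dots> \<le> (\<Sum>N. ennreal (if N1 \<le> N then C * q ^ N else 0))"
    proof (intro suminf_le summableI)
      fix N
      have "(\<Sum>i. diameter_power d (B (N, i))) = (\<Sum>i\<in>G N. diameter_power d (B (N, i)))"
        by (rule suminf_finite[OF fin]) (simp add: B_def diameter_power_def)
      also have "\<dots> \<le> ennreal (if N1 \<le> N then C * q ^ N else 0)"
      proof (cases "N1 \<le> N")
        case True
        have "(\<Sum>i\<in>G N. diameter_power d (B (N, i))) = (\<Sum>i\<in>G N. ennreal ((2 * r ^ N) powr d))"
          using True d r by (intro sum.cong) (auto simp: diameter_power_def dB, auto simp: B_def)
        also have "\<dots> = ennreal (real (card (G N)) * (2 * r ^ N) powr d)"
          by (simp add: ennreal_of_nat_eq_real_of_nat ennreal_mult'')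
        also have "\<dots> \<le> ennreal ((S * \<rho> ^ N) * (2 * r ^ N) powr d)"
          using True N1(1) by (intro ennreal_leI mult_right_mono card) auto
        also have "(2 * r ^ N) powr d = 2 powr d * (r powr d) ^ N"
          using r by (simp add: powr_mult powr_realpow[symmetric] powr_powr mult.commute)
        also have "(S * \<rho> ^ N) * (2 powr d * (r powr d) ^ N) = C * q ^ N"
          by (simp add: C_def q_def power_mult_distrib)
        finally show ?thesis using True by simp
      qed (simp add: B_def diameter_power_def)
      finally show "(\<Sum>i. diameter_power d (B (N, i))) \<le> ennreal (if N1 \<le> N then C * q ^ N else 0)" .
    qed
    also have "\<dots> = ennreal (C * q ^ N1 / (1 - q))"
    proof (rule suminf_ennreal_eq)
      have S0: "S \<ge> 0"
      proof -
        have "0 \<le> S * \<rho> ^ N0" using card[of N0] by (meson of_nat_0_le_iff order_refl order_trans)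
        then show ?thesis using zero_less_power[OF \<rho>(1), of N0] by (auto simp: zero_le_mult_iff)
      qed
      then show "0 \<le> (if N1 \<le> N then C * q ^ N else 0)" for N using q by (simp add: C_def)
      have "(\<lambda>i. (C * q ^ N1) * q ^ i) sums ((C * q ^ N1) * (1 / (1 - q)))"
        using q by (intro sums_mult geometric_sums) auto
      then have "(\<lambda>i. if N1 \<le> i + N1 then C * q ^ (i + N1) else 0) sums (C * q ^ N1 / (1 - q))"
        by (simp add: power_add mult_ac)
      then show "(\<lambda>N. if N1 \<le> N then C * q ^ N else 0) sums (C * q ^ N1 / (1 - q))"
        by (subst (asm) sums_zero_iff_shift) auto
    qed
    also have "\<dots> \<le> 0 + ennreal e" using N1(3) by (simp add: ennreal_leI)
    finally show "hausdorff_premeasure d \<delta> Z \<le> 0 + ennreal e" .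
  qed
  then show ?thesis unfolding hausdorff_measure_def by (auto intro!: antisym SUP_least)
qed

lemma AE_eventually_not_near:
  fixes c :: "nat \<Rightarrow> nat \<Rightarrow> real" and G :: "nat \<Rightarrow> nat set"
  assumes fin: "\<And>N. finite (G N)" and card: "\<And>N. N0 \<le> N \<Longrightarrow> real (card (G N)) \<le> S * \<rho> ^ N"
    and r: "0 < r" and \<rho>: "\<rho> > 0" "\<rho> * r < 1"
  shows "AE s in lebesgue. \<forall>\<^sub>F N in sequentially. \<forall>i\<in>G N. \<not> \<bar>s - c N i\<bar> \<le> r ^ N"
proof -
  define A where "A N = (\<Union>i\<in>G N. cball (c N i) (r ^ N))" for N
  have mA: "A N \<in> sets lborel" for N unfolding A_def using fin by auto
  have eA: "emeasure lborel (A N) \<le> ennreal (real (card (G N)) * (2 * r ^ N))" for N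
  proof -
    have "emeasure lborel (A N) \<le> (\<Sum>i\<in>G N. emeasure lborel (cball (c N i) (r ^ N)))"
      unfolding A_def using fin by (intro emeasure_subadditive_finite) auto
    also have "\<dots> = (\<Sum>i\<in>G N. ennreal (2 * r ^ N))"
      using r by (intro sum.cong) (auto simp: cball_eq_atLeastAtMost)
    also have "\<dots> = ennreal (real (card (G N)) * (2 * r ^ N))"
      using r by (simp add: ennreal_of_nat_eq_real_of_nat ennreal_mult)
    finally show ?thesis .
  qed
  have "AE s in lborel. \<forall>\<^sub>F N in sequentially. s \<in> space lborel - A N"
  proof (rule borel_cantelli_AE1[OF mA])
    show "emeasure lborel (A N) < \<infinity>" for N using eA[of N] by (simp add: order_le_less_trans)
    have "summable (\<lambda>N. (2 * S) * (\<rho> * r) ^ N)"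
      using \<rho> r by (intro summable_mult summable_geometric) auto
    then show "summable (\<lambda>N. measure lborel (A N))"
    proof (rule summable_comparison_test_ev[rotated])
      show "\<forall>\<^sub>F N in sequentially. norm (measure lborel (A N)) \<le> (2 * S) * (\<rho> * r) ^ N"
        using eventually_ge_at_top[of N0]
      proof eventually_elim
        case (elim N)
        have "measure lborel (A N) \<le> real (card (G N)) * (2 * r ^ N)"
          unfolding measure_def using r by (intro enn2real_leI eA) auto
        also have "\<dots> \<le> (S * \<rho> ^ N) * (2 * r ^ N)" using r by (intro mult_right_mono card elim) auto
        finally show ?case by (simp add: power_mult_distrib mult_ac)
      qed
    qed
  qed
  then have "AE s in lborel. \<forall>\<^sub>F N in sequentially. \<forall>i\<in>G N. \<not> \<bar>s - c N i\<bar> \<le> r ^ N"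
    by eventually_elim (auto elim!: eventually_mono simp: A_def dist_real_def abs_minus_commute)
  then show ?thesis by (rule AE_completion)
qed

section \<open>Tight functionals\<close>

lemma bounded_continuous_I:
  assumes "continuous_on UNIV \<psi>" "\<And>x. \<bar>\<psi> x\<bar> \<le> B"
  shows "\<psi> \<in> bounded_continuous"
  using assms by (auto simp: bounded_continuous_def bounded_iff)

lemma bounded_continuous_D:
  assumes "\<psi> \<in> bounded_continuous"
  shows "continuous_on UNIV \<psi>" and "\<exists>B>0. \<forall>x. \<bar>\<psi> x\<bar> \<le> B"
  using assms by (auto simp: bounded_continuous_def bounded_pos)

lemma bounded_continuous_const: "(\<lambda>_. c) \<in> bounded_continuous"
  by (rule bounded_continuous_I[of _ "\<bar>c\<bar>"]) (auto intro: continuous_intros)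

lemma bounded_continuous_add:
  assumes "\<psi> \<in> bounded_continuous" "\<zeta> \<in> bounded_continuous"
  shows "(\<lambda>x. \<psi> x + \<zeta> x) \<in> bounded_continuous"
proof -
  obtain B C where "\<And>x. \<bar>\<psi> x\<bar> \<le> B" "\<And>x. \<bar>\<zeta> x\<bar> \<le> C"
    using assms[THEN bounded_continuous_D(2)] by blast
  then have "\<And>x. \<bar>\<psi> x + \<zeta> x\<bar> \<le> B + C" by (meson abs_triangle_ineq add_mono order_trans)
  then show ?thesis
    using assms[THEN bounded_continuous_D(1)]
    by (auto intro!: bounded_continuous_I[of _ "B + C"] continuous_on_add)
qed

lemma bounded_continuous_mult_const:
  assumes "\<psi> \<in> bounded_continuous"
  shows "(\<lambda>x. c * \<psi> x) \<in> bounded_continuous"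
proof -
  obtain B where "\<And>x. \<bar>\<psi> x\<bar> \<le> B"
    using assms[THEN bounded_continuous_D(2)] by blast
  then have "\<And>x. \<bar>c * \<psi> x\<bar> \<le> \<bar>c\<bar> * B" by (simp add: abs_mult mult_left_mono)
  then show ?thesis
    using assms[THEN bounded_continuous_D(1)]
    by (auto intro!: bounded_continuous_I[of _ "\<bar>c\<bar> * B"] continuous_on_mult_left)
qed

lemma bounded_continuous_max_0:
  assumes "\<psi> \<in> bounded_continuous"
  shows "(\<lambda>x. max 0 (\<psi> x)) \<in> bounded_continuous"
proof -
  obtain B where B: "\<And>x. \<bar>\<psi> x\<bar> \<le> B"
    using assms[THEN bounded_continuous_D(2)] by blast
  have "\<bar>max 0 (\<psi> x)\<bar> \<le> B" for x using B[of x] by auto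
  then show ?thesis
    by (rule bounded_continuous_I[OF continuous_on_max[OF continuous_on_const bounded_continuous_D(1)[OF assms]]])
qed

lemma bounded_continuous_sum:
  assumes "\<And>i. i \<in> I \<Longrightarrow> \<psi> i \<in> bounded_continuous"
  shows "(\<lambda>x. \<Sum>i\<in>I. \<psi> i x) \<in> bounded_continuous"
  using assms
  by (induction I rule: infinite_finite_induct) (auto intro: bounded_continuous_const bounded_continuous_add)

text \<open>\<open>X\<close> need not be locally compact, so the usual Riesz theorem does not apply; tightness takes
  its place. The measure comes from the outer measure that is defined on open sets by approximation
  from below.\<close>

locale tight_functional =
  fixes L :: "('x::metric_space \<Rightarrow> real) \<Rightarrow> real"
  assumes L_add: "\<lbrakk>\<psi> \<in> bounded_continuous; \<zeta> \<in> bounded_continuous\<rbrakk> \<Longrightarrow> L (\<lambda>x. \<psi> x + \<zeta> x) = L \<psi> + L \<zeta>"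
    and L_mult: "\<psi> \<in> bounded_continuous \<Longrightarrow> L (\<lambda>x. c * \<psi> x) = c * L \<psi>"
    and L_mono: "\<lbrakk>\<psi> \<in> bounded_continuous; \<zeta> \<in> bounded_continuous; \<And>x. \<psi> x \<le> \<zeta> x\<rbrakk> \<Longrightarrow> L \<psi> \<le> L \<zeta>"
    and L_one: "L (\<lambda>_. 1) = 1"
    and L_tight: "\<epsilon> > 0 \<Longrightarrow> \<exists>K. compact K \<and> (\<forall>\<psi>\<in>bounded_continuous.
       (\<forall>x. 0 \<le> \<psi> x \<and> \<psi> x \<le> 1) \<longrightarrow> (\<forall>x\<in>K. \<psi> x = 0) \<longrightarrow> L \<psi> \<le> \<epsilon>)"
begin

lemma L_const: "L (\<lambda>_. c) = c"
  using L_mult[OF bounded_continuous_const, of c 1] L_one by simp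

lemma L_sum: "(\<And>i. i \<in> I \<Longrightarrow> \<psi> i \<in> bounded_continuous) \<Longrightarrow> L (\<lambda>x. \<Sum>i\<in>I. \<psi> i x) = (\<Sum>i\<in>I. L (\<psi> i))"
  by (induction I rule: infinite_finite_induct) (simp_all add: L_const L_add bounded_continuous_sum)

definition below :: "'x set \<Rightarrow> ('x \<Rightarrow> real) set" where
  "below U = {\<psi> \<in> bounded_continuous. \<forall>x. 0 \<le> \<psi> x \<and> \<psi> x \<le> indicator U x}"

definition \<tau> :: "'x set \<Rightarrow> ennreal" where "\<tau> U = (SUP \<psi>\<in>below U. ennreal (L \<psi>))"

definition \<mu> :: "'x set \<Rightarrow> ennreal" where "\<mu> A = (INF U\<in>{U. open U \<and> A \<subseteq> U}. \<tau> U)"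

lemma belowD:
  assumes "\<psi> \<in> below U"
  shows "\<psi> \<in> bounded_continuous" "0 \<le> \<psi> x" "\<psi> x \<le> 1" "x \<notin> U \<Longrightarrow> \<psi> x = 0"
proof -
  have 1: "\<psi> \<in> bounded_continuous" and 2: "0 \<le> \<psi> x \<and> \<psi> x \<le> indicator U x" for x
    using assms by (auto simp: below_def)
  show "\<psi> \<in> bounded_continuous" by (fact 1)
  show "0 \<le> \<psi> x" "\<psi> x \<le> 1" "x \<notin> U \<Longrightarrow> \<psi> x = 0"
    using 2[of x] by (cases "x \<in> U"; simp)+
qed

lemma below_L: "\<psi> \<in> below U \<Longrightarrow> ennreal (L \<psi>) \<le> \<tau> U"
  unfolding \<tau>_def by (rule SUP_upper)

lemma zero_below: "(\<lambda>_. 0) \<in> below U"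
  by (simp add: below_def bounded_continuous_const)

lemma L_nonneg: "\<psi> \<in> bounded_continuous \<Longrightarrow> (\<And>x. 0 \<le> \<psi> x) \<Longrightarrow> 0 \<le> L \<psi>"
  using L_mono[OF bounded_continuous_const, of \<psi> 0] L_const by simp

lemma \<tau>_mono: "U \<subseteq> V \<Longrightarrow> \<tau> U \<le> \<tau> V"
proof -
  assume "U \<subseteq> V"
  then have "indicator U x \<le> (indicator V x :: real)" for x by (auto simp: indicator_def)
  then have "below U \<subseteq> below V" unfolding below_def by (blast intro: order_trans)
  then show ?thesis unfolding \<tau>_def by (intro SUP_subset_mono) auto
qed

lemma \<mu>_open: "open U \<Longrightarrow> \<mu> U = \<tau> U"
  unfolding \<mu>_def by (intro antisym INF_lower INF_greatest \<tau>_mono) auto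

lemma \<mu>_mono: "A \<subseteq> A' \<Longrightarrow> \<mu> A \<le> \<mu> A'"
  unfolding \<mu>_def by (intro INF_superset_mono) auto

lemma \<mu>_empty: "\<mu> {} = 0"
proof -
  have "L \<psi> = 0" if "\<psi> \<in> below {}" for \<psi>
  proof -
    have "\<psi> = (\<lambda>_. 0)" using belowD(4)[OF that] by auto
    then show ?thesis by (simp add: L_const)
  qed
  then have "\<tau> {} = 0" using zero_below by (auto simp: \<tau>_def intro!: antisym SUP_least)
  then show ?thesis by (simp add: \<mu>_open)
qed

text \<open>A function below the union is at least \<open>e / 2\<close> on a part \<open>C\<close>
  of the tight compact set, and finitely many of the \<open>U i\<close> cover \<open>C\<close>. On
  the rest of the compact set it is below \<open>e / 2\<close>; outside, tightness pays another
  \<open>e / 2\<close>.\<close>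

lemma \<tau>_countably_subadditive:
  assumes op: "\<And>i::nat. open (U i)"
  shows "\<tau> (\<Union>i. U i) \<le> (\<Sum>i. \<tau> (U i))"
proof (rule ennreal_le_epsilon)
  fix e :: real assume e: "e > 0"
  show "\<tau> (\<Union>i. U i) \<le> (\<Sum>i. \<tau> (U i)) + ennreal e"
    unfolding \<tau>_def[of "\<Union>i. U i"]
  proof (rule SUP_least)
    fix \<psi> assume \<psi>: "\<psi> \<in> below (\<Union>i. U i)"
    note bc = belowD(1)[OF \<psi>]
    from L_tight[of "e / 2"] e obtain K where K: "compact K" and K2: "\<forall>\<psi>\<in>bounded_continuous.
       (\<forall>x. 0 \<le> \<psi> x \<and> \<psi> x \<le> 1) \<longrightarrow> (\<forall>x\<in>K. \<psi> x = 0) \<longrightarrow> L \<psi> \<le> e / 2"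
      by auto
    define C where "C = K \<inter> {x. e / 2 \<le> \<psi> x}"
    have "closed {x. e / 2 \<le> \<psi> x}"
      using bounded_continuous_D(1)[OF bc] by (intro closed_Collect_le continuous_on_const)
    then have C: "compact C" unfolding C_def by (intro compact_Int_closed K)
    have "C \<subseteq> (\<Union>i. U i)"
    proof
      fix x assume "x \<in> C"
      then have "\<psi> x > 0" using e by (simp add: C_def)
      then show "x \<in> (\<Union>i. U i)" using belowD(4)[OF \<psi>, of x] by auto
    qed
    then obtain I where I: "finite I" "C \<subseteq> (\<Union>i\<in>I. U i)"
      using compactE_image[OF C, of UNIV U] op by (metis UNIV_I subset_UNIV)
    \<comment> \<open>These functions increase with \<open>k\<close> to the indicator of
      \<open>U i\<close>. The whole space is treated apart because \<open>infdist\<close> to the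
      empty set is 0.\<close>
    define \<theta> where "\<theta> k i x = (if U i = UNIV then 1 else min 1 (real k * infdist x (- U i)))" for k i x
    have \<theta>: "\<theta> k i \<in> below (U i)" for k i
    proof -
      have 1: "0 \<le> \<theta> k i x \<and> \<theta> k i x \<le> indicator (U i) x" for x
        by (auto simp: \<theta>_def infdist_nonneg indicator_def)
      have "continuous_on UNIV (\<theta> k i)"
        unfolding \<theta>_def[abs_def] by (cases "U i = UNIV") (auto intro!: continuous_intros)
      then have "\<theta> k i \<in> bounded_continuous"
      proof (rule bounded_continuous_I)
        show "\<bar>\<theta> k i x\<bar> \<le> 1" for x using 1[of x] by (cases "x \<in> U i") auto
      qed
      then show ?thesis using 1 by (simp add: below_def)
    qed
    have "\<exists>k. \<forall>x\<in>C. 1 \<le> (\<Sum>i\<in>I. \<theta> k i x)"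
    proof -
      define Op where "Op k = {x. \<exists>i\<in>I. 1 < real k * infdist x (- U i) \<or> U i = UNIV}" for k
      have "open (Op k)" for k
      proof -
        have "Op k = (\<Union>i\<in>I. if U i = UNIV then UNIV else {x. 1 < real k * infdist x (- U i)})"
          by (auto simp: Op_def split: if_splits)
        moreover have "open {x. 1 < real k * infdist x (- U i)}" for i
          by (intro open_Collect_less continuous_intros)
        ultimately show ?thesis by auto
      qed
      moreover have "C \<subseteq> (\<Union>k. Op k)"
      proof
        fix x assume "x \<in> C"
        then obtain i where i: "i \<in> I" "x \<in> U i" using I by blast
        show "x \<in> (\<Union>k. Op k)"
        proof (cases "U i = UNIV")
          case False
          have "infdist x (- U i) \<noteq> 0"
            using in_closed_iff_infdist_zero[of "- U i" x] op[of i] False i by auto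
          then have "infdist x (- U i) > 0" using infdist_nonneg[of x "- U i"] by simp
          then obtain k where "1 < real k * infdist x (- U i)" using reals_Archimedean3 by blast
          then show ?thesis using i by (auto simp: Op_def)
        qed (use i in \<open>auto simp: Op_def\<close>)
      qed
      ultimately obtain J where J: "finite J" "C \<subseteq> (\<Union>k\<in>J. Op k)"
        using compactE_image[OF C, of UNIV Op] by (metis UNIV_I subset_UNIV)
      define k where "k = Max (insert 0 J)"
      have "1 \<le> (\<Sum>i\<in>I. \<theta> k i x)" if "x \<in> C" for x
      proof -
        from that J(2) obtain j where "j \<in> J" "x \<in> Op j" by blast
        then obtain i where ji: "j \<in> J" "i \<in> I" "1 < real j * infdist x (- U i) \<or> U i = UNIV"
          by (auto simp: Op_def)
        have "j \<le> k" using ji J by (simp add: k_def)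
        then have "real j * infdist x (- U i) \<le> real k * infdist x (- U i)"
          by (intro mult_right_mono infdist_nonneg) simp
        then have "1 \<le> \<theta> k i x" using ji by (auto simp: \<theta>_def)
        also have "\<dots> \<le> (\<Sum>i\<in>I. \<theta> k i x)"
          using ji I belowD(2)[OF \<theta>] by (intro member_le_sum) auto
        finally show ?thesis .
      qed
      then show ?thesis by blast
    qed
    then obtain k where k: "\<And>x. x \<in> C \<Longrightarrow> 1 \<le> (\<Sum>i\<in>I. \<theta> k i x)" by blast
    \<comment> \<open>The part of \<psi> that is not dominated by \<open>e / 2\<close> plus the sum.
      It vanishes on the tight compact set.\<close>
    define \<eta> where "\<eta> x = max 0 (\<psi> x + (-1) * (e / 2 + (\<Sum>i\<in>I. \<theta> k i x)))" for x
    have s0: "0 \<le> (\<Sum>i\<in>I. \<theta> k i x)" for x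
      using belowD(2)[OF \<theta>] by (intro sum_nonneg) auto
    have bs: "(\<lambda>x. e / 2 + (\<Sum>i\<in>I. \<theta> k i x)) \<in> bounded_continuous"
      using belowD(1)[OF \<theta>] by (intro bounded_continuous_add bounded_continuous_sum bounded_continuous_const)
    have b\<eta>: "\<eta> \<in> bounded_continuous"
      unfolding \<eta>_def[abs_def]
      by (intro bounded_continuous_max_0 bounded_continuous_add bounded_continuous_mult_const[OF bs] bc)
    have "L \<eta> \<le> e / 2"
    proof (rule K2[rule_format, OF b\<eta>])
      show "0 \<le> \<eta> x \<and> \<eta> x \<le> 1" for x
        using belowD(2,3)[OF \<psi>, of x] s0[of x] e by (auto simp: \<eta>_def)
      show "\<eta> x = 0" if "x \<in> K" for x
      proof (cases "x \<in> C")
        case True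
        then show ?thesis using k[OF True] belowD(3)[OF \<psi>, of x] e by (simp add: \<eta>_def)
      next
        case False
        then show ?thesis using that s0[of x] by (simp add: \<eta>_def C_def)
      qed
    qed
    have "L \<psi> \<le> L (\<lambda>x. (e / 2 + (\<Sum>i\<in>I. \<theta> k i x)) + \<eta> x)"
      by (intro L_mono bc bounded_continuous_add[OF bs b\<eta>]) (auto simp: \<eta>_def)
    also have "\<dots> = e / 2 + (\<Sum>i\<in>I. L (\<theta> k i)) + L \<eta>"
      using belowD(1)[OF \<theta>] bs b\<eta>
      by (simp add: L_add L_sum L_const bounded_continuous_sum bounded_continuous_const)
    also have "\<dots> \<le> (\<Sum>i\<in>I. L (\<theta> k i)) + e" using \<open>L \<eta> \<le> e / 2\<close> by simp
    finally have "ennreal (L \<psi>) \<le> ennreal ((\<Sum>i\<in>I. L (\<theta> k i)) + e)" by (rule ennreal_leI)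
    also have "\<dots> = (\<Sum>i\<in>I. ennreal (L (\<theta> k i))) + ennreal e"
      using e L_nonneg[OF belowD(1)[OF \<theta>] belowD(2)[OF \<theta>]]
      by (simp add: sum_nonneg)
    also have "\<dots> \<le> (\<Sum>i\<in>I. \<tau> (U i)) + ennreal e"
      by (intro add_right_mono sum_mono below_L \<theta>)
    also have "\<dots> \<le> (\<Sum>i. \<tau> (U i)) + ennreal e"
      by (intro add_right_mono sum_le_suminf I summableI) auto
    finally show "ennreal (L \<psi>) \<le> (\<Sum>i. \<tau> (U i)) + ennreal e" .
  qed
qed

lemma \<mu>_countably_subadditive: "\<mu> (\<Union>i. A i) \<le> (\<Sum>i::nat. \<mu> (A i))"
proof (rule ennreal_le_epsilon)
  fix e :: real assume fin: "(\<Sum>i. \<mu> (A i)) < top" and e: "e > 0"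
  have "\<exists>U. open U \<and> A i \<subseteq> U \<and> \<tau> U \<le> \<mu> (A i) + ennreal (e * (1 / 2) ^ Suc i)" for i
  proof -
    have "\<mu> (A i) \<noteq> \<infinity>"
      using ennreal_suminf_lessD[OF fin, of i] by simp
    moreover have "0 < e * (1 / 2) ^ Suc i" using e by simp
    ultimately obtain U where "U \<in> {U. open U \<and> A i \<subseteq> U}" "\<tau> U < \<mu> (A i) + ennreal (e * (1 / 2) ^ Suc i)"
      using INF_approx_ennreal[OF _ \<mu>_def] by metis
    then show ?thesis by (auto intro: less_imp_le)
  qed
  then obtain U where U: "\<And>i. open (U i)" "\<And>i. A i \<subseteq> U i" "\<And>i. \<tau> (U i) \<le> \<mu> (A i) + ennreal (e * (1 / 2) ^ Suc i)"
    by metis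
  have "\<mu> (\<Union>i. A i) \<le> \<tau> (\<Union>i. U i)"
    unfolding \<mu>_def using U by (intro INF_lower) auto
  also have "\<dots> \<le> (\<Sum>i. \<tau> (U i))" by (rule \<tau>_countably_subadditive[OF U(1)])
  also have "\<dots> \<le> (\<Sum>i. \<mu> (A i) + ennreal (e * (1 / 2) ^ Suc i))"
    by (intro suminf_le U summableI)
  also have "\<dots> = (\<Sum>i. \<mu> (A i)) + (\<Sum>i. ennreal (e * (1 / 2) ^ Suc i))"
    by (intro suminf_add[symmetric] summableI)
  also have "(\<Sum>i. ennreal (e * (1 / 2) ^ Suc i)) = ennreal e"
    using sums_mult[OF power_half_series, of e] e by (intro suminf_ennreal_eq) auto
  finally show "\<mu> (\<Union>i. A i) \<le> (\<Sum>i. \<mu> (A i)) + ennreal e" .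
qed

lemma \<mu>_outer_measure: "outer_measure_space (Pow UNIV) \<mu>"
  unfolding outer_measure_space_def
  by (auto simp: positive_def increasing_def countably_subadditive_def \<mu>_empty \<mu>_mono \<mu>_countably_subadditive)

lemma \<mu>_subadditive: "\<mu> (A \<union> A') \<le> \<mu> A + \<mu> A'"
proof -
  have "\<mu> (A \<union> A') \<le> (\<Sum>i. \<mu> (binaryset A A' i))"
    using \<mu>_countably_subadditive[of "binaryset A A'"] by (simp add: UN_binaryset_eq)
  also have "\<dots> = \<mu> A + \<mu> A'"
    by (rule suminf_binaryset_eq[where f = \<mu>, OF \<mu>_empty])
  finally show ?thesis .
qed

text \<open>For \<psi> below \<open>V \<inter> U\<close>, the set \<open>D\<close> where \<psi> is
  less than \<open>e\<close> is an open neighbourhood of \<open>X - U\<close> in \<open>V\<close>.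
  The truncation \<open>max 0 (\<psi> - e)\<close> vanishes on \<open>D\<close>, so adding to it any
  function below \<open>D\<close> stays below \<open>V\<close>. This gives additivity up to
  \<open>e\<close>.\<close>

lemma open_in_lambda_system:
  assumes U: "open U" shows "U \<in> lambda_system UNIV (Pow UNIV) \<mu>"
proof -
  have ge: "\<mu> (U \<inter> X) + \<mu> (X - U) \<le> \<mu> X" for X
    unfolding \<mu>_def[of X]
  proof (rule INF_greatest)
    fix V assume "V \<in> {V. open V \<and> X \<subseteq> V}"
    then have V: "open V" "X \<subseteq> V" by auto
    have key: "ennreal (L \<psi>) + \<mu> (X - U) \<le> \<tau> V" if \<psi>: "\<psi> \<in> below (V \<inter> U)" for \<psi>
    proof (rule ennreal_le_epsilon)
      fix e :: real assume e: "e > 0"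
      define D where "D = V \<inter> {x. \<psi> x < e}"
      have "open D" unfolding D_def
        using bounded_continuous_D(1)[OF belowD(1)[OF \<psi>]]
        by (intro open_Int V open_Collect_less continuous_on_const)
      have "X - U \<subseteq> D" using V belowD(4)[OF \<psi>] e by (auto simp: D_def)
      then have "\<mu> (X - U) \<le> \<tau> D" unfolding \<mu>_def using \<open>open D\<close> by (intro INF_lower) auto
      have bm: "(\<lambda>x. max 0 (\<psi> x + (- e))) \<in> bounded_continuous"
        by (intro bounded_continuous_max_0 bounded_continuous_add belowD(1)[OF \<psi>] bounded_continuous_const)
      have "ennreal (L \<psi>) + ennreal (L \<theta>) \<le> \<tau> V + ennreal e" if \<theta>: "\<theta> \<in> below D" for \<theta>
      proof -
        have "(\<lambda>x. max 0 (\<psi> x + (- e)) + \<theta> x) \<in> below V"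
          unfolding below_def
        proof (intro CollectI conjI allI)
          show "(\<lambda>x. max 0 (\<psi> x + (- e)) + \<theta> x) \<in> bounded_continuous"
            by (intro bounded_continuous_add bm belowD(1)[OF \<theta>])
          fix x
          show "0 \<le> max 0 (\<psi> x + (- e)) + \<theta> x" using belowD(2)[OF \<theta>, of x] by simp
          show "max 0 (\<psi> x + (- e)) + \<theta> x \<le> indicator V x"
            using belowD(2-4)[OF \<theta>, of x] belowD(2-4)[OF \<psi>, of x] e
            by (cases "x \<in> V"; cases "\<psi> x < e") (auto simp: D_def)
        qed
        from below_L[OF this] have "ennreal (L (\<lambda>x. max 0 (\<psi> x + (- e))) + L \<theta>) \<le> \<tau> V"
          by (simp only: L_add[OF bm belowD(1)[OF \<theta>]])
        then have 1: "ennreal (L (\<lambda>x. max 0 (\<psi> x + (- e)))) + ennreal (L \<theta>) \<le> \<tau> V"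
          using L_nonneg[OF bm] L_nonneg[OF belowD(1,2)[OF \<theta>]] by simp
        have "L \<psi> \<le> L (\<lambda>x. max 0 (\<psi> x + (- e)) + e)"
          by (intro L_mono belowD(1)[OF \<psi>] bounded_continuous_add bm bounded_continuous_const) auto
        also have "\<dots> = L (\<lambda>x. max 0 (\<psi> x + (- e))) + e"
          by (simp only: L_add bm bounded_continuous_const L_const)
        finally have "ennreal (L \<psi>) \<le> ennreal (L (\<lambda>x. max 0 (\<psi> x + (- e)))) + ennreal e"
          using L_nonneg[OF bm] e by (simp add: ennreal_plus[symmetric] ennreal_leI del: ennreal_plus)
        then have "ennreal (L \<psi>) + ennreal (L \<theta>) \<le> (ennreal (L (\<lambda>x. max 0 (\<psi> x + (- e)))) + ennreal e) + ennreal (L \<theta>)"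
          by (rule add_right_mono)
        also have "\<dots> = (ennreal (L (\<lambda>x. max 0 (\<psi> x + (- e)))) + ennreal (L \<theta>)) + ennreal e"
          by (simp only: ac_simps)
        also have "\<dots> \<le> \<tau> V + ennreal e" using 1 by (rule add_right_mono)
        finally show ?thesis .
      qed
      then have "ennreal (L \<psi>) + \<tau> D \<le> \<tau> V + ennreal e"
        using zero_below[of D] unfolding \<tau>_def[of D]
        by (subst ennreal_SUP_add_right) (auto intro!: SUP_least)
      then show "ennreal (L \<psi>) + \<mu> (X - U) \<le> \<tau> V + ennreal e"
        using add_left_mono[OF \<open>\<mu> (X - U) \<le> \<tau> D\<close>] order_trans by blast
    qed
    have "\<mu> (U \<inter> X) + \<mu> (X - U) \<le> \<tau> (V \<inter> U) + \<mu> (X - U)"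
      unfolding \<mu>_def[of "U \<inter> X"] using V U by (intro add_right_mono INF_lower) auto
    also have "\<dots> \<le> \<tau> V"
      using zero_below[of "V \<inter> U"] key unfolding \<tau>_def[of "V \<inter> U"]
      by (subst ennreal_SUP_add_left[symmetric]) (auto intro!: SUP_least)
    finally show "\<mu> (U \<inter> X) + \<mu> (X - U) \<le> \<tau> V" .
  qed
  have le: "\<mu> X \<le> \<mu> (U \<inter> X) + \<mu> (X - U)" for X
  proof -
    have "U \<inter> X \<union> (X - U) = X" by blast
    then show ?thesis using \<mu>_subadditive[of "U \<inter> X" "X - U"] by simp
  qed
  have "\<mu> (U \<inter> X) + \<mu> ((UNIV - U) \<inter> X) = \<mu> X" for X
  proof -
    have "(UNIV - U) \<inter> X = X - U" by blast
    with ge[of X] le[of X] show ?thesis by (simp only: antisym)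
  qed
  then show ?thesis by (simp add: lambda_system_def)
qed

definition \<nu> :: "'x measure" where "\<nu> = measure_of UNIV (sets borel) \<mu>"

lemma sets_\<nu> [simp, measurable_cong]: "sets \<nu> = sets borel"
  using sets.sigma_sets_eq[of borel] by (simp add: \<nu>_def)

lemma space_\<nu> [simp]: "space \<nu> = UNIV"
  using sets_eq_imp_space_eq[OF sets_\<nu>] by simp

lemma emeasure_\<nu>: assumes "A \<in> sets borel" shows "emeasure \<nu> A = \<mu> A"
proof -
  have ms: "measure_space UNIV (lambda_system UNIV (Pow UNIV) \<mu>) \<mu>"
    using sigma_algebra.caratheodory_lemma[OF sigma_algebra_Pow \<mu>_outer_measure] .
  have "sigma_sets UNIV {S::'x set. open S} \<subseteq> lambda_system UNIV (Pow UNIV) \<mu>"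
    using ms open_in_lambda_system unfolding measure_space_def
    by (intro sigma_algebra.sigma_sets_subset) auto
  then have sub: "sets (borel::'x measure) \<subseteq> lambda_system UNIV (Pow UNIV) \<mu>"
    by (simp add: sets_borel)
  have "countably_additive (lambda_system UNIV (Pow UNIV) \<mu>) \<mu>"
    using ms by (simp add: measure_space_def)
  then have "countably_additive (sets borel) \<mu>"
    using sub unfolding countably_additive_def by (meson subset_trans subsetD)
  moreover have "positive (sets borel) \<mu>" by (simp add: positive_def \<mu>_empty)
  ultimately show ?thesis
    unfolding \<nu>_def using emeasure_measure_of_sigma[OF _ _ _ assms, of UNIV \<mu>] sets.sigma_algebra_axioms[of borel]
    by simp
qed

lemma prob_space_\<nu>: "prob_space \<nu>"
proof
  have "\<tau> UNIV = 1"
  proof (rule antisym)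
    show "\<tau> UNIV \<le> 1" unfolding \<tau>_def
    proof (rule SUP_least)
      fix \<psi> assume \<psi>: "\<psi> \<in> below UNIV"
      have "L \<psi> \<le> L (\<lambda>_. 1)"
        by (rule L_mono[OF belowD(1)[OF \<psi>] bounded_continuous_const belowD(3)[OF \<psi>]])
      then show "ennreal (L \<psi>) \<le> 1" by (simp add: L_one ennreal_le_1)
    qed
    have "(\<lambda>_. 1) \<in> below UNIV" by (simp add: below_def bounded_continuous_const)
    from below_L[OF this] show "1 \<le> \<tau> UNIV" by (simp add: L_one)
  qed
  then show "emeasure \<nu> (space \<nu>) = 1"
    by (simp add: emeasure_\<nu> \<mu>_open)
qed

lemma integrable_\<nu>: assumes "\<psi> \<in> bounded_continuous" shows "integrable \<nu> \<psi>"
proof -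
  interpret prob_space \<nu> by (rule prob_space_\<nu>)
  obtain B where B: "\<And>x. \<bar>\<psi> x\<bar> \<le> B" using bounded_continuous_D(2)[OF assms] by blast
  have "\<psi> \<in> borel_measurable borel"
    using bounded_continuous_D(1)[OF assms] by (rule borel_measurable_continuous_onI)
  then show ?thesis
    by (intro integrable_const_bound[of _ B]) (use B in auto)
qed

text \<open>A layer-cake decomposition: \<psi> is the sum of slices \<open>d k\<close> of height
  \<open>1 / n\<close>, and \<open>n * d k\<close> lies below the open set \<open>V k\<close> where
  \<psi> exceeds \<open>k / n\<close>. So \<open>L (d k)\<close> is at most the measure of
  \<open>V k\<close> over \<open>n\<close>, and these terms add up to at most the integral of
  \<open>\<psi> + 1 / n\<close>.\<close>

lemma L_le_integral_unit:
  assumes bc: "\<psi> \<in> bounded_continuous" and 01: "\<And>x. 0 \<le> \<psi> x" "\<And>x. \<psi> x \<le> 1"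
  shows "L \<psi> \<le> integral\<^sup>L \<nu> \<psi>"
proof (rule field_le_epsilon)
  interpret prob_space \<nu> by (rule prob_space_\<nu>)
  fix e :: real assume e: "e > 0"
  obtain n :: nat where n: "n > 0" "inverse (real n) < e"
    using ex_inverse_of_nat_less[OF e] by blast
  define c where "c k x = max 0 (\<psi> x + (- (real k / real n)))" for k x
  have bcc: "c k \<in> bounded_continuous" for k
    unfolding c_def[abs_def] by (intro bounded_continuous_max_0 bounded_continuous_add bc bounded_continuous_const)
  define d where "d k x = c k x + (-1) * c (Suc k) x" for k x
  have bd: "d k \<in> bounded_continuous" for k
    unfolding d_def[abs_def] by (intro bounded_continuous_add bounded_continuous_mult_const bcc)
  have tele: "(\<Sum>k<n. d k x) = \<psi> x" for x
  proof -
    have "(\<Sum>k<n. d k x) = c 0 x - c n x"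
      using sum_lessThan_telescope'[of "\<lambda>k. c k x" n] by (simp add: d_def)
    then show ?thesis using 01[of x] n by (simp add: c_def)
  qed
  define V where "V k = {x. real k / real n < \<psi> x}" for k
  have oV: "open (V k)" for k unfolding V_def
    using bounded_continuous_D(1)[OF bc] by (intro open_Collect_less continuous_on_const)
  have Ld: "L (d k) \<le> measure \<nu> (V k) / real n" for k
  proof -
    have "(\<lambda>x. real n * d k x) \<in> below (V k)"
      unfolding below_def
    proof (intro CollectI conjI allI)
      show "(\<lambda>x. real n * d k x) \<in> bounded_continuous" by (rule bounded_continuous_mult_const[OF bd])
      fix x
      have kn: "real (Suc k) / real n = real k / real n + 1 / real n" by (simp add: add_divide_distrib)
      have pn: "1 / real n > 0" using n by simp
      have hat: "0 \<le> max 0 (y + - a) + - 1 * max 0 (y + - (a + b))"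
        "max 0 (y + - a) + - 1 * max 0 (y + - (a + b)) \<le> b"
        "y \<le> a \<Longrightarrow> max 0 (y + - a) + - 1 * max 0 (y + - (a + b)) = 0" if "b > 0" for a b y :: real
        using that by auto
      show "0 \<le> real n * d k x" unfolding d_def c_def kn by (intro mult_nonneg_nonneg hat pn) auto
      have "d k x \<le> 1 / real n" unfolding d_def c_def kn by (rule hat(2)[OF pn])
      then have "real n * d k x \<le> 1" using n by (simp add: field_simps)
      moreover have "d k x = 0" if "x \<notin> V k" using that unfolding d_def c_def kn V_def by (intro hat(3)[OF pn]) simp
      ultimately show "real n * d k x \<le> indicator (V k) x" by (auto simp: indicator_def)
    qed
    from below_L[OF this] have "ennreal (real n * L (d k)) \<le> emeasure \<nu> (V k)"
      using oV by (simp add: L_mult bd emeasure_\<nu> \<mu>_open)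
    then have "real n * L (d k) \<le> measure \<nu> (V k)"
      by (simp add: emeasure_eq_measure)
    then show ?thesis using n by (simp add: field_simps)
  qed
  have ind: "(\<Sum>k<n. indicator (V k) x / real n) \<le> \<psi> x + inverse (real n)" for x
  proof -
    have "{k. k < n \<and> x \<in> V k} \<subseteq> {..<nat \<lceil>real n * \<psi> x\<rceil>}"
    proof
      fix k assume "k \<in> {k. k < n \<and> x \<in> V k}"
      then have "real k < real n * \<psi> x" using n by (simp add: V_def field_simps)
      then have "int k < \<lceil>real n * \<psi> x\<rceil>" by (simp add: less_ceiling_iff)
      then show "k \<in> {..<nat \<lceil>real n * \<psi> x\<rceil>}" by simp
    qed
    then have "card {k. k < n \<and> x \<in> V k} \<le> nat \<lceil>real n * \<psi> x\<rceil>"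
      using card_mono[OF finite_lessThan] by fastforce
    then have "real (card {k. k < n \<and> x \<in> V k}) \<le> real (nat \<lceil>real n * \<psi> x\<rceil>)" by simp
    also have "\<dots> \<le> real n * \<psi> x + 1"
      using 01(1)[of x] n by (simp add: ceiling_less_iff)
    finally have "real (card {k. k < n \<and> x \<in> V k}) / real n \<le> (real n * \<psi> x + 1) / real n"
      by (rule divide_right_mono) simp
    moreover have "(\<Sum>k<n. indicator (V k) x / real n) = real (card {k. k < n \<and> x \<in> V k}) / real n"
      by (simp add: sum_divide_distrib[symmetric] indicator_def sum.If_cases Int_def)
    ultimately show ?thesis using n by (simp add: field_simps)
  qed
  have "L \<psi> = L (\<lambda>x. \<Sum>k<n. d k x)" by (simp add: tele)
  also have "\<dots> = (\<Sum>k<n. L (d k))" by (rule L_sum[OF bd])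
  also have "\<dots> \<le> (\<Sum>k<n. measure \<nu> (V k) / real n)" by (intro sum_mono Ld)
  also have "\<dots> = (LINT x|\<nu>. (\<Sum>k<n. indicator (V k) x / real n))"
    using oV by (subst Bochner_Integration.integral_sum) (auto intro!: integrable_divide_zero simp: emeasure_eq_measure)
  also have "\<dots> \<le> (LINT x|\<nu>. \<psi> x + inverse (real n))"
  proof (rule integral_mono[OF _ _ ind])
    show "integrable \<nu> (\<lambda>x. \<Sum>k<n. indicator (V k) x / real n)"
      using oV by (intro Bochner_Integration.integrable_sum integrable_divide_zero) (simp add: emeasure_eq_measure)
    show "integrable \<nu> (\<lambda>x. \<psi> x + inverse (real n))" using integrable_\<nu>[OF bc] by simp
  qed
  also have "\<dots> = integral\<^sup>L \<nu> \<psi> + inverse (real n)"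
    using integrable_\<nu>[OF bc] prob_space by simp
  finally show "L \<psi> \<le> integral\<^sup>L \<nu> \<psi> + e" using n by simp
qed

text \<open>An affine change extends the inequality from functions with values in [0,1] to all
  bounded continuous functions; applied to the negative of \<psi> as well, it becomes an
  equality.\<close>

lemma L_eq_integral:
  assumes bc: "\<psi> \<in> bounded_continuous"
  shows "L \<psi> = integral\<^sup>L \<nu> \<psi>"
proof -
  interpret prob_space \<nu> by (rule prob_space_\<nu>)
  have le: "L \<psi> \<le> integral\<^sup>L \<nu> \<psi>" if bc: "\<psi> \<in> bounded_continuous" for \<psi>
  proof -
    obtain B where B: "B > 0" "\<And>x. \<bar>\<psi> x\<bar> \<le> B" using bounded_continuous_D(2)[OF bc] by blast
    define \<zeta> where "\<zeta> x = 1 / 2 + (1 / (2 * B)) * \<psi> x" for x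
    have b1: "(\<lambda>x. (1 / (2 * B)) * \<psi> x) \<in> bounded_continuous" by (rule bounded_continuous_mult_const[OF bc])
    have b\<zeta>: "\<zeta> \<in> bounded_continuous"
      unfolding \<zeta>_def[abs_def] by (intro bounded_continuous_add b1 bounded_continuous_const)
    have 1: "- (1 / 2) \<le> (1 / (2 * B)) * \<psi> x \<and> (1 / (2 * B)) * \<psi> x \<le> 1 / 2" for x
      using B(1) B(2)[of x] by (simp add: field_simps abs_le_iff)
    have "L \<zeta> \<le> integral\<^sup>L \<nu> \<zeta>"
    proof (rule L_le_integral_unit[OF b\<zeta>])
      show "0 \<le> \<zeta> x" "\<zeta> x \<le> 1" for x unfolding \<zeta>_def using 1[of x] by linarith+
    qed
    moreover have "L \<zeta> = 1 / 2 + (1 / (2 * B)) * L \<psi>"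
      unfolding \<zeta>_def[abs_def] by (simp only: L_add b1 bounded_continuous_const L_const L_mult bc)
    moreover have "integral\<^sup>L \<nu> \<zeta> = 1 / 2 + (1 / (2 * B)) * integral\<^sup>L \<nu> \<psi>"
      unfolding \<zeta>_def[abs_def] using integrable_\<nu>[OF bc] prob_space by simp
    ultimately show ?thesis using B(1) by (simp add: field_simps)
  qed
  have "L (\<lambda>x. -1 * \<psi> x) \<le> (LINT x|\<nu>. -1 * \<psi> x)"
    by (rule le[OF bounded_continuous_mult_const[OF bc]])
  then have "integral\<^sup>L \<nu> \<psi> \<le> L \<psi>" by (simp only: L_mult[OF bc]) simp
  with le[OF bc] show ?thesis by simp
qed

end


lemma compact_bump:
  fixes K :: "'x::metric_space set"
  assumes lc: "locally compact (UNIV :: 'x set)" and K: "compact K"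
  obtains \<psi> where "\<psi> \<in> compactly_supported" "\<And>x. 0 \<le> \<psi> x \<and> \<psi> x \<le> (1::real)" "\<And>x. x \<in> K \<Longrightarrow> \<psi> x = 1"
proof -
  have "\<exists>U V. open U \<and> compact V \<and> x \<in> U \<and> U \<subseteq> V" for x :: 'x
    using lc unfolding locally_def by (metis UNIV_I open_openin open_UNIV subtopology_UNIV)
  then obtain U V where UV: "\<And>x::'x. open (U x)" "\<And>x. compact (V x)" "\<And>x. x \<in> U x" "\<And>x. U x \<subseteq> V x"
    by metis
  obtain I where I: "finite I" "K \<subseteq> (\<Union>x\<in>I. U x)"
    using compactE_image[OF K, of UNIV U] UV(1,3) by (metis UNIV_I UN_iff subsetI)
  define G where "G = (\<Union>x\<in>I. U x)"
  have G: "open G" "K \<subseteq> G" using UV I by (auto simp: G_def)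
  have cl: "compact (closure G)"
  proof -
    have "compact (\<Union>x\<in>I. V x)" using I UV by (intro compact_UN) auto
    moreover have "closure G \<subseteq> (\<Union>x\<in>I. V x)"
      using UV(4) calculation by (intro closure_minimal compact_imp_closed) (auto simp: G_def)
    ultimately show ?thesis using compact_Int_closed[of "\<Union>x\<in>I. V x" "closure G"] by (simp add: Int_absorb1)
  qed
  \<comment> \<open>The distance quotient needs both \<open>K\<close> and the complement of
    \<open>G\<close> nonempty, since \<open>infdist\<close> to the empty set is 0.\<close>
  consider "K = {}" | "G = UNIV" | "K \<noteq> {}" "G \<noteq> UNIV" by blast
  then show ?thesis
  proof cases
    case 1
    show ?thesis by (rule that[of "\<lambda>_. 0"]) (use 1 in \<open>auto simp: compactly_supported_def\<close>)
  next
    case 2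
    show ?thesis by (rule that[of "\<lambda>_. 1"]) (use 2 cl in \<open>auto simp: compactly_supported_def\<close>)
  next
    case 3
    define d where "d x = infdist x (- G) + infdist x K" for x
    have pos: "d x > 0" for x
    proof (rule ccontr)
      assume "\<not> d x > 0"
      then have "infdist x (- G) = 0" "infdist x K = 0"
        using infdist_nonneg[of x "- G"] infdist_nonneg[of x K] by (auto simp: d_def)
      then have "x \<in> - G" "x \<in> K"
        using in_closed_iff_infdist_zero[of "- G" x] in_closed_iff_infdist_zero[of K x] G(1) 3 compact_imp_closed[OF K] by auto
      then show False using G by auto
    qed
    have ne: "d x \<noteq> 0" for x using pos[of x] by simp
    show ?thesis
    proof (rule that[of "\<lambda>x. infdist x (- G) / d x"])
      have "continuous_on UNIV (\<lambda>x. infdist x (- G) / d x)"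
        unfolding d_def using ne by (intro continuous_intros) (auto simp: d_def)
      moreover have "{x. infdist x (- G) / d x \<noteq> 0} \<subseteq> G" by (auto intro: ccontr)
      then have "closure {x. infdist x (- G) / d x \<noteq> 0} \<subseteq> closure G" by (rule closure_mono)
      then have "compact (closure {x. infdist x (- G) / d x \<noteq> 0})"
        using compact_Int_closed[OF cl closed_closure] by (metis Int_absorb1)
      ultimately show "(\<lambda>x. infdist x (- G) / d x) \<in> compactly_supported"
        by (simp add: compactly_supported_def)
      show "0 \<le> infdist x (- G) / d x \<and> infdist x (- G) / d x \<le> 1" for x
        using pos[of x] infdist_nonneg[of x "- G"] infdist_nonneg[of x K] by (simp add: d_def)
      show "infdist x (- G) / d x = 1" if "x \<in> K" for x
        using ne[of x] that by (simp add: d_def)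
    qed
  qed
qed

text \<open>On bounded continuous functions the limit inherits tightness and is represented by a
  measure. On compactly supported functions, bumps that are 1 on a compact set bound the mass from
  both sides: by 1 through inner regularity, and by \<open>1 - e\<close> from below when the compact
  set carries almost all mass of the averages.\<close>

lemma tight_weak_star_limits:
  fixes \<mu> :: "real \<Rightarrow> 'x::metric_space measure"
  assumes prob: "\<And>T. T > 0 \<Longrightarrow> prob_space (\<mu> T)" and sets: "\<And>T. sets (\<mu> T) = sets borel"
    and tight: "\<And>\<epsilon>. \<epsilon> > 0 \<Longrightarrow> \<exists>K. compact K \<and> (\<forall>\<^sub>F T in at_top. measure (\<mu> T) (- K) \<le> \<epsilon>)"
  shows "weak_star_limits_are_probabilities \<mu>"
proof -
  have space: "space (\<mu> T) = UNIV" for T using sets_eq_imp_space_eq[OF sets] by simp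
  have meas: "\<psi> \<in> borel_measurable (\<mu> T)" if "continuous_on UNIV \<psi>" for \<psi> :: "'x \<Rightarrow> real" and T
    using borel_measurable_continuous_onI[OF that] measurable_cong_sets[OF sets refl] by blast
  have int: "integrable (\<mu> T) \<psi>" if "T > 0" "continuous_on UNIV \<psi>" "\<And>x. \<bar>\<psi> x\<bar> \<le> B" for \<psi> :: "'x \<Rightarrow> real" and T B
  proof -
    interpret prob_space "\<mu> T" by (rule prob[OF that(1)])
    show ?thesis by (intro integrable_const_bound[of _ B] meas that(2)) (use that(3) in auto)
  qed
  have intb: "integrable (\<mu> T) \<psi>" if "T > 0" "\<psi> \<in> bounded_continuous" for \<psi> T
    using bounded_continuous_D[OF that(2)] int[OF that(1)] by blast
  have ev0: "\<forall>\<^sub>F T in F. T > 0" if "F \<le> at_top" for F :: "real filter"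
    using filter_leD[OF that eventually_gt_at_top] .
  have out: "(LINT x|\<mu> T. \<psi> x) \<le> measure (\<mu> T) (- K)"
    if "T > 0" "continuous_on UNIV \<psi>" "\<And>x. 0 \<le> \<psi> x \<and> \<psi> x \<le> 1" "\<And>x. x \<in> K \<Longrightarrow> \<psi> x = 0" "compact K"
    for \<psi> :: "'x \<Rightarrow> real" and T K
  proof -
    interpret prob_space "\<mu> T" by (rule prob[OF that(1)])
    have K: "- K \<in> sets (\<mu> T)" using compact_imp_closed[OF that(5)] by (simp add: sets)
    have "(LINT x|\<mu> T. \<psi> x) \<le> (LINT x|\<mu> T. indicator (- K) x)"
    proof (rule integral_mono)
      show "integrable (\<mu> T) \<psi>" using that(3) by (intro int[OF that(1,2), of 1]) auto
      show "integrable (\<mu> T) (indicator (- K) :: 'x \<Rightarrow> real)" using K by (simp add: emeasure_eq_measure)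
      show "\<psi> x \<le> indicator (- K) x" for x using that(3)[of x] that(4)[of x] by (cases "x \<in> K") auto
    qed
    also have "\<dots> = measure (\<mu> T) (- K)" using K by simp
    finally show ?thesis .
  qed
  have A: "\<exists>\<nu>. sets \<nu> = sets borel \<and> prob_space \<nu> \<and> (\<forall>\<psi>\<in>bounded_continuous. L \<psi> = integral\<^sup>L \<nu> \<psi>)"
    if L: "weak_star_limit bounded_continuous \<mu> L" for L
  proof -
    obtain F where F: "F \<noteq> bot" "F \<le> at_top"
      and lim: "\<And>\<psi>. \<psi> \<in> bounded_continuous \<Longrightarrow> ((\<lambda>T. integral\<^sup>L (\<mu> T) \<psi>) \<longlongrightarrow> L \<psi>) F"
      using L by (auto simp: weak_star_limit_def)
    note ev = ev0[OF F(2)]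
    have "tight_functional L"
    proof
      fix \<psi> \<zeta> :: "'x \<Rightarrow> real" assume b: "\<psi> \<in> bounded_continuous" "\<zeta> \<in> bounded_continuous"
      have "((\<lambda>T. integral\<^sup>L (\<mu> T) (\<lambda>x. \<psi> x + \<zeta> x)) \<longlongrightarrow> L \<psi> + L \<zeta>) F"
        by (rule Lim_transform_eventually[OF tendsto_add[OF lim[OF b(1)] lim[OF b(2)]]])
          (use ev in \<open>eventually_elim, simp add: intb b\<close>)
      with lim[OF bounded_continuous_add[OF b]] show "L (\<lambda>x. \<psi> x + \<zeta> x) = L \<psi> + L \<zeta>"
        using F(1) tendsto_unique by blast
      show "L \<psi> \<le> L \<zeta>" if "\<And>x. \<psi> x \<le> \<zeta> x"
        by (rule tendsto_le[OF F(1) lim[OF b(2)] lim[OF b(1)]])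
          (use ev in \<open>eventually_elim, intro integral_mono intb b that\<close>)
    next
      fix \<psi> :: "'x \<Rightarrow> real" and c assume b: "\<psi> \<in> bounded_continuous"
      have "((\<lambda>T. integral\<^sup>L (\<mu> T) (\<lambda>x. c * \<psi> x)) \<longlongrightarrow> c * L \<psi>) F"
        using tendsto_mult_left[OF lim[OF b], of c] by simp
      with lim[OF bounded_continuous_mult_const[OF b]] show "L (\<lambda>x. c * \<psi> x) = c * L \<psi>"
        using F(1) tendsto_unique by blast
    next
      have "((\<lambda>T. integral\<^sup>L (\<mu> T) (\<lambda>x. 1)) \<longlongrightarrow> (1::real)) F"
        by (rule Lim_transform_eventually[OF tendsto_const])
          (use ev in \<open>eventually_elim, use prob_space.prob_space[OF prob] in simp\<close>)
      with lim[OF bounded_continuous_const[of 1]] show "L (\<lambda>_. 1) = 1"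
        using F(1) tendsto_unique by blast
    next
      fix \<epsilon> :: real assume "\<epsilon> > 0"
      then obtain K where K: "compact K" "\<forall>\<^sub>F T in at_top. measure (\<mu> T) (- K) \<le> \<epsilon>" using tight by blast
      have "L \<psi> \<le> \<epsilon>" if b: "\<psi> \<in> bounded_continuous" "\<forall>x. 0 \<le> \<psi> x \<and> \<psi> x \<le> 1" "\<forall>x\<in>K. \<psi> x = 0" for \<psi>
      proof (rule tendsto_upperbound[OF lim[OF b(1)] _ F(1)])
        show "\<forall>\<^sub>F T in F. integral\<^sup>L (\<mu> T) \<psi> \<le> \<epsilon>"
          using ev filter_leD[OF F(2) K(2)]
        proof eventually_elim
          case (elim T)
          then show ?case using out[OF elim(1) bounded_continuous_D(1)[OF b(1)], of K] b K(1) by force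
        qed
      qed
      with K(1) show "\<exists>K. compact K \<and> (\<forall>\<psi>\<in>bounded_continuous.
       (\<forall>x. 0 \<le> \<psi> x \<and> \<psi> x \<le> 1) \<longrightarrow> (\<forall>x\<in>K. \<psi> x = 0) \<longrightarrow> L \<psi> \<le> \<epsilon>)" by blast
    qed
    then interpret tight_functional L .
    show ?thesis using prob_space_\<nu> L_eq_integral sets_\<nu> by blast
  qed
  have Bp: "prob_space \<nu>" if lc: "locally compact (UNIV :: 'x set)" and r: "radon_measure \<nu>"
    and L: "weak_star_limit compactly_supported \<mu> (integral\<^sup>L \<nu>)" for \<nu>
  proof
    obtain F where F: "F \<noteq> bot" "F \<le> at_top"
      and lim: "\<And>\<psi>. \<psi> \<in> compactly_supported \<Longrightarrow> ((\<lambda>T. integral\<^sup>L (\<mu> T) \<psi>) \<longlongrightarrow> integral\<^sup>L \<nu> \<psi>) F"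
      using L by (auto simp: weak_star_limit_def)
    note ev = ev0[OF F(2)]
    have s\<nu>: "sets \<nu> = sets borel" and fin: "\<And>K. compact K \<Longrightarrow> emeasure \<nu> K < \<infinity>"
      and inner: "emeasure \<nu> UNIV = (SUP K\<in>{K. compact K}. emeasure \<nu> K)"
      using r by (auto simp: radon_measure_def)
    have sp: "space \<nu> = UNIV" using sets_eq_imp_space_eq[OF s\<nu>] by simp
    have bump: "integrable \<nu> \<psi> \<and> integral\<^sup>L \<nu> \<psi> \<le> 1"
      if \<psi>: "\<psi> \<in> compactly_supported" "\<And>x. 0 \<le> \<psi> x \<and> \<psi> x \<le> 1" for \<psi>
    proof
      let ?S = "closure {x. \<psi> x \<noteq> 0}"
      have c: "continuous_on UNIV \<psi>" "compact ?S" using \<psi>(1) by (auto simp: compactly_supported_def)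
      have "integrable \<nu> (indicator ?S :: 'x \<Rightarrow> real)"
        using fin[OF c(2)] by (simp add: s\<nu>)
      then show "integrable \<nu> \<psi>"
      proof (rule Bochner_Integration.integrable_bound)
        show "\<psi> \<in> borel_measurable \<nu>"
          using borel_measurable_continuous_onI[OF c(1)] measurable_cong_sets[OF s\<nu> refl] by blast
        have "norm (\<psi> x) \<le> norm (indicator ?S x :: real)" for x
          using \<psi>(2)[of x] closure_subset[of "{x. \<psi> x \<noteq> 0}"] by (cases "\<psi> x = 0") auto
        then show "AE x in \<nu>. norm (\<psi> x) \<le> norm (indicator ?S x :: real)" by simp
      qed
      show "integral\<^sup>L \<nu> \<psi> \<le> 1"
      proof (rule tendsto_upperbound[OF lim[OF \<psi>(1)] _ F(1)])
        show "\<forall>\<^sub>F T in F. integral\<^sup>L (\<mu> T) \<psi> \<le> 1"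
          using ev
        proof eventually_elim
          case (elim T)
          have "integral\<^sup>L (\<mu> T) \<psi> \<le> measure (\<mu> T) (- {})"
            using \<psi>(2) by (intro out[OF elim c(1)]) auto
          then show ?case using prob_space.prob_space[OF prob[OF elim]] by (simp add: space)
        qed
      qed
    qed
    have le: "emeasure \<nu> UNIV \<le> 1"
      unfolding inner
    proof (rule SUP_least)
      fix K :: "'x set" assume "K \<in> {K. compact K}"
      then have K: "compact K" by simp
      obtain \<psi> where \<psi>: "\<psi> \<in> compactly_supported" "\<And>x. 0 \<le> \<psi> x \<and> \<psi> x \<le> (1::real)" "\<And>x. x \<in> K \<Longrightarrow> \<psi> x = 1"
        using compact_bump[OF lc K] by blast
      have "emeasure \<nu> K = (\<integral>\<^sup>+ x. indicator K x \<partial>\<nu>)"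
        using compact_imp_closed[OF K] by (simp add: s\<nu>)
      also have "\<dots> \<le> (\<integral>\<^sup>+ x. ennreal (\<psi> x) \<partial>\<nu>)"
        using \<psi>(3) by (intro nn_integral_mono) (auto simp: indicator_def)
      also have "\<dots> = ennreal (integral\<^sup>L \<nu> \<psi>)"
        using bump[OF \<psi>(1,2)] \<psi>(2) by (intro nn_integral_eq_integral) auto
      also have "\<dots> \<le> 1" using bump[OF \<psi>(1,2)] by (simp add: ennreal_le_1)
      finally show "emeasure \<nu> K \<le> 1" .
    qed
    have "1 \<le> emeasure \<nu> UNIV"
    proof (rule ennreal_le_epsilon)
      fix e :: real assume e: "e > 0"
      then obtain K where K: "compact K" "\<forall>\<^sub>F T in at_top. measure (\<mu> T) (- K) \<le> e" using tight by blast
      obtain \<psi> where \<psi>: "\<psi> \<in> compactly_supported" "\<And>x. 0 \<le> \<psi> x \<and> \<psi> x \<le> (1::real)" "\<And>x. x \<in> K \<Longrightarrow> \<psi> x = 1"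
        using compact_bump[OF lc K(1)] by blast
      have c: "continuous_on UNIV \<psi>" using \<psi>(1) by (auto simp: compactly_supported_def)
      have "1 - e \<le> integral\<^sup>L \<nu> \<psi>"
      proof (rule tendsto_lowerbound[OF lim[OF \<psi>(1)] _ F(1)])
        show "\<forall>\<^sub>F T in F. 1 - e \<le> integral\<^sup>L (\<mu> T) \<psi>"
          using ev filter_leD[OF F(2) K(2)]
        proof eventually_elim
          case (elim T)
          interpret prob_space "\<mu> T" by (rule prob[OF elim(1)])
          have "(LINT x|\<mu> T. 1 - \<psi> x) \<le> measure (\<mu> T) (- K)"
            by (rule out[OF elim(1)]) (use \<psi> c K(1) in \<open>auto intro!: continuous_intros\<close>)
          moreover have "integrable (\<mu> T) \<psi>" using \<psi>(2) by (intro int[OF elim(1) c, of 1]) auto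
          then have "(LINT x|\<mu> T. 1 - \<psi> x) = 1 - integral\<^sup>L (\<mu> T) \<psi>"
            using prob_space by simp
          ultimately show ?case using elim(2) by simp
        qed
      qed
      then have "1 \<le> ennreal (integral\<^sup>L \<nu> \<psi> + e)" by (simp add: ennreal_ge_1)
      also have "\<dots> = ennreal (integral\<^sup>L \<nu> \<psi>) + ennreal e"
        using e \<psi>(2) by (intro ennreal_plus integral_nonneg) auto
      also have "ennreal (integral\<^sup>L \<nu> \<psi>) = (\<integral>\<^sup>+ x. ennreal (\<psi> x) \<partial>\<nu>)"
        using bump[OF \<psi>(1,2)] \<psi>(2) by (intro nn_integral_eq_integral[symmetric]) auto
      also have "\<dots> \<le> (\<integral>\<^sup>+ x. 1 \<partial>\<nu>)"
        using \<psi>(2) by (intro nn_integral_mono) (simp add: ennreal_le_1)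
      also have "\<dots> = emeasure \<nu> UNIV" by (simp add: sp)
      finally show "1 \<le> emeasure \<nu> UNIV + ennreal e" by (simp add: add_right_mono)
    qed
    with le show "emeasure \<nu> (space \<nu>) = 1" by (simp add: sp)
  qed
  show ?thesis
    using A Bp by (auto simp: weak_star_limits_are_probabilities_def)
qed

section \<open>Contracting curves\<close>

text \<open>What remains of the group: \<open>G\<close> is the flow, \<open>U\<close> the action of
  the exponential on the commutative subspace \<open>V\<close>, which the flow dilates by
  \<open>exp (\<rho> * t)\<close>, and \<open>w\<close> is the derivative of \<phi>. The Hoelder
  condition survives as \<open>\<phi>_taylor\<close>.\<close>

locale contracting_curve =
  fixes G :: "real \<Rightarrow> 'x::metric_space \<Rightarrow> 'x" and U :: "'e::euclidean_space \<Rightarrow> 'x \<Rightarrow> 'x"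
    and V :: "'e set" and \<rho> \<beta> \<gamma> C D a :: real and f :: "'x \<Rightarrow> ennreal"
    and \<phi> w :: "real \<Rightarrow> 'e" and x :: 'x
  assumes V: "subspace V"
    and U_zero: "U 0 y = y"
    and U_add: "\<lbrakk>v \<in> V; v' \<in> V\<rbrakk> \<Longrightarrow> U (v + v') y = U v (U v' y)"
    and G_add: "G (s + t) y = G s (G t y)"
    and G_U: "v \<in> V \<Longrightarrow> G t (U v y) = U (exp (\<rho> * t) *\<^sub>R v) (G t y)"
    and \<rho>: "\<rho> > 0" and \<beta>: "\<beta> > 0" and \<gamma>: "\<gamma> > 0" and C: "C \<ge> 0" and a: "a \<ge> 1"
    and cont_G: "continuous_on UNIV (\<lambda>t. G t y)"
    and f_finite: "f y \<noteq> \<infinity> \<Longrightarrow> f (U v y) \<noteq> \<infinity>" "f y \<noteq> \<infinity> \<Longrightarrow> f (G t y) \<noteq> \<infinity>" "f x \<noteq> \<infinity>"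
    and f_proper: "M \<ge> 1 \<Longrightarrow> compact (closure {y. f y \<le> ennreal M})"
    and U_bound: "\<exists>K\<ge>1. \<forall>v\<in>V. norm v \<le> R \<longrightarrow>
      (\<forall>y. ennreal (inverse K) * f y \<le> f (U v y) \<and> f (U v y) \<le> ennreal K * f y)"
    and G_bound: "\<exists>K\<ge>1. \<forall>\<tau>\<in>{0..t}. \<forall>y. f (G \<tau> y) \<le> ennreal K * f y"
    and contraction: "t > 0 \<Longrightarrow> \<exists>b>0. \<forall>y. \<forall>s\<in>{-1..1}.
        ennreal (1 / 2) * (\<integral>\<^sup>+ r\<in>{-1..1}. f (G t (U (r *\<^sub>R w s) y)) \<partial>lborel)
        \<le> ennreal (a * exp (- \<beta> * (\<rho> * t))) * f y + ennreal b"
    and \<phi>_V: "s \<in> {-1..1} \<Longrightarrow> \<phi> s \<in> V" and w_V: "s \<in> {-1..1} \<Longrightarrow> w s \<in> V"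
    and w_bound: "s \<in> {-1..1} \<Longrightarrow> norm (w s) \<le> D"
    and \<phi>_lipschitz: "\<lbrakk>s \<in> {-1..1}; s' \<in> {-1..1}\<rbrakk> \<Longrightarrow> norm (\<phi> s' - \<phi> s) \<le> D * \<bar>s' - s\<bar>"
    and \<phi>_taylor: "\<lbrakk>s \<in> {-1..1}; s' \<in> {-1..1}\<rbrakk> \<Longrightarrow>
      norm (\<phi> s' - \<phi> s - (s' - s) *\<^sub>R w s) \<le> C * \<bar>s' - s\<bar> powr (1 + \<gamma>)"
begin

definition Y :: "real \<Rightarrow> real \<Rightarrow> 'x" where "Y s t = G t (U (\<phi> s) x)"

lemma f_Y: "f (Y s t) \<noteq> \<infinity>"
  using f_finite by (simp add: Y_def)

text \<open>The distortion of the height under vectors of norm up to \<open>D + 1\<close>: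
  \<open>D\<close> for replacing a cell by its midpoint, 1 for the Taylor remainder. It is fixed
  independently of \<open>p\<close>.\<close>

definition K :: real where
  "K = (SOME K. K \<ge> 1 \<and> (\<forall>v\<in>V. norm v \<le> D + 1 \<longrightarrow>
      (\<forall>y. ennreal (inverse K) * f y \<le> f (U v y) \<and> f (U v y) \<le> ennreal K * f y)))"

lemma K: "K \<ge> 1"
  and U_K: "\<lbrakk>v \<in> V; norm v \<le> D + 1\<rbrakk> \<Longrightarrow> ennreal (inverse K) * f y \<le> f (U v y)"
    "\<lbrakk>v \<in> V; norm v \<le> D + 1\<rbrakk> \<Longrightarrow> f (U v y) \<le> ennreal K * f y"
  using someI_ex[OF U_bound[of "D + 1"], folded K_def] by auto

text \<open>The flow magnifies the difference of two curve points. At time \<open>n * t0\<close> the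
  magnification is \<open>p ^ n\<close>, the inverse of the half-length of the cells of level
  \<open>n\<close>, so one cell has bounded size in the orbit.\<close>

lemma Y_shift:
  assumes "s \<in> {-1..1}" "s' \<in> {-1..1}"
  shows "Y s' t = U (exp (\<rho> * t) *\<^sub>R (\<phi> s' - \<phi> s)) (Y s t)"
proof -
  have d: "\<phi> s' - \<phi> s \<in> V" using \<phi>_V assms V by (simp add: subspace_diff)
  have "\<phi> s' = (\<phi> s' - \<phi> s) + \<phi> s" by simp
  then have "U (\<phi> s') x = U (\<phi> s' - \<phi> s) (U (\<phi> s) x)"
    using U_add[OF d \<phi>_V[OF assms(1)], of x] by simp
  then show ?thesis by (simp add: Y_def G_U[OF d])
qed

lemma exp_scale: "exp (\<rho> * t0) = real p \<Longrightarrow> exp (\<rho> * (real n * t0)) = real p ^ n"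
  using exp_of_nat_mult[of n "\<rho> * t0"] by (simp add: mult.left_commute)

definition h :: "nat \<Rightarrow> real \<Rightarrow> nat \<Rightarrow> nat \<Rightarrow> real" where
  "h p t0 n i = enn2real (f (Y (midpt p n i) (real n * t0)))"

lemma h: "ennreal (h p t0 n i) = f (Y (midpt p n i) (real n * t0))" "h p t0 n i \<ge> 0"
  using f_Y by (auto simp: h_def less_top)

text \<open>[-1,1], as the domain of the segment at a node, is cut into \<open>p\<close> pieces, one
  for each child. A point of the j-th piece, flowed for time \<open>t0\<close>, differs from the
  orbit of the j-th child by a vector of norm at most \<open>D + 1\<close>.\<close>

lemma child_estimate_pointwise:
  assumes p: "p \<ge> 2" and t0: "exp (\<rho> * t0) = real p" and i: "i < p ^ n" and j: "j < p"
    and small: "real p * C * (1 / real p) powr (real n * \<gamma>) \<le> 1"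
    and r: "-1 + 2 * real j / real p \<le> r" "r \<le> -1 + 2 * (real j + 1) / real p"
  shows "ennreal (inverse K) * f (Y (midpt p (Suc n) (p * i + j)) (real (Suc n) * t0))
    \<le> f (G t0 (U (r *\<^sub>R w (midpt p n i)) (Y (midpt p n i) (real n * t0))))"
proof -
  define s s' where "s = midpt p n i" and "s' = midpt p (Suc n) (p * i + j)"
  have "p * i + j < p ^ Suc n"
  proof -
    have "p * i + j < p * (i + 1)" using j by simp
    also have "\<dots> \<le> p * p ^ n" using i by (intro mult_left_mono) auto
    finally show ?thesis by simp
  qed
  then have s: "s \<in> {-1..1}" "s' \<in> {-1..1}"
    using midpt_in[OF i] midpt_in[of "p * i + j" p "Suc n"] by (simp_all add: s_def s'_def)
  have p0: "real p > 0" using p by simp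
  define rj where "rj = -1 + (2 * real j + 1) / real p"
  define P where "P = real p ^ n"
  have P: "P > 0" using p0 by (simp add: P_def)
  have ss: "s' - s = rj / P"
    using p0 by (simp add: s_def s'_def midpt_def rj_def P_def field_simps)
  have rj: "\<bar>rj\<bar> \<le> 1"
  proof -
    have "real (Suc j) \<le> real p" using j by (simp only: of_nat_le_iff Suc_le_eq)
    then have "(2 * real j + 1) / real p \<le> 2" "(2 * real j + 1) / real p \<ge> 0"
      using p0 by (auto simp: divide_le_eq)
    then show ?thesis by (simp add: rj_def abs_le_iff)
  qed
  have rr: "\<bar>real p * (rj - r)\<bar> \<le> 1"
  proof -
    have "2 * real j - real p \<le> real p * r" "real p * r \<le> 2 * real j + 2 - real p"
      using r p0 by (simp_all add: field_simps)
    moreover have "real p * rj = 2 * real j + 1 - real p"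
      using p0 by (simp add: rj_def field_simps)
    ultimately show ?thesis unfolding right_diff_distrib by linarith
  qed
  define \<delta> where "\<delta> = \<phi> s' - \<phi> s"
  \<comment> \<open>The discrepancy at time \<open>(n + 1) * t0\<close>. It splits into the Taylor
    remainder, at most 1 by \<open>small\<close>, and the offset of \<open>r\<close> from the
    midpoint of its piece, at most \<open>D\<close> after magnification.\<close>
  define e where "e = (real p * P) *\<^sub>R \<delta> - (real p * r) *\<^sub>R w s"
  have eV: "e \<in> V" "\<delta> \<in> V"
    using V \<phi>_V[OF s(1)] \<phi>_V[OF s(2)] w_V[OF s(1)]
    by (auto simp: e_def \<delta>_def intro!: subspace_diff subspace_scale)
  have "norm e \<le> D + 1"
  proof -
    have "e = (real p * P) *\<^sub>R (\<delta> - (s' - s) *\<^sub>R w s) + (real p * (rj - r)) *\<^sub>R w s"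
      using P by (simp add: e_def ss scaleR_diff_right scaleR_diff_left right_diff_distrib)
    then have "norm e \<le> norm ((real p * P) *\<^sub>R (\<delta> - (s' - s) *\<^sub>R w s)) + norm ((real p * (rj - r)) *\<^sub>R w s)"
      by (simp only: norm_triangle_ineq)
    also have "norm ((real p * (rj - r)) *\<^sub>R w s) \<le> D"
    proof -
      have "\<bar>real p * (rj - r)\<bar> * norm (w s) \<le> 1 * norm (w s)" by (rule mult_right_mono[OF rr]) simp
      then show ?thesis using w_bound[OF s(1)] by (simp only: norm_scaleR)
    qed
    also have "norm ((real p * P) *\<^sub>R (\<delta> - (s' - s) *\<^sub>R w s)) \<le> 1"
    proof -
      have "norm (\<delta> - (s' - s) *\<^sub>R w s) \<le> C * \<bar>s' - s\<bar> powr (1 + \<gamma>)"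
        unfolding \<delta>_def by (rule \<phi>_taylor[OF s])
      also have "\<dots> \<le> C * (1 / P) powr (1 + \<gamma>)"
        using C rj P \<gamma> by (intro mult_left_mono powr_mono2) (auto simp: ss divide_right_mono abs_divide)
      also have "(1 / P) powr (1 + \<gamma>) = (1 / P) * (1 / real p) powr (real n * \<gamma>)"
      proof -
        have "1 / P = (1 / real p) powr real n" using p0 by (simp add: P_def powr_realpow power_one_over)
        then have "(1 / P) powr \<gamma> = (1 / real p) powr (real n * \<gamma>)" by (simp add: powr_powr)
        then show ?thesis using P by (simp add: powr_add)
      qed
      finally have "(real p * P) * norm (\<delta> - (s' - s) *\<^sub>R w s) \<le> (real p * P) * (C * ((1 / P) * (1 / real p) powr (real n * \<gamma>)))"
        using p0 P by (intro mult_left_mono) auto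
      also have "\<dots> = real p * C * (1 / real p) powr (real n * \<gamma>)" using P by simp
      also have "\<dots> \<le> 1" by (rule small)
      finally show ?thesis using p0 P by simp
    qed
    finally show ?thesis by simp
  qed
  let ?z = "Y s (real n * t0)"
  have rw: "r *\<^sub>R w s \<in> V" using w_V[OF s(1)] V by (simp add: subspace_scale)
  have q1: "Y s (real (Suc n) * t0) = G t0 ?z"
    unfolding Y_def G_add[symmetric] by (simp add: distrib_right)
  have q2: "G t0 (U (r *\<^sub>R w s) ?z) = U ((real p * r) *\<^sub>R w s) (G t0 ?z)"
    using G_U[OF rw] t0 by simp
  have q3: "Y s' (real (Suc n) * t0) = U ((real p * P) *\<^sub>R \<delta>) (G t0 ?z)"
    using Y_shift[OF s, of "real (Suc n) * t0"] exp_scale[OF t0, of "Suc n"] unfolding q1 \<delta>_def P_def by simp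
  have "(real p * r) *\<^sub>R w s = - e + (real p * P) *\<^sub>R \<delta>" by (simp add: e_def)
  moreover have "- e \<in> V" "(real p * P) *\<^sub>R \<delta> \<in> V" using eV V by (auto simp: subspace_neg subspace_scale)
  ultimately have "G t0 (U (r *\<^sub>R w s) ?z) = U (- e) (Y s' (real (Suc n) * t0))"
    unfolding q2 q3 by (simp only: U_add)
  then show ?thesis
    using U_K(1)[of "- e" "Y s' (real (Suc n) * t0)"] \<open>- e \<in> V\<close> \<open>norm e \<le> D + 1\<close>
    unfolding s_def s'_def by simp
qed

text \<open>The pointwise bound is integrated over the pieces, each of length \<open>2 / p\<close>,
  so the average over the segment dominates the average height of the children up to the factor
  \<open>K\<close>.\<close>

lemma child_estimate:
  assumes p: "p \<ge> 2" and t0: "exp (\<rho> * t0) = real p"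
  obtains n0 b where "b > 0" "\<And>n i. n0 \<le> n \<Longrightarrow> i < p ^ n \<Longrightarrow>
    (\<Sum>j<p. h p t0 (Suc n) (p * i + j)) \<le> K * real p * (a * real p powr (- \<beta>) * h p t0 n i + b)"
proof -
  have p0: "real p > 0" "real p > 1" using p by simp_all
  have "exp (\<rho> * t0) > 1" using t0 p0 by simp
  then have "t0 > 0" using \<rho> by (simp add: zero_less_mult_iff)
  from contraction[OF this] obtain b where b: "b > 0" and con: "\<And>y s. s \<in> {-1..1} \<Longrightarrow>
        ennreal (1 / 2) * (\<integral>\<^sup>+ r\<in>{-1..1}. f (G t0 (U (r *\<^sub>R w s) y)) \<partial>lborel)
        \<le> ennreal (a * exp (- \<beta> * (\<rho> * t0))) * f y + ennreal b" by blast
  have ex: "exp (- \<beta> * (\<rho> * t0)) = real p powr (- \<beta>)"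
  proof -
    have "ln (real p) = \<rho> * t0" unfolding t0[symmetric] by simp
    then show ?thesis using p0 by (simp add: powr_def)
  qed
  have "(\<lambda>n. real p * C * ((1 / real p) powr \<gamma>) ^ n) \<longlonglongrightarrow> real p * C * 0"
  proof (intro tendsto_intros LIMSEQ_power_zero)
    have "(1 / real p) powr \<gamma> < 1 powr \<gamma>" using p0 \<gamma> by (intro powr_less_mono2) auto
    then show "norm ((1 / real p) powr \<gamma>) < 1" by simp
  qed
  then have "\<forall>\<^sub>F n in sequentially. real p * C * ((1 / real p) powr \<gamma>) ^ n < 1"
    by (intro order_tendstoD(2)) auto
  \<comment> \<open>From this level on the magnified Taylor remainder is below 1; this is where a
    positive Hoelder exponent is used.\<close>
  then obtain n0 where n0: "\<And>n. n \<ge> n0 \<Longrightarrow> real p * C * ((1 / real p) powr \<gamma>) ^ n < 1"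
    by (auto simp: eventually_sequentially)
  have small: "real p * C * (1 / real p) powr (real n * \<gamma>) \<le> 1" if "n0 \<le> n" for n
  proof -
    have "((1 / real p) powr \<gamma>) ^ n = (1 / real p) powr (real n * \<gamma>)"
      using p0 by (simp add: powr_realpow[symmetric] powr_powr mult.commute)
    then show ?thesis using n0[OF that] by simp
  qed
  show ?thesis
  proof (rule that[OF b])
    fix n i assume n: "n0 \<le> n" and i: "i < p ^ n"
    let ?s = "midpt p n i" and ?H = "\<lambda>j. h p t0 (Suc n) (p * i + j)"
    let ?F = "\<lambda>r. f (G t0 (U (r *\<^sub>R w ?s) (Y ?s (real n * t0))))"
    \<comment> \<open>Half-open pieces are disjoint, so at most one summand is nonzero at each
      \<open>r\<close>.\<close>
    define J where "J j = {-1 + 2 * real j / real p ..< -1 + 2 * (real j + 1) / real p}" for j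
    have lenJ: "emeasure lborel (J j) = ennreal (2 / real p)" for j
      using p0 by (simp add: J_def field_simps diff_divide_distrib[symmetric])
    have J_unique: "j = j'" if r: "r \<in> J j" "r \<in> J j'" for r j j'
    proof -
      have "2 * real k \<le> (r + 1) * real p" "(r + 1) * real p < 2 * (real k + 1)" if "r \<in> J k" for k
        using that p0 by (auto simp: J_def field_simps)
      from this[OF r(1)] this[OF r(2)] have "real j < real j' + 1" "real j' < real j + 1"
        by argo+
      then show ?thesis by simp
    qed
    have J_sub: "J j \<subseteq> {-1..1}" if "j < p" for j
    proof -
      have "real (Suc j) \<le> real p" using that by (simp only: of_nat_le_iff Suc_le_eq)
      then have "2 * (real j + 1) / real p \<le> 2" using p0 by (simp add: divide_le_eq)
      moreover have "0 \<le> 2 * real j / real p" using p0 by simp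
      ultimately have "-1 \<le> r \<and> r \<le> 1" if "r \<in> J j" for r
        using that unfolding J_def atLeastLessThan_iff by argo
      then show ?thesis by auto
    qed
    have pt: "(\<Sum>j<p. ennreal (inverse K * ?H j) * indicator (J j) r) \<le> ?F r * indicator {-1..1} r" for r
    proof (cases "\<exists>j<p. r \<in> J j")
      case True
      then obtain j where j: "j < p" "r \<in> J j" by blast
      have "(\<Sum>k<p. ennreal (inverse K * ?H k) * indicator (J k) r) = (\<Sum>k\<in>{j}. ennreal (inverse K * ?H k) * indicator (J k) r)"
      proof (rule sum.mono_neutral_right)
        show "\<forall>k\<in>{..<p} - {j}. ennreal (inverse K * ?H k) * indicator (J k) r = 0"
        proof
          fix k assume "k \<in> {..<p} - {j}"
          then have "r \<notin> J k" using J_unique[OF j(2), of k] by blast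
          then show "ennreal (inverse K * ?H k) * indicator (J k) r = 0" by simp
        qed
      qed (use j in auto)
      also have "\<dots> = ennreal (inverse K) * f (Y (midpt p (Suc n) (p * i + j)) (real (Suc n) * t0))"
      proof -
        have "ennreal (inverse K * ?H j) = ennreal (inverse K) * ennreal (?H j)"
          using K h(2) by (intro ennreal_mult) auto
        then show ?thesis using j(2) by (simp only: h(1)) simp
      qed
      also have "\<dots> \<le> ?F r"
        by (rule child_estimate_pointwise[OF p t0 i j(1) small[OF n]])
          (use j(2) in \<open>simp_all only: J_def atLeastLessThan_iff less_imp_le\<close>)
      also have "\<dots> = ?F r * indicator {-1..1} r"
      proof -
        have "r \<in> {-1..1}" using J_sub[OF j(1)] j(2) by blast
        then show ?thesis by simp
      qed
      finally show ?thesis .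
    next
      case False
      then have "(\<Sum>j<p. ennreal (inverse K * ?H j) * indicator (J j) r) = 0" by (intro sum.neutral) auto
      then show ?thesis by simp
    qed
    have "ennreal (inverse K * (\<Sum>j<p. ?H j) * (2 / real p)) = (\<Sum>j<p. ennreal (inverse K * ?H j) * ennreal (2 / real p))"
    proof -
      have "(\<Sum>j<p. ennreal (inverse K * ?H j) * ennreal (2 / real p)) = (\<Sum>j<p. ennreal (inverse K * ?H j * (2 / real p)))"
        using K h(2) by (intro sum.cong refl ennreal_mult[symmetric]) auto
      also have "\<dots> = ennreal (\<Sum>j<p. inverse K * ?H j * (2 / real p))"
        using K h(2) by (intro sum_ennreal) auto
      finally show ?thesis by (simp only: sum_distrib_left sum_distrib_right)
    qed
    also have "\<dots> = (\<integral>\<^sup>+ r. (\<Sum>j<p. ennreal (inverse K * ?H j) * indicator (J j) r) \<partial>lborel)"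
    proof -
      have mJ: "J j \<in> sets lborel" for j by (simp add: J_def)
      have "(\<integral>\<^sup>+ r. (\<Sum>j<p. ennreal (inverse K * ?H j) * indicator (J j) r) \<partial>lborel)
          = (\<Sum>j<p. \<integral>\<^sup>+ r. ennreal (inverse K * ?H j) * indicator (J j) r \<partial>lborel)"
        by (rule nn_integral_sum) (use mJ in simp)
      then show ?thesis by (simp only: nn_integral_cmult_indicator[OF mJ] lenJ)
    qed
    also have "\<dots> \<le> (\<integral>\<^sup>+ r\<in>{-1..1}. ?F r \<partial>lborel)"
      by (intro nn_integral_mono pt)
    finally have "ennreal (1 / 2) * ennreal (inverse K * (\<Sum>j<p. ?H j) * (2 / real p))
        \<le> ennreal (1 / 2) * (\<integral>\<^sup>+ r\<in>{-1..1}. ?F r \<partial>lborel)" by (rule mult_left_mono) simp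
    also have "\<dots> \<le> ennreal (a * real p powr (- \<beta>)) * f (Y ?s (real n * t0)) + ennreal b"
      using con[OF midpt_in[OF i], of "Y ?s (real n * t0)"] by (simp only: ex)
    also have "\<dots> = ennreal (a * real p powr (- \<beta>) * h p t0 n i + b)"
      unfolding h(1)[symmetric] using a b h(2) by (simp add: ennreal_mult)
    also have "ennreal (1 / 2) * ennreal (inverse K * (\<Sum>j<p. ?H j) * (2 / real p))
       = ennreal (inverse K * (\<Sum>j<p. ?H j) / real p)"
    proof -
      have "0 \<le> (\<Sum>j<p. ?H j)" by (intro sum_nonneg h(2))
      then show ?thesis using K by (subst ennreal_mult[symmetric]) auto
    qed
    finally have "inverse K * (\<Sum>j<p. ?H j) / real p \<le> a * real p powr (- \<beta>) * h p t0 n i + b"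
      using a b h(2) by (subst (asm) ennreal_le_iff) (auto intro!: add_nonneg_nonneg)
    then show "(\<Sum>j<p. ?H j) \<le> K * real p * (a * real p powr (- \<beta>) * h p t0 n i + b)"
      using K p0 by (simp add: field_simps)
  qed
qed

section \<open>From nodes of the tree to orbits\<close>

text \<open>\<open>s\<close> lies in the cells of all ancestors of its node. At level
  \<open>k\<close> its distance from the midpoint, magnified by \<open>p ^ k\<close>, gives a vector
  of norm at most \<open>D\<close>, so node heights control the heights along the orbit of
  \<open>s\<close>.\<close>

lemma f_le_node:
  assumes p: "p \<ge> 2" and t0: "exp (\<rho> * t0) = real p" and s: "s \<in> {-1..1}"
    and i: "i < p ^ N" and near: "\<bar>s - midpt p N i\<bar> \<le> (1 / real p) ^ N" and k: "k \<le> N"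
  shows "f (Y s (real k * t0)) \<le> ennreal (K * h p t0 k (i div p ^ (N - k)))"
proof -
  let ?m = "midpt p k (i div p ^ (N - k))"
  have "p ^ N = p ^ k * p ^ (N - k)" using k by (simp add: power_add[symmetric])
  then have "i div p ^ (N - k) < p ^ k" using i p by (simp add: less_mult_imp_div_less)
  then have m: "?m \<in> {-1..1}" by (rule midpt_in)
  have d: "\<bar>s - ?m\<bar> \<le> (1 / real p) ^ k" using midpt_ancestor[OF _ near k] p by simp
  have V': "real p ^ k *\<^sub>R (\<phi> s - \<phi> ?m) \<in> V"
    using \<phi>_V[OF s] \<phi>_V[OF m] V by (auto intro: subspace_scale subspace_diff)
  have D0: "D \<ge> 0" using w_bound[OF s] norm_ge_zero[of "w s"] by linarith
  have "norm (real p ^ k *\<^sub>R (\<phi> s - \<phi> ?m)) \<le> real p ^ k * (D * (1 / real p) ^ k)"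
  proof -
    have "norm (\<phi> s - \<phi> ?m) \<le> D * (1 / real p) ^ k"
      using \<phi>_lipschitz[OF m s] mult_left_mono[OF d D0] by linarith
    then show ?thesis by (simp add: mult_left_mono)
  qed
  also have "\<dots> = D" using p by (simp add: power_one_over)
  finally have "norm (real p ^ k *\<^sub>R (\<phi> s - \<phi> ?m)) \<le> D + 1" by simp
  from U_K(2)[OF V' this] have "f (Y s (real k * t0)) \<le> ennreal K * f (Y ?m (real k * t0))"
    unfolding Y_shift[OF m s] exp_scale[OF t0] .
  then show ?thesis unfolding h(1)[symmetric] using K h(2) by (simp add: ennreal_mult)
qed

lemma continuous_Y: "continuous_on UNIV (Y s)"
  unfolding Y_def[abs_def] by (rule cont_G)

lemma Y_vimage_sets: "closed Q \<Longrightarrow> {0..T} \<inter> Y s -` Q \<in> sets lborel"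
  using closed_vimage[of Q "Y s"] continuous_Y by simp

text \<open>A low ancestor at level \<open>k\<close> keeps the orbit in one compact set during the
  whole time interval from \<open>k * t0\<close> to \<open>(k + 1) * t0\<close>, because the height
  grows at most by \<open>K'\<close> within time \<open>t0\<close>. The intervals are disjoint, so
  low ancestors count time spent in \<open>Q\<close>.\<close>

lemma time_in_compact:
  assumes p: "p \<ge> 2" and t0: "exp (\<rho> * t0) = real p" "t0 > 0"
  obtains Q where "compact Q" "\<And>s N i T n0. \<lbrakk>s \<in> {-1..1}; i < p ^ N; \<bar>s - midpt p N i\<bar> \<le> (1 / real p) ^ N; real N * t0 \<le> T\<rbrakk> \<Longrightarrow>
    t0 * real (card {k. n0 \<le> k \<and> k < N \<and> \<not> M < h p t0 k (i div p ^ (N - k))}) \<le> measure lborel ({0..T} \<inter> Y s -` Q)"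
proof -
  obtain K' where K': "K' \<ge> 1" "\<And>\<tau> y. \<tau> \<in> {0..t0} \<Longrightarrow> f (G \<tau> y) \<le> ennreal K' * f y"
    using G_bound[of t0] by blast
  define M' where "M' = max 1 (K' * (K * M))"
  define Q where "Q = closure {y. f y \<le> ennreal M'}"
  have Q: "compact Q" unfolding Q_def by (rule f_proper) (simp add: M'_def)
  show ?thesis
  proof (rule that[OF Q])
    fix s T :: real and N i n0 :: nat
    assume s: "s \<in> {-1..1}" and i: "i < p ^ N" and near: "\<bar>s - midpt p N i\<bar> \<le> (1 / real p) ^ N" and T: "real N * t0 \<le> T"
    define L where "L = {k. n0 \<le> k \<and> k < N \<and> \<not> M < h p t0 k (i div p ^ (N - k))}"
    have L: "finite L" by (simp add: L_def)
    define J where "J k = {real k * t0 ..< real (Suc k) * t0}" for k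
    have sub: "J k \<subseteq> {0..T} \<inter> Y s -` Q" if k: "k \<in> L" for k
    proof
      fix t assume t: "t \<in> J k"
      have "real (Suc k) \<le> real N" using k by (simp only: L_def of_nat_le_iff Suc_le_eq mem_Collect_eq)
      then have "real (Suc k) * t0 \<le> real N * t0" using t0 by (intro mult_right_mono) auto
      then have "t \<le> T" using t T by (simp add: J_def)
      moreover have "0 \<le> real k * t0" using t0 by simp
      then have "0 \<le> t" using t unfolding J_def by (meson atLeastLessThan_iff order_trans)
      moreover have "Y s t \<in> Q"
      proof -
        define \<tau> where "\<tau> = t - real k * t0"
        have \<tau>: "\<tau> \<in> {0..t0}" using t by (auto simp: \<tau>_def J_def algebra_simps)
        have "Y s t = G \<tau> (Y s (real k * t0))" by (simp add: Y_def G_add[symmetric] \<tau>_def)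
        then have "f (Y s t) \<le> ennreal K' * f (Y s (real k * t0))" using K'(2)[OF \<tau>] by simp
        also have "\<dots> \<le> ennreal K' * ennreal (K * h p t0 k (i div p ^ (N - k)))"
          using k by (intro mult_left_mono f_le_node[OF p t0(1) s i near]) (auto simp: L_def)
        also have "\<dots> = ennreal (K' * (K * h p t0 k (i div p ^ (N - k))))"
          using K K' h(2) by (intro ennreal_mult[symmetric]) auto
        also have "\<dots> \<le> ennreal M'"
        proof (rule ennreal_leI)
          have "K' * (K * h p t0 k (i div p ^ (N - k))) \<le> K' * (K * M)"
            using k K K' by (intro mult_left_mono) (auto simp: L_def)
          then show "K' * (K * h p t0 k (i div p ^ (N - k))) \<le> M'" by (simp add: M'_def)
        qed
        finally show ?thesis unfolding Q_def by (intro subsetD[OF closure_subset]) simp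
      qed
      ultimately show "t \<in> {0..T} \<inter> Y s -` Q" by simp
    qed
    have disj: "disjoint_family_on J L"
      unfolding disjoint_family_on_def
    proof (intro ballI impI)
      fix k k' :: nat assume "k \<noteq> k'"
      then consider "Suc k \<le> k'" | "Suc k' \<le> k" by linarith
      then show "J k \<inter> J k' = {}"
      proof cases
        case 1
        then have "real (Suc k) * t0 \<le> real k' * t0" using t0 by (intro mult_right_mono) auto
        then show ?thesis by (auto simp: J_def)
      next
        case 2
        then have "real (Suc k') * t0 \<le> real k * t0" using t0 by (intro mult_right_mono) auto
        then show ?thesis by (auto simp: J_def)
      qed
    qed
    have lenJ: "emeasure lborel (J k) = ennreal t0" for k
      using t0 by (simp add: J_def distrib_right mult_right_mono)
    have "t0 * real (card L) = measure lborel (\<Union>k\<in>L. J k)"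
    proof -
      have "emeasure lborel (\<Union>k\<in>L. J k) = (\<Sum>k\<in>L. emeasure lborel (J k))"
        by (rule sum_emeasure[symmetric, OF _ disj L]) (auto simp: J_def)
      also have "\<dots> = ennreal (t0 * real (card L))"
        using t0 by (simp add: lenJ ennreal_of_nat_eq_real_of_nat ennreal_mult mult.commute)
      finally show ?thesis using t0 by (simp add: measure_def)
    qed
    also have "\<dots> \<le> measure lborel ({0..T} \<inter> Y s -` Q)"
    proof (rule measure_mono_fmeasurable)
      show "(\<Union>k\<in>L. J k) \<subseteq> {0..T} \<inter> Y s -` Q" using sub by blast
      show "(\<Union>k\<in>L. J k) \<in> sets lborel" using L by (auto simp: J_def)
      have "{0..T} \<inter> Y s -` Q \<in> sets lborel" by (rule Y_vimage_sets[OF compact_imp_closed[OF Q]])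
      then show "{0..T} \<inter> Y s -` Q \<in> fmeasurable lborel"
        by (rule fmeasurableI2[of "{0..T}", rotated 2]) (auto simp: fmeasurable_def emeasure_lborel_Icc_eq)
    qed
    finally show "t0 * real (card {k. n0 \<le> k \<and> k < N \<and> \<not> M < h p t0 k (i div p ^ (N - k))}) \<le> measure lborel ({0..T} \<inter> Y s -` Q)"
      by (simp add: L_def)
  qed
qed

lemma set_integral_Y:
  assumes "closed Q"
  shows "(LINT t:{0..T}|lborel. indicator Q (Y s t) :: real) = measure lborel ({0..T} \<inter> Y s -` Q)"
proof -
  have "(LINT t:{0..T}|lborel. indicator Q (Y s t) :: real) = (LINT t|lborel. indicator ({0..T} \<inter> Y s -` Q) t)"
    unfolding set_lebesgue_integral_def by (intro Bochner_Integration.integral_cong refl) (auto simp: indicator_def)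
  also have "\<dots> = measure lborel ({0..T} \<inter> Y s -` Q)"
    using Y_vimage_sets[OF assms] by simp
  finally show ?thesis .
qed


lemma divergent_near_nodes:
  assumes p: "p \<ge> 2" and t0: "exp (\<rho> * t0) = real p" "t0 > 0" and s: "s \<in> {-1..1}"
    and div: "divergent_on_average (Y s)" and \<delta>: "\<delta> > 0"
  shows "\<forall>\<^sub>F N in sequentially. \<exists>i\<in>{i. i < p ^ N \<and>
      real (card {k. n0 \<le> k \<and> k < N \<and> \<not> M < h p t0 k (i div p ^ (N - k))}) \<le> \<delta> * real N}.
    \<bar>s - midpt p N i\<bar> \<le> (1 / real p) ^ N"
proof -
  obtain Q where Q: "compact Q" "\<And>s N i T n0. \<lbrakk>s \<in> {-1..1}; i < p ^ N; \<bar>s - midpt p N i\<bar> \<le> (1 / real p) ^ N; real N * t0 \<le> T\<rbrakk> \<Longrightarrow>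
    t0 * real (card {k. n0 \<le> k \<and> k < N \<and> \<not> M < h p t0 k (i div p ^ (N - k))}) \<le> measure lborel ({0..T} \<inter> Y s -` Q)"
    by (rule time_in_compact[OF p t0, where M = M]) (rule that)
  have "filterlim (\<lambda>N. real N * t0) at_top sequentially"
    using t0 by (intro filterlim_at_top_mult_tendsto_pos[OF tendsto_const _ filterlim_real_sequentially]) auto
  moreover have "((\<lambda>T. (1 / T) * measure lborel ({0..T} \<inter> Y s -` Q)) \<longlongrightarrow> 0) at_top"
    using div Q(1) by (simp add: divergent_on_average_def set_integral_Y compact_imp_closed)
  ultimately have "(\<lambda>N. (1 / (real N * t0)) * measure lborel ({0..real N * t0} \<inter> Y s -` Q)) \<longlonglongrightarrow> 0"
    by (rule filterlim_compose[rotated])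
  then have "\<forall>\<^sub>F N in sequentially. (1 / (real N * t0)) * measure lborel ({0..real N * t0} \<inter> Y s -` Q) < \<delta>"
    using \<delta> by (rule order_tendstoD(2))
  then show ?thesis
    using eventually_gt_at_top[of 0]
  proof eventually_elim
    case (elim N)
    obtain i where i: "i < p ^ N" "\<bar>s - midpt p N i\<bar> \<le> (1 / real p) ^ N"
      using midpt_exists[OF s, of p N] p by auto
    have "measure lborel ({0..real N * t0} \<inter> Y s -` Q) \<le> \<delta> * (real N * t0)"
      using elim t0 by (simp add: field_simps)
    with Q(2)[OF s i order_refl, of n0]
    have "t0 * real (card {k. n0 \<le> k \<and> k < N \<and> \<not> M < h p t0 k (i div p ^ (N - k))}) \<le> t0 * (\<delta> * real N)"
      by (simp add: mult_ac)
    then have "real (card {k. n0 \<le> k \<and> k < N \<and> \<not> M < h p t0 k (i div p ^ (N - k))}) \<le> \<delta> * real N"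
      using t0 by simp
    then show ?case using i by blast
  qed
qed

lemma exists_large_base:
  fixes X \<eta> :: real
  assumes "\<eta> > 0"
  obtains p :: nat and t0 where "p \<ge> 2" "X \<le> real p powr \<eta>" "exp (\<rho> * t0) = real p" "t0 > 0"
proof -
  obtain n :: nat where n: "max 1 X powr (1 / \<eta>) < real n" using reals_Archimedean2 by blast
  define p where "p = max 2 n"
  have p: "p \<ge> 2" by (simp add: p_def)
  have "X \<le> max 1 X" by simp
  also have "\<dots> = (max 1 X powr (1 / \<eta>)) powr \<eta>" using assms by (simp add: powr_powr)
  also have "\<dots> \<le> real p powr \<eta>" using n assms by (intro powr_mono2) (auto simp: p_def)
  finally have X: "X \<le> real p powr \<eta>" .
  show ?thesis
    by (rule that[OF p X, of "ln (real p) / \<rho>"]) (use p \<rho> in auto)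
qed

text \<open>The growth per level is \<open>2 * Q * exp 1\<close>, where \<open>Q\<close> is
  \<open>K * a\<close> times \<open>p powr (1 - \<beta>)\<close>. The base \<open>p\<close> is taken
  so large that \<open>2 * K * a * exp 1\<close> disappears in \<open>p powr \<eta>\<close>.\<close>

lemma few_low_setup:
  assumes \<eta>: "\<eta> > 0"
  obtains p t0 n0 M \<delta> S R where "p \<ge> 2" "exp (\<rho> * t0) = real p" "t0 > 0" "\<delta> > 0" "R > 0"
    "R \<le> real p powr (\<eta> + 1 - \<beta>)"
    "\<And>N. n0 \<le> N \<Longrightarrow> real (card {i. i < p ^ N \<and>
        real (card {k. n0 \<le> k \<and> k < N \<and> \<not> M < h p t0 k (i div p ^ (N - k))}) \<le> \<delta> * real N}) \<le> S * R ^ N"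
proof -
  obtain p t0 where p: "p \<ge> 2" "2 * K * a * exp 1 \<le> real p powr \<eta>" "exp (\<rho> * t0) = real p" "t0 > 0"
    by (rule exists_large_base[OF \<eta>]) (rule that)
  have p0: "real p > 0" using p by simp
  obtain n0 b where b: "b > 0" "\<And>n i. n0 \<le> n \<Longrightarrow> i < p ^ n \<Longrightarrow>
    (\<Sum>j<p. h p t0 (Suc n) (p * i + j)) \<le> K * real p * (a * real p powr (- \<beta>) * h p t0 n i + b)"
    by (rule child_estimate[OF p(1,3)]) (rule that)
  define Q where "Q = K * real p * a * real p powr (- \<beta>)"
  have Q: "Q > 0" using K a p0 by (simp add: Q_def)
  have R: "2 * Q * exp 1 \<le> real p powr (\<eta> + 1 - \<beta>)"
  proof -
    have "2 * Q * exp 1 = (2 * K * a * exp 1) * (real p * real p powr (- \<beta>))" by (simp add: Q_def)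
    also have "\<dots> \<le> real p powr \<eta> * (real p * real p powr (- \<beta>))"
      using p by (intro mult_right_mono) auto
    also have "\<dots> = real p powr (\<eta> + 1 - \<beta>)"
      using p0 powr_add[of "real p" \<eta> "1 - \<beta>"] powr_add[of "real p" 1 "- \<beta>"] by (simp add: add_diff_eq)
    finally show ?thesis .
  qed
  have D: "K * real p * b \<ge> 0" using K b(1) by simp
  have child: "(\<Sum>j<p. h p t0 (Suc n) (p * i + j)) \<le> Q * h p t0 n i + K * real p * b"
    if "n0 \<le> n" "i < p ^ n" for n i
    using b(2)[OF that] by (simp add: Q_def algebra_simps)
  have "p > 0" using p by simp
  obtain M \<delta> S where MS: "\<delta> > 0"
    "\<And>N. n0 \<le> N \<Longrightarrow> real (card {i. i < p ^ N \<and>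
        real (card {k. n0 \<le> k \<and> k < N \<and> \<not> M < h p t0 k (i div p ^ (N - k))}) \<le> \<delta> * real N})
      \<le> S * (2 * Q * exp 1) ^ N"
  proof (rule few_low_count[of p "h p t0" Q "K * real p * b" 1 n0, OF \<open>p > 0\<close> h(2) Q D zero_less_one])
    show "(\<Sum>j<p. h p t0 (Suc n) (p * i + j)) \<le> Q * h p t0 n i + K * real p * b"
      if "n0 \<le> n" "i < p ^ n" for n i by (rule child[OF that])
  qed (rule that)
  show ?thesis
  proof (rule that[OF p(1,3,4) MS(1) _ R MS(2)])
    show "0 < 2 * Q * exp 1" using Q by simp
  qed
qed

lemma hausdorff_measure_divergent:
  assumes d: "d > 0" "d > 1 - \<beta>"
  shows "hausdorff_measure d {s \<in> {-1..1}. divergent_on_average (Y s)} = 0"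
proof -
  \<comment> \<open>Half the gap: one half pays for the constants, the other leaves
    \<open>R * (1 / p) powr d\<close> at most \<open>p powr (- \<eta>)\<close>.\<close>
  define \<eta> where "\<eta> = (d - (1 - \<beta>)) / 2"
  have \<eta>: "\<eta> > 0" using d by (simp add: \<eta>_def)
  obtain p t0 n0 M \<delta> S R where p: "p \<ge> 2" "exp (\<rho> * t0) = real p" "t0 > 0" and \<delta>: "\<delta> > 0" and R: "R > 0"
    "R \<le> real p powr (\<eta> + 1 - \<beta>)" and card:
    "\<And>N. n0 \<le> N \<Longrightarrow> real (card {i. i < p ^ N \<and>
        real (card {k. n0 \<le> k \<and> k < N \<and> \<not> M < h p t0 k (i div p ^ (N - k))}) \<le> \<delta> * real N}) \<le> S * R ^ N"
    by (rule few_low_setup[OF \<eta>]) (rule that)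
  have p1: "real p > 1" using p by simp
  show ?thesis
  proof (rule hausdorff_measure_limsup_zero[OF _ card _ _ d(1) R(1), where r = "1 / real p" and c = "midpt p"])
    have "R * (1 / real p) powr d \<le> real p powr (\<eta> + 1 - \<beta>) * (1 / real p) powr d"
      by (intro mult_right_mono R) simp
    also have "\<dots> = real p powr (\<eta> + 1 - \<beta> - d)" using p1 by (simp add: powr_diff powr_divide)
    also have "\<eta> + 1 - \<beta> - d = - \<eta>" by (simp add: \<eta>_def field_simps)
    also have "real p powr (- \<eta>) < 1"
    proof -
      have "1 < real p powr \<eta>" using p1 \<eta> by (rule gr_one_powr)
      then show ?thesis by (simp add: powr_minus inverse_less_1_iff)
    qed
    finally show "R * (1 / real p) powr d < 1" .
    fix s assume "s \<in> {s \<in> {-1..1}. divergent_on_average (Y s)}"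
    then show "\<exists>\<^sub>F N in sequentially. \<exists>i\<in>{i. i < p ^ N \<and>
        real (card {k. n0 \<le> k \<and> k < N \<and> \<not> M < h p t0 k (i div p ^ (N - k))}) \<le> \<delta> * real N}.
       \<bar>s - midpt p N i\<bar> \<le> (1 / real p) ^ N"
      by (intro eventually_frequently[OF trivial_limit_sequentially] divergent_near_nodes[OF p _ _ \<delta>]) auto
  qed (use p1 in auto)
qed

text \<open>For \<beta> > 1 the claimed dimension is negative, so the exceptional set has to be
  empty. Here the growth rate is below 1; a count below 1 means that no node with few low ancestors
  is left at large levels.\<close>

lemma not_divergent:
  assumes \<beta>1: "\<beta> > 1" and s: "s \<in> {-1..1}"
  shows "\<not> divergent_on_average (Y s)"
proof
  assume div: "divergent_on_average (Y s)"
  define \<eta> where "\<eta> = (\<beta> - 1) / 2"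
  have \<eta>: "\<eta> > 0" using \<beta>1 by (simp add: \<eta>_def)
  obtain p t0 n0 M \<delta> S R where p: "p \<ge> 2" "exp (\<rho> * t0) = real p" "t0 > 0" and \<delta>: "\<delta> > 0" and R: "R > 0"
    "R \<le> real p powr (\<eta> + 1 - \<beta>)" and card:
    "\<And>N. n0 \<le> N \<Longrightarrow> real (card {i. i < p ^ N \<and>
        real (card {k. n0 \<le> k \<and> k < N \<and> \<not> M < h p t0 k (i div p ^ (N - k))}) \<le> \<delta> * real N}) \<le> S * R ^ N"
    by (rule few_low_setup[OF \<eta>]) (rule that)
  have p1: "real p > 1" using p by simp
  have "1 < real p powr \<eta>" using p1 \<eta> by (rule gr_one_powr)
  then have l1: "real p powr (- \<eta>) < 1" by (simp add: powr_minus inverse_less_1_iff)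
  have e: "\<eta> + 1 - \<beta> = - \<eta>" by (simp add: \<eta>_def field_simps)
  have "R < 1" using R(2) l1 unfolding e by linarith
  then have "(\<lambda>N. S * R ^ N) \<longlonglongrightarrow> S * 0" using R by (intro tendsto_intros LIMSEQ_power_zero) auto
  then have "\<forall>\<^sub>F N in sequentially. S * R ^ N < 1" by (intro order_tendstoD(2)) auto
  then have "\<forall>\<^sub>F N in sequentially. False"
    using divergent_near_nodes[OF p s div \<delta>, of n0 M] eventually_ge_at_top[of n0]
  proof eventually_elim
    case (elim N)
    let ?G = "{i. i < p ^ N \<and> real (card {k. n0 \<le> k \<and> k < N \<and> \<not> M < h p t0 k (i div p ^ (N - k))}) \<le> \<delta> * real N}"
    have "real (card ?G) < 1" using card[OF elim(3)] elim(1) by linarith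
    then have "card ?G = 0" by simp
    then have "?G = {}" by (subst (asm) card_0_eq) auto
    then show ?case using elim(2) by blast
  qed
  then show False by simp
qed

theorem hausdorff_dim_divergent:
  "hausdorff_dim {s \<in> {-1..1}. divergent_on_average (Y s)} \<le> ereal (1 - \<beta>)"
proof (cases "{s \<in> {-1..1}. divergent_on_average (Y s)} = {}")
  case True
  then show ?thesis by (simp only: hausdorff_dim_def) simp
next
  case False
  then have \<beta>1: "\<beta> \<le> 1" using not_divergent by (metis (mono_tags, lifting) Collect_empty_eq linorder_not_le)
  let ?Z = "{s \<in> {-1..1}. divergent_on_average (Y s)}"
  have "Inf {ereal d |d. d \<ge> 0 \<and> hausdorff_measure d ?Z = 0} \<le> ereal (1 - \<beta>) + ereal e" if e: "e > 0" for e
  proof (rule Inf_lower)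
    have "hausdorff_measure (1 - \<beta> + e) ?Z = 0" by (rule hausdorff_measure_divergent) (use e \<beta>1 in auto)
    then show "ereal (1 - \<beta>) + ereal e \<in> {ereal d |d. d \<ge> 0 \<and> hausdorff_measure d ?Z = 0}"
      using e \<beta>1 by (auto intro!: exI[of _ "1 - \<beta> + e"])
  qed
  then have "Inf {ereal d |d. d \<ge> 0 \<and> hausdorff_measure d ?Z = 0} \<le> ereal (1 - \<beta>)"
    by (rule ereal_le_epsilon2)
  then show ?thesis using False by (simp only: hausdorff_dim_def if_False)
qed

section \<open>Tightness of the orbit averages\<close>

lemma orbit_average_props:
  assumes "T > 0"
  shows "prob_space (orbit_average (Y s) T)"
    and "compact Q \<Longrightarrow> measure (orbit_average (Y s) T) (- Q) = 1 - measure lborel ({0..T} \<inter> Y s -` Q) / T"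
proof -
  have m: "Y s \<in> borel_measurable (uniform_measure lborel {0..T})"
    using borel_measurable_continuous_onI[OF continuous_Y] by simp
  have pu: "prob_space (uniform_measure lborel {0..T})"
    using assms by (intro prob_space_uniform_measure) auto
  show P: "prob_space (orbit_average (Y s) T)"
    unfolding orbit_average_def by (rule prob_space.prob_space_distr[OF pu m])
  show "measure (orbit_average (Y s) T) (- Q) = 1 - measure lborel ({0..T} \<inter> Y s -` Q) / T" if Q: "compact Q"
  proof -
    interpret prob_space "orbit_average (Y s) T" by (rule P)
    have sQ: "Q \<in> sets (borel :: 'x measure)" using compact_imp_closed[OF Q] by simp
    have "measure (orbit_average (Y s) T) Q = measure (uniform_measure lborel {0..T}) (Y s -` Q)"
      unfolding orbit_average_def using measure_distr[OF m sQ] by simp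
    also have "\<dots> = measure lborel ({0..T} \<inter> Y s -` Q) / T"
      using assms closed_vimage[OF compact_imp_closed[OF Q] continuous_Y[of s]]
      by (subst measure_uniform_measure) auto
    finally have "measure (orbit_average (Y s) T) Q = measure lborel ({0..T} \<inter> Y s -` Q) / T" .
    moreover have "measure (orbit_average (Y s) T) (- Q) = 1 - measure (orbit_average (Y s) T) Q"
      using prob_compl[of Q] sQ by (simp add: orbit_average_def Compl_eq_Diff_UNIV)
    ultimately show ?thesis by simp
  qed
qed

lemma AE_many_low:
  assumes p: "p \<ge> 2" and t0: "exp (\<rho> * t0) = real p" and \<epsilon>: "0 < \<epsilon>" "\<epsilon> < 1"
    and D: "D' \<ge> 0" and child: "\<And>n i. n0 \<le> n \<Longrightarrow> i < p ^ n \<Longrightarrow>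
      (\<Sum>j<p. h p t0 (Suc n) (p * i + j)) \<le> real p * (h p t0 n i / 4 + D')"
  shows "\<exists>M. AE s in lebesgue. \<forall>\<^sub>F N in sequentially. \<forall>i<p ^ N. \<bar>s - midpt p N i\<bar> \<le> (1 / real p) ^ N \<longrightarrow>
     (1 - \<epsilon>) * real N \<le> real (card {k. n0 \<le> k \<and> k < N \<and> \<not> M < h p t0 k (i div p ^ (N - k))})"
proof -
  have p0: "p > 0" "real p > 0" using p by simp_all
  obtain M S \<theta> where \<theta>: "0 < \<theta>" "\<theta> < 1" and card:
    "\<And>N. n0 \<le> N \<Longrightarrow> real (card {i. i < p ^ N \<and>
        real (card {k. n0 \<le> k \<and> k < N \<and> \<not> M < h p t0 k (i div p ^ (N - k))}) \<le> (1 - \<epsilon>) * real N})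
      \<le> S * (real p * \<theta>) ^ N"
  proof (rule many_high_count[of p "h p t0" D' \<epsilon> n0, OF p0(1) h(2) D \<epsilon>])
    show "(\<Sum>j<p. h p t0 (Suc n) (p * i + j)) \<le> real p * (h p t0 n i / 4 + D')"
      if "n0 \<le> n" "i < p ^ n" for n i by (rule child[OF that])
  qed (rule that)
  have "AE s in lebesgue. \<forall>\<^sub>F N in sequentially. \<forall>i\<in>{i. i < p ^ N \<and>
        real (card {k. n0 \<le> k \<and> k < N \<and> \<not> M < h p t0 k (i div p ^ (N - k))}) \<le> (1 - \<epsilon>) * real N}.
      \<not> \<bar>s - midpt p N i\<bar> \<le> (1 / real p) ^ N"
    by (rule AE_eventually_not_near[OF _ card]) (use p0 \<theta> in auto)
  then have "AE s in lebesgue. \<forall>\<^sub>F N in sequentially. \<forall>i<p ^ N. \<bar>s - midpt p N i\<bar> \<le> (1 / real p) ^ N \<longrightarrow>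
     (1 - \<epsilon>) * real N \<le> real (card {k. n0 \<le> k \<and> k < N \<and> \<not> M < h p t0 k (i div p ^ (N - k))})"
    by eventually_elim (erule eventually_mono, force)
  then show ?thesis by blast
qed

theorem AE_weak_star_limits:
  "AE s in lebesgue. s \<in> {-1..1} \<longrightarrow> weak_star_limits_are_probabilities (orbit_average (Y s))"
proof -
  obtain p t0 where p: "p \<ge> 2" "4 * K * a \<le> real p powr \<beta>" "exp (\<rho> * t0) = real p" "t0 > 0"
    by (rule exists_large_base[OF \<beta>]) (rule that)
  have p0: "real p > 0" using p by simp
  obtain n0 b where b: "b > 0" "\<And>n i. n0 \<le> n \<Longrightarrow> i < p ^ n \<Longrightarrow>
    (\<Sum>j<p. h p t0 (Suc n) (p * i + j)) \<le> K * real p * (a * real p powr (- \<beta>) * h p t0 n i + b)"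
    by (rule child_estimate[OF p(1,3)]) (rule that)
  \<comment> \<open>This is the factor 1/4 of \<open>many_high_count\<close>. One \<open>p\<close>
    serves for all proportions; only the threshold \<open>M\<close> depends on
    \<open>m\<close>.\<close>
  have Ka: "K * a * real p powr (- \<beta>) \<le> 1 / 4"
    using p(2) p0 by (simp add: powr_minus field_simps)
  have child: "(\<Sum>j<p. h p t0 (Suc n) (p * i + j)) \<le> real p * (h p t0 n i / 4 + K * b)"
    if "n0 \<le> n" "i < p ^ n" for n i
  proof -
    have "K * real p * (a * real p powr (- \<beta>) * h p t0 n i + b)
        = real p * ((K * a * real p powr (- \<beta>)) * h p t0 n i + K * b)" by (simp add: algebra_simps)
    also have "\<dots> \<le> real p * ((1 / 4) * h p t0 n i + K * b)"
      by (intro mult_left_mono add_right_mono mult_right_mono Ka h(2)) simp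
    finally show ?thesis using b(2)[OF that] by simp
  qed
  \<comment> \<open>Countably many proportions tending to 0, so that a single null set serves for
    all of them. The 2 keeps them below 1.\<close>
  define \<epsilon> :: "nat \<Rightarrow> real" where "\<epsilon> m = 1 / (real m + 2)" for m
  have \<epsilon>: "0 < \<epsilon> m" "\<epsilon> m < 1" for m by (auto simp: \<epsilon>_def)
  have "K * b \<ge> 0" using K b(1) by simp
  from AE_many_low[OF p(1,3) \<epsilon> this child]
  have "\<forall>m. \<exists>M. AE s in lebesgue. \<forall>\<^sub>F N in sequentially. \<forall>i<p ^ N. \<bar>s - midpt p N i\<bar> \<le> (1 / real p) ^ N \<longrightarrow>
     (1 - \<epsilon> m) * real N \<le> real (card {k. n0 \<le> k \<and> k < N \<and> \<not> M < h p t0 k (i div p ^ (N - k))})"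
    by blast
  from choice[OF this] obtain M where
    "\<And>m. AE s in lebesgue. \<forall>\<^sub>F N in sequentially. \<forall>i<p ^ N. \<bar>s - midpt p N i\<bar> \<le> (1 / real p) ^ N \<longrightarrow>
     (1 - \<epsilon> m) * real N \<le> real (card {k. n0 \<le> k \<and> k < N \<and> \<not> M m < h p t0 k (i div p ^ (N - k))})"
    by blast
  then have "AE s in lebesgue. \<forall>m. \<forall>\<^sub>F N in sequentially. \<forall>i<p ^ N. \<bar>s - midpt p N i\<bar> \<le> (1 / real p) ^ N \<longrightarrow>
     (1 - \<epsilon> m) * real N \<le> real (card {k. n0 \<le> k \<and> k < N \<and> \<not> M m < h p t0 k (i div p ^ (N - k))})"
    by (simp add: AE_all_countable)
  then show ?thesis
  proof (rule AE_mp, intro AE_I2 impI)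
    fix s :: real
    assume low: "\<forall>m. \<forall>\<^sub>F N in sequentially. \<forall>i<p ^ N. \<bar>s - midpt p N i\<bar> \<le> (1 / real p) ^ N \<longrightarrow>
     (1 - \<epsilon> m) * real N \<le> real (card {k. n0 \<le> k \<and> k < N \<and> \<not> M m < h p t0 k (i div p ^ (N - k))})"
      and s: "s \<in> {-1..1}"
    show "weak_star_limits_are_probabilities (orbit_average (Y s))"
    proof (rule tight_weak_star_limits)
      show "prob_space (orbit_average (Y s) T)" if "T > 0" for T by (rule orbit_average_props(1)[OF that])
      show "sets (orbit_average (Y s) T) = sets borel" for T by (simp add: orbit_average_def)
      fix e :: real assume e: "e > 0"
      obtain m where m: "\<epsilon> m < e / 2"
      proof -
        obtain m :: nat where "2 / e < real m" using reals_Archimedean2 by blast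
        then have "\<epsilon> m < e / 2" using e by (simp add: \<epsilon>_def field_simps)
        then show ?thesis by (rule that)
      qed
      obtain Q where Q: "compact Q" "\<And>s N i T n0. \<lbrakk>s \<in> {-1..1}; i < p ^ N; \<bar>s - midpt p N i\<bar> \<le> (1 / real p) ^ N; real N * t0 \<le> T\<rbrakk> \<Longrightarrow>
        t0 * real (card {k. n0 \<le> k \<and> k < N \<and> \<not> M m < h p t0 k (i div p ^ (N - k))}) \<le> measure lborel ({0..T} \<inter> Y s -` Q)"
        by (rule time_in_compact[OF p(1,3,4), where M = "M m"]) (rule that)
      \<comment> \<open>Rounding \<open>T\<close> down to a multiple of \<open>t0\<close> loses less
        than \<open>t0\<close>, which is at most \<open>(e / 2) * T\<close> once
        \<open>T \<ge> 2 * t0 / e\<close>.\<close>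
      define N where "N T = nat \<lfloor>T / t0\<rfloor>" for T
      have "filterlim (\<lambda>T. T / t0) at_top at_top"
        using filterlim_tendsto_pos_mult_at_top[OF tendsto_const[of "1 / t0"] _ filterlim_ident] p(4) by simp
      then have "filterlim N at_top at_top"
        unfolding N_def by (intro filterlim_compose[OF filterlim_nat_sequentially] filterlim_compose[OF filterlim_floor_sequentially])
      from this[unfolded filterlim_iff, rule_format, OF low[rule_format, of m]]
      have ev: "\<forall>\<^sub>F T in at_top. \<forall>i<p ^ N T. \<bar>s - midpt p (N T) i\<bar> \<le> (1 / real p) ^ N T \<longrightarrow>
         (1 - \<epsilon> m) * real (N T) \<le> real (card {k. n0 \<le> k \<and> k < N T \<and> \<not> M m < h p t0 k (i div p ^ (N T - k))})" .
      have "\<forall>\<^sub>F T in at_top. measure (orbit_average (Y s) T) (- Q) \<le> e"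
        using ev eventually_gt_at_top[of 0] eventually_ge_at_top[of "2 * t0 / e"]
      proof eventually_elim
        case (elim T)
        obtain i where i: "i < p ^ N T" "\<bar>s - midpt p (N T) i\<bar> \<le> (1 / real p) ^ N T"
          using midpt_exists[OF s, of p "N T"] p by auto
        have "0 \<le> T / t0" using elim p(4) by simp
        then have NT: "real (N T) \<le> T / t0" "T / t0 < real (N T) + 1"
          unfolding N_def by (auto simp: of_nat_nat)
        then have NT': "real (N T) * t0 \<le> T" "T < (real (N T) + 1) * t0"
          using p(4) by (simp_all add: field_simps)
        have "(1 - \<epsilon> m) * (T - t0) \<le> (1 - \<epsilon> m) * (t0 * real (N T))"
          using NT' \<epsilon>[of m] by (intro mult_left_mono) (auto simp: algebra_simps)
        also have "\<dots> = t0 * ((1 - \<epsilon> m) * real (N T))" by simp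
        also have "\<dots> \<le> t0 * real (card {k. n0 \<le> k \<and> k < N T \<and> \<not> M m < h p t0 k (i div p ^ (N T - k))})"
          using elim(1) i p(4) by (intro mult_left_mono) auto
        also have "\<dots> \<le> measure lborel ({0..T} \<inter> Y s -` Q)" by (rule Q(2)[OF s i NT'(1)])
        finally have meas: "(1 - \<epsilon> m) * (T - t0) \<le> measure lborel ({0..T} \<inter> Y s -` Q)" .
        have "T - measure lborel ({0..T} \<inter> Y s -` Q) \<le> T - (1 - \<epsilon> m) * (T - t0)" using meas by simp
        also have "\<dots> = \<epsilon> m * T + (1 - \<epsilon> m) * t0" by (simp add: algebra_simps)
        also have "\<dots> \<le> (e / 2) * T + 1 * t0"
          using m \<epsilon>[of m] elim(2) p(4) by (intro add_mono mult_right_mono) auto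
        also have "\<dots> \<le> e * T" using elim(3) e by (simp add: field_simps)
        finally have "(T - measure lborel ({0..T} \<inter> Y s -` Q)) / T \<le> e" using elim(2) by (simp add: divide_le_eq)
        then show ?case
          using elim(2) by (simp add: orbit_average_props(2)[OF elim(2) Q(1)] diff_divide_distrib)
      qed
      with Q(1) show "\<exists>Q. compact Q \<and> (\<forall>\<^sub>F T in at_top. measure (orbit_average (Y s) T) (- Q) \<le> e)" by blast
    qed
  qed
qed

end

section \<open>Reduction of the theorem to contracting curves\<close>

text \<open>Positivity makes \<alpha> increasing. Squeezing \<open>n * t\<close> between consecutive
  integers bounds \<open>n\<close> times the deviation from linearity by \<open>\<alpha> 1\<close>
  for every \<open>n\<close>, so the deviation is 0.\<close>

lemma additive_pos_linear:
  fixes \<alpha> :: "real \<Rightarrow> real"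
  assumes add: "Modules.additive \<alpha>" and pos: "\<And>t. t > 0 \<Longrightarrow> \<alpha> t > 0"
  shows "\<alpha> t = \<alpha> 1 * t"
proof -
  interpret additive \<alpha> by (fact add)
  have mono: "\<alpha> s \<le> \<alpha> t" if "s \<le> t" for s t
    using pos[of "t - s"] diff[of t s] that by (cases "s = t") auto
  have nat: "\<alpha> (real n * t) = real n * \<alpha> t" for n t
    by (induction n) (simp_all add: zero add distrib_right)
  have int: "\<alpha> (of_int k) = of_int k * \<alpha> 1" for k
  proof (cases k)
    case (nonneg n)
    then show ?thesis using nat[of n 1] by simp
  next
    case (neg n)
    then have rk: "real_of_int k = - real (Suc n)" by simp
    have "\<alpha> (real (Suc n)) = real (Suc n) * \<alpha> 1" using nat[of "Suc n" 1] by (simp only: mult_1_right)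
    then show ?thesis by (simp only: rk minus mult_minus_left)
  qed
  have bound: "real n * \<bar>\<alpha> t - \<alpha> 1 * t\<bar> \<le> \<alpha> 1" for n
  proof -
    define k where "k = \<lfloor>real n * t\<rfloor>"
    have k: "of_int k \<le> real n * t" "real n * t \<le> of_int (k + 1)"
      using floor_correct[of "real n * t"] unfolding k_def by (auto intro: less_imp_le)
    have "of_int k * \<alpha> 1 \<le> real n * \<alpha> t" "real n * \<alpha> t \<le> of_int (k + 1) * \<alpha> 1"
      using mono[OF k(1)] mono[OF k(2)] unfolding int nat by auto
    moreover have "of_int k * \<alpha> 1 \<le> real n * t * \<alpha> 1" "real n * t * \<alpha> 1 \<le> of_int (k + 1) * \<alpha> 1"
      using k pos[of 1] by (auto intro!: mult_right_mono)
    ultimately have "\<bar>real n * \<alpha> t - real n * t * \<alpha> 1\<bar> \<le> \<alpha> 1"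
      by (simp add: distrib_right abs_le_iff)
    moreover have "real n * \<alpha> t - real n * t * \<alpha> 1 = real n * (\<alpha> t - \<alpha> 1 * t)" by (simp add: algebra_simps)
    ultimately show ?thesis by (simp add: abs_mult)
  qed
  have "\<bar>\<alpha> t - \<alpha> 1 * t\<bar> \<le> 0"
  proof (rule ccontr)
    assume "\<not> \<bar>\<alpha> t - \<alpha> 1 * t\<bar> \<le> 0"
    then obtain n :: nat where "\<alpha> 1 < real n * \<bar>\<alpha> t - \<alpha> 1 * t\<bar>"
      using reals_Archimedean3[of "\<bar>\<alpha> t - \<alpha> 1 * t\<bar>"] by auto
    with bound[of n] show False by simp
  qed
  then show ?thesis by simp
qed

text \<open>Against every vector orthogonal to \<open>V\<close> the curve has constant inner product
  0, so the derivative lies in the double orthogonal complement.\<close>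

lemma vector_derivative_in_subspace:
  fixes \<phi> :: "real \<Rightarrow> 'e::euclidean_space"
  assumes V: "subspace V" and \<phi>: "\<And>t. t \<in> S \<Longrightarrow> \<phi> t \<in> V" and s: "s \<in> S" "at s within S \<noteq> bot"
    and d: "(\<phi> has_vector_derivative w) (at s within S)"
  shows "w \<in> V"
proof -
  have "y \<bullet> w = 0" if y: "y \<in> orthogonal_comp V" for y
  proof -
    have "((\<lambda>t. y \<bullet> \<phi> t) has_vector_derivative (y \<bullet> w)) (at s within S)"
      using bounded_linear.has_vector_derivative[OF bounded_linear_inner_right d] .
    moreover have "((\<lambda>t. y \<bullet> \<phi> t) has_vector_derivative 0) (at s within S)"
    proof (rule has_vector_derivative_transform[OF s(1)])
      show "y \<bullet> \<phi> t = 0" if "t \<in> S" for t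
        using y \<phi>[OF that] by (auto simp: orthogonal_comp_def orthogonal_def inner_commute)
    qed simp
    ultimately show ?thesis using vector_derivative_unique_within[OF s(2)] by blast
  qed
  then have "w \<in> orthogonal_comp (orthogonal_comp V)"
    by (auto simp: orthogonal_comp_def orthogonal_def)
  then show ?thesis using orthogonal_comp_self[OF V] by simp
qed

text \<open>For the last estimate the mean value inequality is applied to
  \<open>\<phi> r - r * w s\<close> on the interval between \<open>s\<close> and \<open>s'\<close>
  only; there the derivative is at most \<open>C * \<bar>s' - s\<bar> powr \<gamma>\<close>.\<close>

lemma hoelder_curve_estimates:
  fixes \<phi> :: "real \<Rightarrow> 'e::euclidean_space"
  assumes diff: "\<And>s. s \<in> {-1..1} \<Longrightarrow> (\<phi> has_vector_derivative w s) (at s within {-1..1})"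
    and \<gamma>: "\<gamma> > 0" and C: "C \<ge> 0"
    and hoelder: "\<And>s r. \<lbrakk>s \<in> {-1..1}; r \<in> {-1..1}\<rbrakk> \<Longrightarrow> norm (w s - w r) \<le> C * \<bar>s - r\<bar> powr \<gamma>"
  shows "s \<in> {-1..1} \<Longrightarrow> norm (w s) \<le> norm (w 0) + C"
    and "\<lbrakk>s \<in> {-1..1}; s' \<in> {-1..1}\<rbrakk> \<Longrightarrow> norm (\<phi> s' - \<phi> s) \<le> (norm (w 0) + C) * \<bar>s' - s\<bar>"
    and "\<lbrakk>s \<in> {-1..1}; s' \<in> {-1..1}\<rbrakk> \<Longrightarrow>
      norm (\<phi> s' - \<phi> s - (s' - s) *\<^sub>R w s) \<le> C * \<bar>s' - s\<bar> powr (1 + \<gamma>)"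
proof -
  show w: "norm (w s) \<le> norm (w 0) + C" if s: "s \<in> {-1..1}" for s
  proof -
    have "norm (w s - w 0) \<le> C * \<bar>s - 0\<bar> powr \<gamma>" using hoelder[OF s, of 0] by simp
    also have "\<dots> \<le> C * 1 powr \<gamma>"
      using s C \<gamma> by (intro mult_left_mono powr_mono2) auto
    finally show ?thesis using norm_triangle_sub[of "w s" "w 0"] by simp
  qed
  show "norm (\<phi> s' - \<phi> s) \<le> (norm (w 0) + C) * \<bar>s' - s\<bar>" if s: "s \<in> {-1..1}" "s' \<in> {-1..1}"
  proof -
    have "norm (\<phi> s' - \<phi> s) \<le> (norm (w 0) + C) * norm (s' - s)"
    proof (rule differentiable_bound[of "{-1..1}" \<phi> "\<lambda>r h. h *\<^sub>R w r"])
      show "(\<phi> has_derivative (\<lambda>h. h *\<^sub>R w r)) (at r within {-1..1})" if "r \<in> {-1..1}" for r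
        using diff[OF that] by (simp only: has_vector_derivative_def)
      show "onorm (\<lambda>h. h *\<^sub>R w r) \<le> norm (w 0) + C" if "r \<in> {-1..1}" for r
        using mult_right_mono[OF w[OF that] abs_ge_zero] by (intro onorm_le) (simp add: mult.commute)
    qed (use s in auto)
    then show ?thesis by simp
  qed
  show "norm (\<phi> s' - \<phi> s - (s' - s) *\<^sub>R w s) \<le> C * \<bar>s' - s\<bar> powr (1 + \<gamma>)" if s: "s \<in> {-1..1}" "s' \<in> {-1..1}"
  proof -
    let ?S = "{min s s'..max s s'}"
    have sub: "?S \<subseteq> {-1..1}" using s by auto
    have "norm ((\<phi> s' - s' *\<^sub>R w s) - (\<phi> s - s *\<^sub>R w s)) \<le> (C * \<bar>s' - s\<bar> powr \<gamma>) * norm (s' - s)"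
    proof (rule differentiable_bound[of ?S "\<lambda>r. \<phi> r - r *\<^sub>R w s" "\<lambda>r h. h *\<^sub>R w r - h *\<^sub>R w s"])
      fix r assume r: "r \<in> ?S"
      then have r1: "r \<in> {-1..1}" using sub by blast
      have "(\<phi> has_derivative (\<lambda>h. h *\<^sub>R w r)) (at r within ?S)"
        using has_derivative_subset[OF diff[OF r1, unfolded has_vector_derivative_def] sub] .
      then show "((\<lambda>r. \<phi> r - r *\<^sub>R w s) has_derivative (\<lambda>h. h *\<^sub>R w r - h *\<^sub>R w s)) (at r within ?S)"
        by (auto intro!: derivative_eq_intros)
      have "norm (w r - w s) \<le> C * \<bar>r - s\<bar> powr \<gamma>" by (rule hoelder[OF r1 s(1)])
      also have "\<dots> \<le> C * \<bar>s' - s\<bar> powr \<gamma>"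
        using r C \<gamma> by (intro mult_left_mono powr_mono2) auto
      finally have wl: "norm (w r - w s) \<le> C * \<bar>s' - s\<bar> powr \<gamma>" .
      have "norm (h *\<^sub>R (w r - w s)) \<le> (C * \<bar>s' - s\<bar> powr \<gamma>) * norm h" for h
        using mult_right_mono[OF wl, of "norm h"] by (simp add: mult.commute)
      then show "onorm (\<lambda>h. h *\<^sub>R w r - h *\<^sub>R w s) \<le> C * \<bar>s' - s\<bar> powr \<gamma>"
        unfolding scaleR_diff_right[symmetric] by (rule onorm_le)
    qed auto
    also have "(C * \<bar>s' - s\<bar> powr \<gamma>) * norm (s' - s) = C * \<bar>s' - s\<bar> powr (1 + \<gamma>)"
      by (cases "s = s'") (simp_all add: powr_add)
    also have "(\<phi> s' - s' *\<^sub>R w s) - (\<phi> s - s *\<^sub>R w s) = \<phi> s' - \<phi> s - (s' - s) *\<^sub>R w s"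
      by (simp add: scaleR_diff_left)
    finally show ?thesis .
  qed
qed

theorem theorem4p3:
  fixes A :: "('g::{group_mult, t2_space, second_countable_topology}, 'e::euclidean_space) chart set"
    and c :: "('g, 'e) chart"
    and act :: "'g \<Rightarrow> 'x::metric_space \<Rightarrow> 'x"
    and g :: "real \<Rightarrow> 'g"
    and \<alpha> :: "real \<Rightarrow> real"
    and \<phi> :: "real \<Rightarrow> 'e"
    and \<beta> :: real
    and f :: "'x \<Rightarrow> ennreal"
    and x :: 'x
  assumes "lie_group A" and "connected (UNIV :: 'g set)" and "identity_chart A c"
    and "continuous_action act"
    and "one_parameter_subgroup g" and "\<exists>t. g t \<noteq> 1" and "Ad_diagonalizable c g"
    and "admissible_curve c g \<alpha> \<phi>"
    and "\<beta> > 0" and "contraction_height c act g \<alpha> \<phi> \<beta> f"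
    and "f x \<noteq> \<infinity>"
  shows "hausdorff_dim {s \<in> {-1..1}.
           divergent_on_average (\<lambda>t. act (g t) (act (lie_exp c (\<phi> s)) x))} \<le> ereal (1 - \<beta>) \<and>
         (AE s in lebesgue. s \<in> {-1..1} \<longrightarrow>
           weak_star_limits_are_probabilities
             (orbit_average (\<lambda>t. act (g t) (act (lie_exp c (\<phi> s)) x))))"
proof -
  note L = assms(1) and c = assms(3)
  let ?u = "lie_exp c" and ?w = "velocity \<phi>"
  have act_one: "act 1 y = y" and act_mult: "act (h * k) y = act h (act k y)"
    and act_cont: "continuous_on UNIV (\<lambda>(h, y). act h y)" for h k y
    using assms(4) by (auto simp: continuous_action_def)
  have g_add: "g (s + t) = g s * g t" and g_cont: "continuous_on UNIV g" for s t
    using assms(5) by (auto simp: one_parameter_subgroup_def)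
  note adm = assms(8)[unfolded admissible_curve_def]
  note diff = bspec[OF adm[THEN conjunct1]]
  from adm[THEN conjunct2, THEN conjunct1] obtain \<gamma> C0 where \<gamma>: "\<gamma> > 0"
    and hoelder: "\<And>s r. \<lbrakk>s \<in> {-1..1}; r \<in> {-1..1}\<rbrakk> \<Longrightarrow> norm (?w s - ?w r) \<le> C0 * \<bar>s - r\<bar> powr \<gamma>"
    by blast
  have \<alpha>: "Modules.additive \<alpha>" "\<And>t. t > 0 \<Longrightarrow> \<alpha> t > 0"
    using adm[THEN conjunct2, THEN conjunct2, THEN conjunct1]
      adm[THEN conjunct2, THEN conjunct2, THEN conjunct2, THEN conjunct1] by blast+
  from adm[THEN conjunct2, THEN conjunct2, THEN conjunct2, THEN conjunct2, THEN conjunct1]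
  obtain V where V: "subspace V" "V \<subseteq> Ad_eigenspace c g \<alpha>" "\<And>v v'. \<lbrakk>v \<in> V; v' \<in> V\<rbrakk> \<Longrightarrow> lie_bracket c v v' = 0"
    and \<phi>V: "\<phi> ` {-1..1} \<subseteq> V"
    by blast
  have \<alpha>_eq: "\<alpha> t = \<alpha> 1 * t" for t by (rule additive_pos_linear[OF \<alpha>])
  \<comment> \<open>The Hoelder constant is given without a sign.\<close>
  define C where "C = \<bar>C0\<bar>"
  have C: "C \<ge> 0" by (simp add: C_def)
  have hoelder': "norm (?w s - ?w r) \<le> C * \<bar>s - r\<bar> powr \<gamma>" if "s \<in> {-1..1}" "r \<in> {-1..1}" for s r
    using hoelder[OF that] mult_right_mono[OF abs_ge_self[of C0], of "\<bar>s - r\<bar> powr \<gamma>"]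
    unfolding C_def by simp
  have der: "(\<phi> has_vector_derivative ?w s) (at s within {-1..1})" if "s \<in> {-1..1}" for s
    using diff[OF that] unfolding velocity_def by (simp add: vector_derivative_works)
  note est = hoelder_curve_estimates[of \<phi> ?w, OF der \<gamma> C hoelder']
  have wV: "?w s \<in> V" if s: "s \<in> {-1..1}" for s
  proof (rule vector_derivative_in_subspace[OF V(1) _ s _ der[OF s]])
    show "at s within {-1..1} \<noteq> bot"
      using s by (simp add: trivial_limit_within)
  qed (use \<phi>V in auto)
  note ch = assms(10)[unfolded contraction_height_def, THEN conjunct2, THEN conjunct2]
  note inv = spec[OF ch[THEN conjunct1]]
  note ch' = ch[THEN conjunct2, THEN conjunct2]
  note bnd = ch'[THEN conjunct1, rule_format]
  note con = ch'[THEN conjunct2, THEN conjunct1]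
  note proper = ch'[THEN conjunct2, THEN conjunct2, rule_format]
  obtain a where a: "a \<ge> 1" and con: "\<And>t. t > 0 \<Longrightarrow> \<exists>b>0::real. \<forall>y. \<forall>s\<in>{-1..1}.
        ennreal (1 / 2) * (\<integral>\<^sup>+ r\<in>{-1..1}. f (act (g t) (act (?u (r *\<^sub>R ?w s)) y)) \<partial>lborel)
        \<le> ennreal (a * exp (- \<beta> * \<alpha> t)) * f y + ennreal b"
    using con by blast
  \<comment> \<open>The set of infinite height is invariant, so applying \<open>inverse h\<close>
    would carry infinite height back to \<open>y\<close>.\<close>
  have fin: "f (act h y) \<noteq> \<infinity>" if "f y \<noteq> \<infinity>" for h y
  proof
    assume "f (act h y) = \<infinity>"
    then have "act (inverse h) (act h y) \<in> {y. f y = \<infinity>}" using inv[of "inverse h"] by blast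
    then show False using that by (simp add: act_mult[symmetric] group_left_inverse act_one)
  qed
  obtain N :: "'g set" where N: "compact N" "1 \<in> interior N"
    by (rule lie_group_compact_neighbourhood[OF L c]) (rule that)
  have bnd': "\<exists>K\<ge>1::real. \<forall>h\<in>S. \<forall>y. ennreal (inverse K) * f y \<le> f (act h y) \<and> f (act h y) \<le> ennreal K * f y"
    if S: "compact S" for S
  proof -
    have NS: "compact (N \<union> S)" using N(1) S by (rule compact_Un)
    then have "compact (closure (N \<union> S))"
      by (simp only: closure_closed[OF compact_imp_closed[OF NS]])
    moreover have "1 \<in> interior (N \<union> S)" using N(2) interior_mono[of N "N \<union> S"] by blast
    ultimately obtain K :: real where "K \<ge> 1" "\<forall>h\<in>N \<union> S. \<forall>y. ennreal (inverse K) * f y \<le> f (act h y) \<and> f (act h y) \<le> ennreal K * f y"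
      using bnd by blast
    then show ?thesis by blast
  qed
  interpret contracting_curve "\<lambda>t. act (g t)" "\<lambda>v. act (?u v)" V "\<alpha> 1" \<beta> \<gamma> C "norm (?w 0) + C" a f \<phi> ?w x
  proof
    show "subspace V" by (fact V)
    show "act (?u 0) y = y" for y by (simp add: lie_exp_zero[OF L c] act_one)
    show "act (?u (v + v')) y = act (?u v) (act (?u v') y)" if "v \<in> V" "v' \<in> V" for v v' y
      using lie_exp_add[OF L c V(3)[OF that]] by (simp add: act_mult)
    show "act (g (s + t)) y = act (g s) (act (g t) y)" for s t y by (simp add: g_add act_mult)
    show "act (g t) (act (?u v) y) = act (?u (exp (\<alpha> 1 * t) *\<^sub>R v)) (act (g t) y)" if v: "v \<in> V" for v t y
    proof -
      have "g t * ?u v * inverse (g t) = ?u (exp (\<alpha> 1 * t) *\<^sub>R v)"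
        using lie_exp_eigen_conj[OF L c assms(5) \<alpha>(1), of v t] V(2) v \<alpha>_eq[of t] by auto
      then have "g t * ?u v = ?u (exp (\<alpha> 1 * t) *\<^sub>R v) * g t"
        by (metis group_left_inverse mult.assoc mult_1_right)
      then show ?thesis by (simp add: act_mult[symmetric])
    qed
    show "\<alpha> 1 > 0" "\<beta> > 0" "\<gamma> > 0" "C \<ge> 0" "a \<ge> 1" using \<alpha>(2)[of 1] assms(9) \<gamma> C a by auto
    show "continuous_on UNIV (\<lambda>t. act (g t) y)" for y
      using continuous_on_compose2[OF act_cont continuous_on_Pair[OF g_cont continuous_on_const], of y] by simp
    show "f (act (?u v) y) \<noteq> \<infinity>" "f (act (g t) y) \<noteq> \<infinity>" if "f y \<noteq> \<infinity>" for v t y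
      using fin[OF that] by auto
    show "f x \<noteq> \<infinity>" by (fact assms)
    show "compact (closure {y. f y \<le> ennreal M})" if "M \<ge> 1" for M by (rule proper[OF that])
    show "\<exists>K\<ge>1. \<forall>v\<in>V. norm v \<le> R \<longrightarrow>
      (\<forall>y. ennreal (inverse K) * f y \<le> f (act (?u v) y) \<and> f (act (?u v) y) \<le> ennreal K * f y)" for R
    proof -
      have "compact (?u ` cball 0 R)"
        by (intro compact_continuous_image continuous_on_subset[OF continuous_lie_exp[OF L c]]) auto
      from bnd'[OF this] obtain K :: real where K: "K \<ge> 1" "\<And>h. h \<in> ?u ` cball 0 R \<Longrightarrow>
        \<forall>y. ennreal (inverse K) * f y \<le> f (act h y) \<and> f (act h y) \<le> ennreal K * f y"
        by blast
      have "?u v \<in> ?u ` cball 0 R" if "norm v \<le> R" for v using that by (intro imageI) simp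
      then show ?thesis using K by blast
    qed
    show "\<exists>K\<ge>1. \<forall>\<tau>\<in>{0..t}. \<forall>y. f (act (g \<tau>) y) \<le> ennreal K * f y" for t
    proof -
      have "compact (g ` {0..t})"
        by (intro compact_continuous_image continuous_on_subset[OF g_cont]) auto
      from bnd'[OF this] show ?thesis by blast
    qed
    show "\<exists>b>0. \<forall>y. \<forall>s\<in>{-1..1}.
        ennreal (1 / 2) * (\<integral>\<^sup>+ r\<in>{-1..1}. f (act (g t) (act (?u (r *\<^sub>R ?w s)) y)) \<partial>lborel)
        \<le> ennreal (a * exp (- \<beta> * (\<alpha> 1 * t))) * f y + ennreal b" if "t > 0" for t
      using con[OF that] unfolding \<alpha>_eq[of t] .
    show "\<phi> s \<in> V" "?w s \<in> V" if "s \<in> {-1..1}" for s using \<phi>V wV that by auto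
  qed (use est in blast)+
  have Y_eq: "Y s = (\<lambda>t. act (g t) (act (?u (\<phi> s)) x))" for s by (simp add: Y_def fun_eq_iff)
  show ?thesis
    using hausdorff_dim_divergent AE_weak_star_limits unfolding Y_eq by blast
qed

end
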